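(* Let $C$ be any coalgebra over a field $K$, and let $C_\infty$ be the coalgebra containing $C$ as a subcoalgebra which is constructed from $C$ in the context. Then every finite dimensional right $C_\infty$-comodule is a quotient (as a right $C_\infty$-comodule) of $C_\infty$. Consequently, $C_\infty$ satisfies the right generating condition, i.e. every right $C_\infty$-comodule is a quotient of a direct sum of copies of the right $C_\infty$-comodule $C_\infty$.
   Context: Construction of $C'$ from a coalgebra $(C,\Delta,\varepsilon)$ over a field $K$. For a finite dimensional right $C$-comodule $(M,\rho_M)$, let $\mathrm{End}(M^C)$ be the finite dimensional algebra of right $C$-comodule endomorphisms of $M$, with multiplication the opposite of composition, so that $M$ is a right $\mathrm{End}(M^C)$-module via $m\cdot f=f(m)$. Let $(A_M,\delta_M,e_M)$ be the finite dimensional coalgebra dual to this algebra (so $A_M^*=\mathrm{End}(M^C)$ with convolution product). The right $\mathrm{End}(M^C)$-module structure corresponds to a left $A_M$-comodule structure $r_M:M\to A_M\otimes M$, $r_M(m)=m_{(-1)}\otimes m_{(0)}$, determined by $f(m)=f(m_{(-1)})\,m_{(0)}$ for $f\in \mathrm{End}(M^C)=A_M^*$; with it $M$ is an $A_M$-$C$-bicomodule. Let $\mathcal R(C)$ be a set of representatives of the isomorphism types of finite dimensional right $C$-comodules, and put, as a vector space, $$C'=\Big(\bigoplus_{M\in\mathcal R(C)}A_M\Big)\oplus\Big(\bigoplus_{M\in\mathcal R(C)}M\Big)\oplus C .$$ Define $\delta:C'\to C'\otimes C'$ and $e:C'\to K$ by: $\delta(a)=\delta_M(a)\in A_M\otimes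 A_M$ and $e(a)=e_M(a)$ for $a\in A_M$; $\delta(m)=r_M(m)+\rho_M(m)\in A_M\otimes M+M\otimes C$ and $e(m)=0$ for $m\in M$, $M\in\mathcal R(C)$; $\delta(c)=\Delta(c)\in C\otimes C$ and $e(c)=\varepsilon(c)$ for $c\in C$. Then $(C',\delta,e)$ is a coalgebra containing $C$ as a subcoalgebra. Construction of $C_\infty$: put $C^{(0)}=C$, $C^{(n+1)}=(C^{(n)})'$ for $n\ge 0$, and $C_\infty=\bigcup_{n\ge 1}C^{(n)}$, with the comultiplication and counit whose restrictions to each $C^{(n)}$ are those of $C^{(n)}$. *)

theory Defs
  imports Complex_Main "HOL-Library.Function_Algebras" "HOL-Library.Product_Plus"
begin

section \<open>Vector spaces and tensor products over a field\<close>

text \<open>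
  A vector space is a subspace (the carrier) of an ambient type that is itself a vector space
  for the given scalar multiplication.
\<close>

record ('k, 'v) vspace =
  carrier :: "'v set"
  smult :: "'k \<Rightarrow> 'v \<Rightarrow> 'v"

definition vspace :: "('k::field, 'v::ab_group_add, 'z) vspace_scheme \<Rightarrow> bool" where
  "vspace V \<longleftrightarrow> vector_space (smult V) \<and> module.subspace (smult V) (carrier V)"

definition finite_dim :: "('k::field, 'v::ab_group_add, 'z) vspace_scheme \<Rightarrow> bool" where
  "finite_dim V \<longleftrightarrow> (\<exists>B. finite B \<and> carrier V = module.span (smult V) B)"

definition ground :: "('k::field, 'k) vspace" where
  "ground = \<lparr>carrier = UNIV, smult = (*)\<rparr>"

definition linear_map ::
  "('k::field, 'v::ab_group_add, 'y) vspace_scheme \<Rightarrow> ('k, 'w::ab_group_add, 'z) vspace_scheme \<Rightarrow>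
    ('v \<Rightarrow> 'w) \<Rightarrow> bool" where
  "linear_map V W f \<longleftrightarrow>
     (\<forall>x\<in>carrier V. f x \<in> carrier W) \<and>
     (\<forall>x\<in>carrier V. \<forall>y\<in>carrier V. f (x + y) = f x + f y) \<and>
     (\<forall>a. \<forall>x\<in>carrier V. f (smult V a x) = smult W a (f x))"

text \<open>
  Over a field the canonical map sending \<open>v \<otimes> w\<close> to the form \<open>(f, g) \<mapsto> f v * g w\<close> on pairs of
  linear functionals of the ambient spaces is injective, and the tensor product of subspaces
  embeds into that of the ambient spaces. So the tensor product of \<open>V\<close> and \<open>W\<close> is modelled as the
  space of functions on pairs of functionals that is spanned by the forms \<open>v \<otimes> w\<close> with \<open>v\<close> in
  \<open>V\<close> and \<open>w\<close> in \<open>W\<close>. In particular the tensor product of a subspace is literally contained in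
  that of the larger space.
\<close>

type_synonym ('k, 'v, 'w) tensor = "('v \<Rightarrow> 'k) \<Rightarrow> ('w \<Rightarrow> 'k) \<Rightarrow> 'k"

definition tens ::
  "('k::field, 'v::ab_group_add, 'y) vspace_scheme \<Rightarrow> ('k, 'w::ab_group_add, 'z) vspace_scheme \<Rightarrow>
    'v \<Rightarrow> 'w \<Rightarrow> ('k, 'v, 'w) tensor" where
  "tens V W v w = (\<lambda>f g. if Vector_Spaces.linear (smult V) (*) f \<and> Vector_Spaces.linear (smult W) (*) g
                         then f v * g w else 0)"

definition tensor_smult :: "'k::field \<Rightarrow> ('k, 'v, 'w) tensor \<Rightarrow> ('k, 'v, 'w) tensor" where
  "tensor_smult a t = (\<lambda>f g. a * t f g)"

definition tensor_prod ::
  "('k::field, 'v::ab_group_add, 'y) vspace_scheme \<Rightarrow> ('k, 'w::ab_group_add, 'z) vspace_scheme \<Rightarrow>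
    ('k, ('k, 'v, 'w) tensor) vspace" where
  "tensor_prod V W =
     \<lparr>carrier = module.span tensor_smult {tens V W v w | v w. v \<in> carrier V \<and> w \<in> carrier W},
      smult = tensor_smult\<rparr>"

text \<open>
  The universal property: for \<open>\<beta>\<close> bilinear on \<open>V \<times> W\<close>, the value at \<open>t = \<Sum> v\<^sub>i \<otimes> w\<^sub>i\<close> of the
  linear map induced by \<open>\<beta>\<close> is \<open>\<Sum> \<beta> v\<^sub>i w\<^sub>i\<close>.
\<close>

definition tensor_lift ::
  "('k::field, 'v::ab_group_add, 'y) vspace_scheme \<Rightarrow> ('k, 'w::ab_group_add, 'z) vspace_scheme \<Rightarrow>
    ('v \<Rightarrow> 'w \<Rightarrow> 'x::ab_group_add) \<Rightarrow> ('k, 'v, 'w) tensor \<Rightarrow> 'x" where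
  "tensor_lift V W \<beta> t =
     (THE s. \<exists>xs. set xs \<subseteq> carrier V \<times> carrier W \<and>
        t = (\<Sum>(v, w)\<leftarrow>xs. tens V W v w) \<and> s = (\<Sum>(v, w)\<leftarrow>xs. \<beta> v w))"

definition tensor_map ::
  "('k::field, 'v::ab_group_add, 'p) vspace_scheme \<Rightarrow> ('k, 'w::ab_group_add, 'q) vspace_scheme \<Rightarrow>
   ('k, 'v2::ab_group_add, 'r) vspace_scheme \<Rightarrow> ('k, 'w2::ab_group_add, 's) vspace_scheme \<Rightarrow>
    ('v \<Rightarrow> 'v2) \<Rightarrow> ('w \<Rightarrow> 'w2) \<Rightarrow> ('k, 'v, 'w) tensor \<Rightarrow> ('k, 'v2, 'w2) tensor" where
  "tensor_map V W V2 W2 f g = tensor_lift V W (\<lambda>v w. tens V2 W2 (f v) (g w))"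

definition tensor_assoc ::
  "('k::field, 'u::ab_group_add, 'p) vspace_scheme \<Rightarrow> ('k, 'v::ab_group_add, 'q) vspace_scheme \<Rightarrow>
   ('k, 'w::ab_group_add, 'r) vspace_scheme \<Rightarrow>
    ('k, ('k, 'u, 'v) tensor, 'w) tensor \<Rightarrow> ('k, 'u, ('k, 'v, 'w) tensor) tensor" where
  "tensor_assoc U V W =
     tensor_lift (tensor_prod U V) W
       (\<lambda>s w. tensor_lift U V (\<lambda>u v. tens U (tensor_prod V W) u (tens V W v w)) s)"


section \<open>Coalgebras and right comodules\<close>

record ('k, 'v) coalgebra = "('k, 'v) vspace" +
  comult :: "'v \<Rightarrow> ('k, 'v, 'v) tensor"
  counit :: "'v \<Rightarrow> 'k"

definition coalgebra :: "('k::field, 'v::ab_group_add) coalgebra \<Rightarrow> bool" where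
  "coalgebra C \<longleftrightarrow>
     vspace C \<and> linear_map C (tensor_prod C C) (comult C) \<and> linear_map C ground (counit C) \<and>
     (\<forall>c\<in>carrier C.
        tensor_assoc C C C (tensor_map C C (tensor_prod C C) C (comult C) id (comult C c)) =
          tensor_map C C C (tensor_prod C C) id (comult C) (comult C c) \<and>
        tensor_lift C C (\<lambda>x y. smult C (counit C x) y) (comult C c) = c \<and>
        tensor_lift C C (\<lambda>x y. smult C (counit C y) x) (comult C c) = c)"

definition coalgebra_iso ::
  "('k::field, 'v::ab_group_add) coalgebra \<Rightarrow> ('k, 'w::ab_group_add) coalgebra \<Rightarrow>
    ('v \<Rightarrow> 'w) \<Rightarrow> bool" where
  "coalgebra_iso C D f \<longleftrightarrow>
     linear_map C D f \<and> bij_betw f (carrier C) (carrier D) \<and>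
     (\<forall>c\<in>carrier C. comult D (f c) = tensor_map C C D D f f (comult C c) \<and>
                     counit D (f c) = counit C c)"

record ('k, 'm, 'v) comodule = "('k, 'm) vspace" +
  coact :: "'m \<Rightarrow> ('k, 'm, 'v) tensor"

definition comodule ::
  "('k::field, 'v::ab_group_add) coalgebra \<Rightarrow> ('k, 'm::ab_group_add, 'v) comodule \<Rightarrow> bool" where
  "comodule C M \<longleftrightarrow>
     vspace M \<and> linear_map M (tensor_prod M C) (coact M) \<and>
     (\<forall>m\<in>carrier M.
        tensor_assoc M C C (tensor_map M C (tensor_prod M C) C (coact M) id (coact M m)) =
          tensor_map M C M (tensor_prod C C) id (comult C) (coact M m) \<and>
        tensor_lift M C (\<lambda>x c. smult M (counit C c) x) (coact M m) = m)"

definition comodule_hom ::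
  "('k::field, 'v::ab_group_add) coalgebra \<Rightarrow> ('k, 'm::ab_group_add, 'v) comodule \<Rightarrow>
   ('k, 'n::ab_group_add, 'v) comodule \<Rightarrow> ('m \<Rightarrow> 'n) \<Rightarrow> bool" where
  "comodule_hom C M N f \<longleftrightarrow>
     linear_map M N f \<and>
     (\<forall>m\<in>carrier M. coact N (f m) = tensor_map M C N C f id (coact M m))"

definition comodule_isomorphic ::
  "('k::field, 'v::ab_group_add) coalgebra \<Rightarrow> ('k, 'm::ab_group_add, 'v) comodule \<Rightarrow>
   ('k, 'n::ab_group_add, 'v) comodule \<Rightarrow> bool" where
  "comodule_isomorphic C M N \<longleftrightarrow>
     (\<exists>f. comodule_hom C M N f \<and> bij_betw f (carrier M) (carrier N))"

definition is_quotient ::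
  "('k::field, 'v::ab_group_add) coalgebra \<Rightarrow> ('k, 'n::ab_group_add, 'v) comodule \<Rightarrow>
   ('k, 'm::ab_group_add, 'v) comodule \<Rightarrow> bool" where
  "is_quotient C N M \<longleftrightarrow> (\<exists>f. comodule_hom C M N f \<and> f ` carrier M = carrier N)"

definition regular_comodule :: "('k, 'v) coalgebra \<Rightarrow> ('k, 'v, 'v) comodule" where
  "regular_comodule C = \<lparr>carrier = carrier C, smult = smult C, coact = comult C\<rparr>"

definition single :: "'i \<Rightarrow> 'v::zero \<Rightarrow> 'i \<Rightarrow> 'v" where
  "single i x = (\<lambda>j. if j = i then x else 0)"

definition copies_space ::
  "'i set \<Rightarrow> ('k::field, 'm::ab_group_add, 'z) vspace_scheme \<Rightarrow> ('k, 'i \<Rightarrow> 'm) vspace" where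
  "copies_space I M =
     \<lparr>carrier = {x. finite {i. x i \<noteq> 0} \<and> (\<forall>i\<in>I. x i \<in> carrier M) \<and> (\<forall>i. i \<notin> I \<longrightarrow> x i = 0)},
      smult = (\<lambda>a x i. smult M a (x i))\<rparr>"

text \<open>The direct sum of copies of \<open>M\<close> indexed by \<open>I\<close>.\<close>

definition copies ::
  "('k::field, 'v::ab_group_add) coalgebra \<Rightarrow> 'i set \<Rightarrow> ('k, 'm::ab_group_add, 'v) comodule \<Rightarrow>
    ('k, 'i \<Rightarrow> 'm, 'v) comodule" where
  "copies C I M =
     \<lparr>carrier = carrier (copies_space I M), smult = smult (copies_space I M),
      coact = (\<lambda>x. \<Sum>i | x i \<noteq> 0.
                 tensor_map M C (copies_space I M) C (single i) id (coact M (x i)))\<rparr>"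


section \<open>The coalgebra dual to the endomorphism algebra of a comodule\<close>

record ('k, 'v) algebra = "('k, 'v) vspace" +
  mult :: "'v \<Rightarrow> 'v \<Rightarrow> 'v"
  unit :: 'v

definition dual_space :: "('k::field, 'v::ab_group_add, 'z) vspace_scheme \<Rightarrow> ('k, 'v \<Rightarrow> 'k) vspace" where
  "dual_space V =
     \<lparr>carrier = {\<alpha>. linear_map V ground \<alpha> \<and> (\<forall>x. x \<notin> carrier V \<longrightarrow> \<alpha> x = 0)},
      smult = (\<lambda>a \<alpha> x. a * \<alpha> x)\<rparr>"

text \<open>
  For a finite dimensional algebra \<open>E\<close>, the comultiplication \<open>\<alpha> \<mapsto> \<Sum> \<alpha>\<^sub>1 \<otimes> \<alpha>\<^sub>2\<close> of the dual
  coalgebra is determined by \<open>\<Sum> \<alpha>\<^sub>1 f * \<alpha>\<^sub>2 g = \<alpha> (f g)\<close>, that is, the product of \<open>E\<close> is the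
  convolution product.
\<close>

definition dual_coalgebra :: "('k::field, 'v::ab_group_add) algebra \<Rightarrow> ('k, 'v \<Rightarrow> 'k) coalgebra" where
  "dual_coalgebra E =
     \<lparr>carrier = carrier (dual_space E), smult = smult (dual_space E),
      comult = (\<lambda>\<alpha>. THE t. t \<in> carrier (tensor_prod (dual_space E) (dual_space E)) \<and>
        (\<forall>f\<in>carrier E. \<forall>g\<in>carrier E.
           tensor_lift (dual_space E) (dual_space E) (\<lambda>\<alpha>1 \<alpha>2. \<alpha>1 f * \<alpha>2 g) t = \<alpha> (mult E f g))),
      counit = (\<lambda>\<alpha>. \<alpha> (unit E))\<rparr>"

text \<open>
  Endomorphisms are normalised to vanish outside the carrier of \<open>M\<close>. The product is the
  opposite of composition.
\<close>

definition end_algebra ::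
  "('k::field, 'v::ab_group_add) coalgebra \<Rightarrow> ('k, 'm::ab_group_add, 'v) comodule \<Rightarrow>
    ('k, 'm \<Rightarrow> 'm) algebra" where
  "end_algebra C M =
     \<lparr>carrier = {f. comodule_hom C M M f \<and> (\<forall>m. m \<notin> carrier M \<longrightarrow> f m = 0)},
      smult = (\<lambda>a f m. smult M a (f m)),
      mult = (\<lambda>f g. g \<circ> f),
      unit = (\<lambda>m. if m \<in> carrier M then m else 0)\<rparr>"

definition end_coalgebra ::
  "('k::field, 'v::ab_group_add) coalgebra \<Rightarrow> ('k, 'm::ab_group_add, 'v) comodule \<Rightarrow>
    ('k, ('m \<Rightarrow> 'm) \<Rightarrow> 'k) coalgebra" where
  "end_coalgebra C M = dual_coalgebra (end_algebra C M)"

text \<open>The left coaction \<open>r\<^sub>M\<close>, determined by \<open>f m = \<Sum> f m\<^sub>-\<^sub>1 \<cdot> m\<^sub>0\<close> for all endomorphisms \<open>f\<close>.\<close>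

definition left_coact ::
  "('k::field, 'v::ab_group_add) coalgebra \<Rightarrow> ('k, 'm::ab_group_add, 'v) comodule \<Rightarrow>
    'm \<Rightarrow> ('k, ('m \<Rightarrow> 'm) \<Rightarrow> 'k, 'm) tensor" where
  "left_coact C M m =
     (THE t. t \<in> carrier (tensor_prod (end_coalgebra C M) M) \<and>
        (\<forall>f\<in>carrier (end_algebra C M).
           tensor_lift (end_coalgebra C M) M (\<lambda>\<alpha> x. smult M (\<alpha> f) x) t = f m))"


section \<open>The coalgebra \<open>C'\<close>\<close>

text \<open>
  Every finite dimensional vector space is isomorphic to a subspace of \<open>K\<^sup>\<nat>\<close>, so the finite
  dimensional comodules on such subspaces represent all isomorphism types.
\<close>

type_synonym ('k, 'v) coord_comodule = "('k, nat \<Rightarrow> 'k, 'v) comodule"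

definition fd_coord_comodules ::
  "('k::field, 'v::ab_group_add) coalgebra \<Rightarrow> ('k, 'v) coord_comodule set" where
  "fd_coord_comodules C = {M. comodule C M \<and> finite_dim M \<and> smult M = (\<lambda>a x i. a * x i)}"

definition representatives ::
  "('k::field, 'v::ab_group_add) coalgebra \<Rightarrow> ('k, 'v) coord_comodule set \<Rightarrow> bool" where
  "representatives C R \<longleftrightarrow>
     R \<subseteq> fd_coord_comodules C \<and>
     (\<forall>M\<in>fd_coord_comodules C. \<exists>!N. N \<in> R \<and> comodule_isomorphic C M N)"

text \<open>
  Elements of \<open>C'\<close> are triples \<open>(\<alpha>, \<mu>, c)\<close> where \<open>\<alpha>\<close> and \<open>\<mu>\<close> are finitely supported families with
  \<open>\<alpha> M\<close> in the dual coalgebra of the endomorphism algebra of \<open>M\<close> and \<open>\<mu> M\<close> in \<open>M\<close>, for \<open>M\<close> in \<open>R\<close>.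
\<close>

type_synonym ('k, 'v) prime_elem =
  "(('k, 'v) coord_comodule \<Rightarrow> ((nat \<Rightarrow> 'k) \<Rightarrow> (nat \<Rightarrow> 'k)) \<Rightarrow> 'k) \<times>
   (('k, 'v) coord_comodule \<Rightarrow> (nat \<Rightarrow> 'k)) \<times> 'v"

definition prime_space ::
  "('k::field, 'v::ab_group_add) coord_comodule set \<Rightarrow> ('k, 'v) coalgebra \<Rightarrow>
    ('k, ('k, 'v) prime_elem) vspace" where
  "prime_space R C =
     \<lparr>carrier = {(\<alpha>, \<mu>, c).
        finite {M. \<alpha> M \<noteq> 0} \<and> finite {M. \<mu> M \<noteq> 0} \<and>
        (\<forall>M\<in>R. \<alpha> M \<in> carrier (end_coalgebra C M) \<and> \<mu> M \<in> carrier M) \<and>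
        (\<forall>M. M \<notin> R \<longrightarrow> \<alpha> M = 0 \<and> \<mu> M = 0) \<and> c \<in> carrier C},
      smult = (\<lambda>a (\<alpha>, \<mu>, c). (\<lambda>M f. a * \<alpha> M f, \<lambda>M i. a * \<mu> M i, smult C a c))\<rparr>"

definition in_end :: "('k, 'v) coord_comodule \<Rightarrow> (((nat \<Rightarrow> 'k) \<Rightarrow> (nat \<Rightarrow> 'k)) \<Rightarrow> 'k) \<Rightarrow>
    ('k::field, 'v::ab_group_add) prime_elem" where
  "in_end M a = (single M a, 0, 0)"

definition in_mod :: "('k, 'v) coord_comodule \<Rightarrow> (nat \<Rightarrow> 'k) \<Rightarrow>
    ('k::field, 'v::ab_group_add) prime_elem" where
  "in_mod M m = (0, single M m, 0)"

definition in_base :: "'v \<Rightarrow> ('k::field, 'v::ab_group_add) prime_elem" where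
  "in_base c = (0, 0, c)"

definition prime_coalgebra ::
  "('k::field, 'v::ab_group_add) coord_comodule set \<Rightarrow> ('k, 'v) coalgebra \<Rightarrow>
    ('k, ('k, 'v) prime_elem) coalgebra" where
  "prime_coalgebra R C =
     \<lparr>carrier = carrier (prime_space R C), smult = smult (prime_space R C),
      comult = (\<lambda>(\<alpha>, \<mu>, c).
        (\<Sum>M | \<alpha> M \<noteq> 0.
           tensor_map (end_coalgebra C M) (end_coalgebra C M) (prime_space R C) (prime_space R C)
             (in_end M) (in_end M) (comult (end_coalgebra C M) (\<alpha> M))) +
        (\<Sum>M | \<mu> M \<noteq> 0.
           tensor_map (end_coalgebra C M) M (prime_space R C) (prime_space R C)
             (in_end M) (in_mod M) (left_coact C M (\<mu> M)) +
           tensor_map M C (prime_space R C) (prime_space R C)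
             (in_mod M) in_base (coact M (\<mu> M))) +
        tensor_map C C (prime_space R C) (prime_space R C) in_base in_base (comult C c)),
      counit = (\<lambda>(\<alpha>, \<mu>, c). (\<Sum>M | \<alpha> M \<noteq> 0. counit (end_coalgebra C M) (\<alpha> M)) + counit C c)\<rparr>"


section \<open>The coalgebra \<open>C\<^sub>\<infinity>\<close>\<close>

text \<open>
  The iterates of the construction are realised as an increasing sequence of subspaces \<open>Cs n\<close> of
  one fixed vector space: \<open>Cs 0\<close> is a copy of \<open>C\<close>, and \<open>Cs (Suc n)\<close> is a copy of \<open>(Cs n)'\<close>, where
  the summand \<open>Cs n\<close> of \<open>(Cs n)'\<close> is identified with \<open>Cs n\<close> itself. The sets of representatives
  \<open>R n\<close> are arbitrary. Such a sequence exists for every coalgebra \<open>C\<close>, see theorem \<open>tower_exists\<close> below.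
\<close>

definition is_tower ::
  "('k::field, 'c::ab_group_add) coalgebra \<Rightarrow> (nat \<Rightarrow> ('k, 'v::ab_group_add) coord_comodule set) \<Rightarrow>
    (nat \<Rightarrow> ('k, 'v) coalgebra) \<Rightarrow> bool" where
  "is_tower C R Cs \<longleftrightarrow>
     vector_space (smult (Cs 0)) \<and> (\<forall>n. smult (Cs n) = smult (Cs 0)) \<and>
     (\<exists>j. coalgebra_iso C (Cs 0) j) \<and>
     (\<forall>n. representatives (Cs n) (R n) \<and>
          (\<exists>\<phi>. coalgebra_iso (prime_coalgebra (R n) (Cs n)) (Cs (Suc n)) \<phi> \<and>
               (\<forall>c\<in>carrier (Cs n). \<phi> (in_base c) = c)))"

text \<open>
  The comultiplication and counit of the union at \<open>c\<close> are those of any member containing \<open>c\<close>;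
  they do not depend on the member.
\<close>

definition union_coalgebra ::
  "(nat \<Rightarrow> ('k::field, 'v::ab_group_add) coalgebra) \<Rightarrow> ('k, 'v) coalgebra" where
  "union_coalgebra Cs =
     \<lparr>carrier = (\<Union>n\<in>{1..}. carrier (Cs n)), smult = smult (Cs 0),
      comult = (\<lambda>c. comult (Cs (LEAST n. 1 \<le> n \<and> c \<in> carrier (Cs n))) c),
      counit = (\<lambda>c. counit (Cs (LEAST n. 1 \<le> n \<and> c \<in> carrier (Cs n))) c)\<rparr>"


section \<open>Every coalgebra has a tower\<close>

lemma sum_list_fun2: "(\<Sum>x\<leftarrow>xs. F x) f g = (\<Sum>x\<leftarrow>xs. F x f g)"
  for F :: "'a \<Rightarrow> 'f \<Rightarrow> 'g \<Rightarrow> 'b::ab_group_add"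
  by (induction xs) auto

lemma sum_tens_eval:
  assumes "Vector_Spaces.linear (smult V) (*) f" "Vector_Spaces.linear (smult W) (*) g"
  shows "(\<Sum>(v, w)\<leftarrow>xs. tens V W v w) f g = (\<Sum>(v, w)\<leftarrow>xs. f v * g w)"
  using assms by (induction xs) (auto simp: tens_def split: prod.splits)

definition bilinear_map ::
  "('k::field, 'v::ab_group_add, 'y) vspace_scheme \<Rightarrow> ('k, 'w::ab_group_add, 'z) vspace_scheme \<Rightarrow>
    ('k \<Rightarrow> 'x \<Rightarrow> 'x::ab_group_add) \<Rightarrow> ('v \<Rightarrow> 'w \<Rightarrow> 'x) \<Rightarrow> bool" where
  "bilinear_map V W s \<beta> \<longleftrightarrow>
     (\<forall>v\<in>carrier V. \<forall>v'\<in>carrier V. \<forall>w\<in>carrier W. \<beta> (v + v') w = \<beta> v w + \<beta> v' w) \<and>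
     (\<forall>v\<in>carrier V. \<forall>w\<in>carrier W. \<forall>w'\<in>carrier W. \<beta> v (w + w') = \<beta> v w + \<beta> v w') \<and>
     (\<forall>a. \<forall>v\<in>carrier V. \<forall>w\<in>carrier W. \<beta> (smult V a v) w = s a (\<beta> v w)) \<and>
     (\<forall>a. \<forall>v\<in>carrier V. \<forall>w\<in>carrier W. \<beta> v (smult W a w) = s a (\<beta> v w))"

lemma (in vector_space) functionals_separate:
  assumes "\<And>f. Vector_Spaces.linear scale (*) f \<Longrightarrow> f x = f y"
  shows "x = y"
proof -
  let ?B = "extend_basis {}"
  have B: "independent ?B" "span ?B = UNIV"
    using independent_extend_basis[OF independent_empty] span_extend_basis[OF independent_empty] by auto
  have "representation ?B x = representation ?B y"
  proof
    fix b
    show "representation ?B x b = representation ?B y b"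
      by (rule assms) (rule linear_representation[OF B])
  qed
  then show ?thesis
    by (metis B UNIV_I sum_nonzero_representation_eq)
qed

lemma sum_bilinear_cong:
  fixes V :: "('k::field, 'v::ab_group_add, 'y) vspace_scheme"
    and W :: "('k, 'w::ab_group_add, 'z) vspace_scheme"
    and \<beta> :: "'v \<Rightarrow> 'w \<Rightarrow> 'x::ab_group_add"
  assumes V: "vspace V" and W: "vspace W" and \<beta>: "bilinear_map V W s \<beta>"
    and xs: "set xs \<subseteq> carrier V \<times> carrier W" and ys: "set ys \<subseteq> carrier V \<times> carrier W"
    and eq: "(\<Sum>(v, w)\<leftarrow>xs. tens V W v w) = (\<Sum>(v, w)\<leftarrow>ys. tens V W v w)"
  shows "(\<Sum>(v, w)\<leftarrow>xs. \<beta> v w) = (\<Sum>(v, w)\<leftarrow>ys. \<beta> v w)"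
proof -
  interpret V: vector_space "smult V" using V by (simp add: vspace_def)
  interpret W: vector_space "smult W" using W by (simp add: vspace_def)
  have sV: "V.subspace (carrier V)" and sW: "W.subspace (carrier W)"
    using V W by (simp_all add: vspace_def)
  obtain B where B: "B \<subseteq> carrier W" "W.independent B" "carrier W \<subseteq> W.span B"
    using W.maximal_independent_subset by blast
  define r where "r = W.representation (W.extend_basis B)"
  have eB: "W.independent (W.extend_basis B)" "W.span (W.extend_basis B) = UNIV"
    using W.independent_extend_basis[OF B(2)] W.span_extend_basis[OF B(2)] by auto
  have rB: "r w = W.representation B w" if "w \<in> carrier W" for w
    unfolding r_def
    using W.representation_extend[OF eB(1), of w B] W.extend_basis_superset[OF B(2)] B(3) that by auto
  have lin: "Vector_Spaces.linear (smult W) (*) (\<lambda>w. r w b)" for b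
    unfolding r_def by (rule W.linear_representation[OF eB])
  define F where "F = (\<Union>(v, w)\<in>set xs \<union> set ys. {b. r w b \<noteq> 0})"
  have finF: "finite F"
    unfolding F_def r_def by (auto intro: W.finite_representation)
  have FB: "F \<subseteq> B"
    unfolding F_def using xs ys rB W.representation_ne_zero[of B] by (fastforce simp: set_eq_iff)
  then have FW: "F \<subseteq> carrier W" using B(1) by blast
  have expand: "w = (\<Sum>b\<in>F. smult W (r w b) b)" if "(v, w) \<in> set xs \<union> set ys" for v w
  proof -
    have w: "w \<in> carrier W" using that xs ys by auto
    have "w = (\<Sum>b | r w b \<noteq> 0. smult W (r w b) b)"
      using W.sum_nonzero_representation_eq[OF eB(1), of w] eB(2) by (simp add: r_def)
    also have "\<dots> = (\<Sum>b\<in>F. smult W (r w b) b)"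
      by (rule sum.mono_neutral_left) (use finF that in \<open>auto simp: F_def\<close>)
    finally show ?thesis .
  qed
  define u where "u zs b = (\<Sum>(v, w)\<leftarrow>zs. smult V (r w b) v)" for zs :: "('v \<times> 'w) list" and b
  have u_mem: "u zs b \<in> carrier V" if "set zs \<subseteq> carrier V \<times> carrier W" for zs b
    unfolding u_def using that
    by (induction zs) (auto intro!: V.subspace_add[OF sV] V.subspace_scale[OF sV] V.subspace_0[OF sV])
  have \<beta>0l: "\<beta> 0 w = 0" if "w \<in> carrier W" for w
  proof -
    have "\<beta> (0 + 0) w = \<beta> 0 w + \<beta> 0 w"
      using \<beta> that V.subspace_0[OF sV] unfolding bilinear_map_def by blast
    then show ?thesis by simp
  qed
  have \<beta>0r: "\<beta> v 0 = 0" if "v \<in> carrier V" for v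
  proof -
    have "\<beta> v (0 + 0) = \<beta> v 0 + \<beta> v 0"
      using \<beta> that W.subspace_0[OF sW] unfolding bilinear_map_def by blast
    then show ?thesis by simp
  qed
  have \<beta>sum: "\<beta> v (\<Sum>b\<in>G. smult W (c b) b) = (\<Sum>b\<in>G. \<beta> (smult V (c b) v) b)"
    if "finite G" "G \<subseteq> F" "v \<in> carrier V" for v c G
    using that
  proof (induction G rule: finite_induct)
    case empty
    then show ?case by (simp add: \<beta>0r)
  next
    case (insert b G)
    have "(\<Sum>b\<in>G. smult W (c b) b) \<in> carrier W" "smult W (c b) b \<in> carrier W" "b \<in> carrier W"
      using insert.prems FW by (auto intro!: W.subspace_sum[OF sW] W.subspace_scale[OF sW])
    then show ?case
      using insert \<beta> unfolding bilinear_map_def by simp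
  qed
  have key: "(\<Sum>(v, w)\<leftarrow>zs. \<beta> v w) = (\<Sum>b\<in>F. \<beta> (u zs b) b)"
    if "set zs \<subseteq> set xs \<union> set ys" for zs
    using that
  proof (induction zs)
    case Nil
    have "(\<Sum>b\<in>F. \<beta> 0 b) = 0" using \<beta>0l FW by (intro sum.neutral) auto
    then show ?case by (simp add: u_def)
  next
    case (Cons z zs)
    obtain v w where z: "z = (v, w)" by (cases z)
    have mem: "v \<in> carrier V" "w \<in> carrier W" "set zs \<subseteq> carrier V \<times> carrier W"
      using Cons.prems xs ys z by auto
    have "\<beta> v w = (\<Sum>b\<in>F. \<beta> (smult V (r w b) v) b)"
      using expand[of v w] \<beta>sum[OF finF subset_refl mem(1), of "r w"] Cons.prems z by simp
    moreover have "\<beta> (u (z # zs) b) b = \<beta> (smult V (r w b) v) b + \<beta> (u zs b) b" if "b \<in> F" for b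
    proof -
      have "smult V (r w b) v \<in> carrier V" "u zs b \<in> carrier V" "b \<in> carrier W"
        using mem u_mem FW that V.subspace_scale[OF sV] by auto
      then show ?thesis using \<beta> unfolding bilinear_map_def by (simp add: u_def z)
    qed
    ultimately show ?case using Cons by (simp add: z sum.distrib)
  qed
  have "u xs b = u ys b" for b
  proof (rule V.functionals_separate)
    fix f assume f: "Vector_Spaces.linear (smult V) (*) f"
    interpret f: Vector_Spaces.linear "smult V" "(*)" f by (rule f)
    have *: "f (u zs b) = (\<Sum>(v, w)\<leftarrow>zs. f v * r w b)" for zs
      unfolding u_def by (induction zs) (auto simp: f.add f.scale f.zero mult.commute)
    show "f (u xs b) = f (u ys b)"
      unfolding * using sum_tens_eval[OF f lin, of xs b] sum_tens_eval[OF f lin, of ys b] eq by simp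
  qed
  then show ?thesis using key[of xs] key[of ys] by simp
qed

lemma tensor_lift_eval:
  assumes "vspace V" "vspace W" "bilinear_map V W s \<beta>" "set xs \<subseteq> carrier V \<times> carrier W"
  shows "tensor_lift V W \<beta> (\<Sum>(v, w)\<leftarrow>xs. tens V W v w) = (\<Sum>(v, w)\<leftarrow>xs. \<beta> v w)"
  unfolding tensor_lift_def
proof (rule the_equality)
  show "\<exists>ys. set ys \<subseteq> carrier V \<times> carrier W \<and>
     (\<Sum>(v, w)\<leftarrow>xs. tens V W v w) = (\<Sum>(v, w)\<leftarrow>ys. tens V W v w) \<and>
     (\<Sum>(v, w)\<leftarrow>xs. \<beta> v w) = (\<Sum>(v, w)\<leftarrow>ys. \<beta> v w)"
    using assms(4) by blast
qed (use sum_bilinear_cong[OF assms(1-3) assms(4)] in metis)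

lemma
  shows tens_add_left: "tens V W (x + y) w = tens V W x w + tens V W y w"
    and tens_add_right: "tens V W x (w + z) = tens V W x w + tens V W x z"
    and tens_scale_left: "tens V W (smult V a x) w = tensor_smult a (tens V W x w)"
    and tens_scale_right: "tens V W x (smult W a w) = tensor_smult a (tens V W x w)"
proof -
  have *: "f (x + y) = f x + f y" "f (s a x) = a * f x"
    if "Vector_Spaces.linear s (*) f" for s f a and x y :: "'z::ab_group_add"
  proof -
    interpret f: Vector_Spaces.linear s "(*)" f by (rule that)
    show "f (x + y) = f x + f y" "f (s a x) = a * f x" by (simp_all add: f.add f.scale)
  qed
  show "tens V W (x + y) w = tens V W x w + tens V W y w"
    "tens V W x (w + z) = tens V W x w + tens V W x z"
    "tens V W (smult V a x) w = tensor_smult a (tens V W x w)"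
    "tens V W x (smult W a w) = tensor_smult a (tens V W x w)"
    by (auto simp: tens_def tensor_smult_def fun_eq_iff * algebra_simps)
qed

lemma vector_space_tensor: "vector_space tensor_smult"
  by unfold_locales (auto simp: tensor_smult_def fun_eq_iff algebra_simps)

lemma tensor_prod_iff:
  assumes V: "vspace V"
  shows "t \<in> carrier (tensor_prod V W) \<longleftrightarrow>
    (\<exists>xs. set xs \<subseteq> carrier V \<times> carrier W \<and> t = (\<Sum>(v, w)\<leftarrow>xs. tens V W v w))"
proof -
  interpret T: vector_space "tensor_smult :: 'a \<Rightarrow> ('a, 'b, 'd) tensor \<Rightarrow> _"
    by (rule vector_space_tensor)
  interpret V: vector_space "smult V" using V by (simp add: vspace_def)
  have sV: "V.subspace (carrier V)" using V by (simp add: vspace_def)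
  let ?G = "{tens V W v w | v w. v \<in> carrier V \<and> w \<in> carrier W}"
  have "\<exists>xs. set xs \<subseteq> carrier V \<times> carrier W \<and> t = (\<Sum>(v, w)\<leftarrow>xs. tens V W v w)"
    if "t \<in> T.span ?G"
    using that
  proof (induction rule: T.span_induct_alt)
    case base
    show ?case by (rule exI[of _ "[]"]) auto
  next
    case (step a x y)
    then obtain v w xs where *: "v \<in> carrier V" "w \<in> carrier W" "x = tens V W v w"
      "set xs \<subseteq> carrier V \<times> carrier W" "y = (\<Sum>(v, w)\<leftarrow>xs. tens V W v w)" by blast
    show ?case
      by (rule exI[of _ "(smult V a v, w) # xs"])
        (use * V.subspace_scale[OF sV] in \<open>auto simp: tens_scale_left\<close>)
  qed
  moreover have "(\<Sum>(v, w)\<leftarrow>xs. tens V W v w) \<in> T.span ?G"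
    if "set xs \<subseteq> carrier V \<times> carrier W" for xs
    using that
  proof (induction xs)
    case Nil
    show ?case using T.span_zero[of ?G] by (simp only: list.map sum_list.Nil)
  next
    case (Cons x xs)
    obtain v w where x: "x = (v, w)" by (cases x)
    have "tens V W v w \<in> T.span ?G" "(\<Sum>(v, w)\<leftarrow>xs. tens V W v w) \<in> T.span ?G"
      using Cons by (auto simp: x intro!: T.span_base)
    from T.span_add[OF this] show ?case by (simp only: x list.map sum_list.Cons prod.case)
  qed
  ultimately show ?thesis by (auto simp: tensor_prod_def)
qed

lemma tensor_map_eval:
  assumes "vspace V" "vspace W" "linear_map V V2 f" "linear_map W W2 g"
    "set xs \<subseteq> carrier V \<times> carrier W"
  shows "tensor_map V W V2 W2 f g (\<Sum>(v, w)\<leftarrow>xs. tens V W v w) =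
    (\<Sum>(v, w)\<leftarrow>xs. tens V2 W2 (f v) (g w))"
  unfolding tensor_map_def
proof (rule tensor_lift_eval[OF assms(1,2) _ assms(5)])
  show "bilinear_map V W tensor_smult (\<lambda>v w. tens V2 W2 (f v) (g w))"
    using assms(3,4) unfolding bilinear_map_def linear_map_def
    by (auto simp: tens_add_left tens_add_right tens_scale_left tens_scale_right)
qed

lemma linear_map_id: "linear_map V V id"
  by (simp add: linear_map_def)

lemma coact_repr:
  assumes "comodule C M" "m \<in> carrier M"
  obtains xs where "set xs \<subseteq> carrier M \<times> carrier C" "coact M m = (\<Sum>(x, c)\<leftarrow>xs. tens M C x c)"
  using assms tensor_prod_iff[of M "coact M m" C] unfolding comodule_def linear_map_def by blast

lemma tensor_map_comp:
  assumes C: "vspace C" and M: "comodule C M" and N: "comodule C N"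
    and f: "linear_map M N f" and g: "linear_map N P g" and m: "m \<in> carrier M"
  shows "tensor_map N C P C g id (tensor_map M C N C f id (coact M m)) =
    tensor_map M C P C (g \<circ> f) id (coact M m)"
proof -
  have vM: "vspace M" and vN: "vspace N" using M N by (simp_all add: comodule_def)
  obtain xs where xs: "set xs \<subseteq> carrier M \<times> carrier C" "coact M m = (\<Sum>(x, c)\<leftarrow>xs. tens M C x c)"
    using coact_repr[OF M m] .
  have gf: "linear_map M P (g \<circ> f)" using f g by (auto simp: linear_map_def)
  have 1: "tensor_map M C N C f id (coact M m) = (\<Sum>(x, c)\<leftarrow>map (map_prod f id) xs. tens N C x c)"
    unfolding xs(2) tensor_map_eval[OF vM C f linear_map_id xs(1)]
    by (simp add: o_def split_def)
  have "set (map (map_prod f id) xs) \<subseteq> carrier N \<times> carrier C"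
    using xs(1) f by (auto simp: linear_map_def)
  from tensor_map_eval[OF vN C g linear_map_id this]
  have "tensor_map N C P C g id (tensor_map M C N C f id (coact M m)) =
      (\<Sum>(x, c)\<leftarrow>xs. tens P C ((g \<circ> f) x) (id c))"
    unfolding 1 by (simp add: o_def split_def)
  also have "\<dots> = tensor_map M C P C (g \<circ> f) id (coact M m)"
    unfolding xs(2) tensor_map_eval[OF vM C gf linear_map_id xs(1)] ..
  finally show ?thesis .
qed

lemma tensor_map_ident:
  assumes C: "vspace C" and M: "comodule C M" and m: "m \<in> carrier M"
    and f: "\<And>x. x \<in> carrier M \<Longrightarrow> f x = x" and N: "smult N = smult M" "carrier N = carrier M"
  shows "tensor_map M C N C f id (coact M m) = coact M m"
proof -
  have vM: "vspace M" using M by (simp_all add: comodule_def)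
  interpret vector_space "smult M" using vM by (simp add: vspace_def)
  have sM: "subspace (carrier M)" using vM by (simp add: vspace_def)
  obtain xs where xs: "set xs \<subseteq> carrier M \<times> carrier C" "coact M m = (\<Sum>(x, c)\<leftarrow>xs. tens M C x c)"
    using coact_repr[OF M m] .
  have lf: "linear_map M N f"
    using f N subspace_add[OF sM] subspace_scale[OF sM] by (auto simp: linear_map_def)
  have tN: "tens N C = tens M C" by (simp add: tens_def fun_eq_iff N)
  show ?thesis
    unfolding xs(2) tensor_map_eval[OF vM C lf linear_map_id xs(1)]
    by (rule arg_cong[where f = sum_list], rule map_cong) (use xs(1) f in \<open>auto simp: tN\<close>)
qed

lemma comodule_isomorphic_same:
  assumes "vspace C" "comodule C M" "smult N = smult M" "carrier N = carrier M"
    "\<And>m. m \<in> carrier M \<Longrightarrow> coact N m = coact M m"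
  shows "comodule_isomorphic C M N"
  unfolding comodule_isomorphic_def comodule_hom_def
  by (rule exI[of _ id]) (use assms tensor_map_ident[of C M _ id N] in \<open>auto simp: linear_map_def\<close>)

lemma comodule_isomorphic_sym:
  assumes C: "vspace C" and M: "comodule C M" and N: "comodule C N"
    and iso: "comodule_isomorphic C M N"
  shows "comodule_isomorphic C N M"
proof -
  obtain f where f: "linear_map M N f" "bij_betw f (carrier M) (carrier N)"
    "\<And>m. m \<in> carrier M \<Longrightarrow> coact N (f m) = tensor_map M C N C f id (coact M m)"
    using iso unfolding comodule_isomorphic_def comodule_hom_def by blast
  define g where "g = inv_into (carrier M) f"
  have gf: "g (f m) = m" if "m \<in> carrier M" for m
    using that f(2) by (simp add: g_def bij_betw_inv_into_left)
  have N_eq: "carrier N = f ` carrier M" using f(2) by (simp add: bij_betw_def)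
  have vM: "vspace M" using M by (simp_all add: comodule_def)
  interpret vector_space "smult M" using vM by (simp add: vspace_def)
  have sM: "subspace (carrier M)" using vM by (simp add: vspace_def)
  have lf: "f (x + y) = f x + f y" "f (smult M a x) = smult N a (f x)"
    if "x \<in> carrier M" "y \<in> carrier M" for x y a
    using f(1) that by (auto simp: linear_map_def)
  have g: "linear_map N M g"
    unfolding linear_map_def N_eq
    using subspace_add[OF sM] subspace_scale[OF sM]
    by (auto simp: gf lf[symmetric])
  have "bij_betw g (carrier N) (carrier M)"
    unfolding g_def using f(2) by (rule bij_betw_inv_into)
  moreover have "coact M (g n) = tensor_map N C M C g id (coact N n)" if n: "n \<in> carrier N" for n
  proof -
    obtain m where m: "m \<in> carrier M" "n = f m" using n N_eq by blast
    have "tensor_map N C M C g id (coact N n) = tensor_map M C M C (g \<circ> f) id (coact M m)"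
      unfolding m(2) f(3)[OF m(1)] by (rule tensor_map_comp[OF C M N f(1) g m(1)])
    also have "\<dots> = coact M m" by (rule tensor_map_ident[OF C M m(1)]) (auto simp: gf)
    finally show ?thesis using m gf by simp
  qed
  ultimately show ?thesis using g unfolding comodule_isomorphic_def comodule_hom_def by blast
qed

lemma comodule_isomorphic_trans:
  assumes C: "vspace C" and M: "comodule C M" and N: "comodule C N"
    and "comodule_isomorphic C M N" "comodule_isomorphic C N P"
  shows "comodule_isomorphic C M P"
proof -
  obtain f where f: "linear_map M N f" "bij_betw f (carrier M) (carrier N)"
    "\<And>m. m \<in> carrier M \<Longrightarrow> coact N (f m) = tensor_map M C N C f id (coact M m)"
    using assms(4) unfolding comodule_isomorphic_def comodule_hom_def by blast
  obtain g where g: "linear_map N P g" "bij_betw g (carrier N) (carrier P)"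
    "\<And>m. m \<in> carrier N \<Longrightarrow> coact P (g m) = tensor_map N C P C g id (coact N m)"
    using assms(5) unfolding comodule_isomorphic_def comodule_hom_def by blast
  have "linear_map M P (g \<circ> f)" using f(1) g(1) by (auto simp: linear_map_def)
  moreover have "bij_betw (g \<circ> f) (carrier M) (carrier P)" using f(2) g(2) by (rule bij_betw_trans)
  moreover have "coact P ((g \<circ> f) m) = tensor_map M C P C (g \<circ> f) id (coact M m)"
    if m: "m \<in> carrier M" for m
  proof -
    have "f m \<in> carrier N" using f(1) m by (auto simp: linear_map_def)
    then show ?thesis using g(3) f(3)[OF m] tensor_map_comp[OF C M N f(1) g(1) m] by simp
  qed
  ultimately show ?thesis unfolding comodule_isomorphic_def comodule_hom_def by blast
qed

lemma representatives_exist: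
  fixes C :: "('k::field, 'v::ab_group_add) coalgebra"
  assumes C: "vspace C"
  shows "\<exists>R. representatives C R"
proof -
  define F where "F = fd_coord_comodules C"
  have F: "comodule C M" if "M \<in> F" for M :: "('k, 'v) coord_comodule" using that by (simp add: F_def fd_coord_comodules_def)
  define rep where "rep M = (SOME N. N \<in> F \<and> comodule_isomorphic C M N)" for M :: "('k, 'v) coord_comodule"
  have rep: "rep M \<in> F \<and> comodule_isomorphic C M (rep M)" if "M \<in> F" for M
    unfolding rep_def by (rule someI[of _ M]) (use that F C in \<open>auto intro: comodule_isomorphic_same\<close>)
  have rep_cong: "rep M = rep N" if "M \<in> F" "N \<in> F" "comodule_isomorphic C M N" for M N
  proof -
    have "comodule_isomorphic C M P \<longleftrightarrow> comodule_isomorphic C N P" for P :: "('k, 'v) coord_comodule"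
      using that F C comodule_isomorphic_sym[of C M N] comodule_isomorphic_trans[of C] by blast
    then show ?thesis by (simp add: rep_def)
  qed
  have "representatives C (rep ` F)"
    unfolding representatives_def F_def[symmetric]
  proof (intro conjI ballI)
    show "rep ` F \<subseteq> F" using rep by blast
    fix M assume M: "M \<in> F"
    show "\<exists>!N. N \<in> rep ` F \<and> comodule_isomorphic C M N"
    proof (rule ex1I[of _ "rep M"])
      show "rep M \<in> rep ` F \<and> comodule_isomorphic C M (rep M)" using M rep by blast
      fix N assume "N \<in> rep ` F \<and> comodule_isomorphic C M N"
      then obtain P where P: "P \<in> F" "N = rep P" "comodule_isomorphic C M (rep P)" by blast
      have "comodule_isomorphic C (rep P) P"
        using comodule_isomorphic_sym[OF C] rep[OF P(1)] F P(1) by blast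
      then have "comodule_isomorphic C M P"
        using comodule_isomorphic_trans[OF C, of M "rep P" P] P M F rep by blast
      then show "N = rep M" using rep_cong M P by auto
    qed
  qed
  then show ?thesis by blast
qed


text \<open>
  Keys index the coordinates of a vector space in which all members of a tower fit: those of level
  \<open>n\<close> are the coordinates of the summands added in step \<open>n\<close>, and a comodule is named by its
  carrier and by representations of the values of its coaction as finite lists.
\<close>

datatype ('k, 'c) key =
  BaseKey 'c
| EndKey nat "(nat \<Rightarrow> 'k) set" "(nat \<Rightarrow> 'k) \<Rightarrow> ((nat \<Rightarrow> 'k) \<times> (('k, 'c) key \<times> 'k) list) list"
    "((nat \<Rightarrow> 'k) \<Rightarrow> (nat \<Rightarrow> 'k)) \<Rightarrow> 'k"
| ModKey nat "(nat \<Rightarrow> 'k) set" "(nat \<Rightarrow> 'k) \<Rightarrow> ((nat \<Rightarrow> 'k) \<times> (('k, 'c) key \<times> 'k) list) list"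
    "nat \<Rightarrow> 'k"

fun key_below :: "nat \<Rightarrow> ('k, 'c) key \<Rightarrow> bool" where
  "key_below n (BaseKey c) = True"
| "key_below n (EndKey l _ _ _) = (l < n)"
| "key_below n (ModKey l _ _ _) = (l < n)"

type_synonym ('k, 'c) keyspace = "('k, 'c) key \<Rightarrow> 'k"

definition key_smult :: "'k::field \<Rightarrow> ('k, 'c) keyspace \<Rightarrow> ('k, 'c) keyspace" where
  "key_smult a x = (\<lambda>y. a * x y)"

lemma vector_space_key: "vector_space key_smult"
  by unfold_locales (auto simp: key_smult_def fun_eq_iff algebra_simps)

definition level :: "nat \<Rightarrow> ('k::field, ('k, 'c) keyspace) coalgebra \<Rightarrow> bool" where
  "level n D \<longleftrightarrow> smult D = key_smult \<and> module.subspace key_smult (carrier D) \<and>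
     (\<forall>x\<in>carrier D. finite {y. x y \<noteq> 0} \<and> (\<forall>y. x y \<noteq> 0 \<longrightarrow> key_below n y))"

definition transport ::
  "('k::field, 'v::ab_group_add) coalgebra \<Rightarrow> ('v \<Rightarrow> ('k, 'c) keyspace) \<Rightarrow>
    ('k, ('k, 'c) keyspace) coalgebra" where
  "transport C \<phi> =
     (let D = \<lparr>carrier = \<phi> ` carrier C, smult = key_smult\<rparr>;
          \<psi> = inv_into (carrier C) \<phi>
      in \<lparr>carrier = carrier D, smult = key_smult,
          comult = (\<lambda>y. tensor_map C C D D \<phi> \<phi> (comult C (\<psi> y))), counit = (\<lambda>y. counit C (\<psi> y))\<rparr>)"

lemma transport:
  assumes C: "vspace C" and inj: "inj_on \<phi> (carrier C)"
    and add: "\<And>x y. x \<in> carrier C \<Longrightarrow> y \<in> carrier C \<Longrightarrow> \<phi> (x + y) = \<phi> x + \<phi> y"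
    and scale: "\<And>a x. x \<in> carrier C \<Longrightarrow> \<phi> (smult C a x) = key_smult a (\<phi> x)"
    and supp: "\<And>x. x \<in> carrier C \<Longrightarrow> finite {y. \<phi> x y \<noteq> 0}"
      "\<And>x y. x \<in> carrier C \<Longrightarrow> \<phi> x y \<noteq> 0 \<Longrightarrow> key_below n y"
  shows "coalgebra_iso C (transport C \<phi>) \<phi>" "level n (transport C \<phi>)"
proof -
  interpret C: vector_space "smult C" using C by (simp add: vspace_def)
  have sC: "C.subspace (carrier C)" using C by (simp add: vspace_def)
  interpret K: vector_space "key_smult :: 'a \<Rightarrow> ('a, 'c) keyspace \<Rightarrow> _" by (rule vector_space_key)
  have zero: "\<phi> 0 = 0"
    using add[of 0 0] C.subspace_0[OF sC] by simp
  have "K.subspace (\<phi> ` carrier C)"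
  proof (rule K.subspaceI)
    show "0 \<in> \<phi> ` carrier C" using zero C.subspace_0[OF sC] by (metis imageI)
    show "x + y \<in> \<phi> ` carrier C" if "x \<in> \<phi> ` carrier C" "y \<in> \<phi> ` carrier C" for x y
      using that add C.subspace_add[OF sC] by (metis (no_types, lifting) image_iff)
    show "key_smult a x \<in> \<phi> ` carrier C" if "x \<in> \<phi> ` carrier C" for a x
      using that scale C.subspace_scale[OF sC] by (metis (no_types, lifting) image_iff)
  qed
  then show "level n (transport C \<phi>)"
    using supp by (auto simp: level_def transport_def Let_def)
  have t: "tensor_map C C (transport C \<phi>) (transport C \<phi>) =
      tensor_map C C \<lparr>carrier = \<phi> ` carrier C, smult = key_smult\<rparr>
        \<lparr>carrier = \<phi> ` carrier C, smult = key_smult\<rparr>"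
    by (simp add: tensor_map_def tens_def transport_def Let_def fun_eq_iff)
  show "coalgebra_iso C (transport C \<phi>) \<phi>"
    unfolding coalgebra_iso_def t
    using inj by (auto simp: transport_def Let_def linear_map_def bij_betw_def add scale)
qed

definition key_list :: "(('k::field, 'c) key \<times> 'k) list \<Rightarrow> ('k, 'c) keyspace" where
  "key_list ks z = (\<Sum>(y, k)\<leftarrow>ks. if z = y then k else 0)"

lemma key_list_exists:
  assumes "finite {y. x y \<noteq> 0}"
  shows "\<exists>ks. x = key_list ks"
proof -
  obtain ys where ys: "set ys = {y. x y \<noteq> 0}" "distinct ys" using finite_distinct_list[OF assms] by blast
  have *: "(\<Sum>y\<leftarrow>ys. if z = y then x y else 0) = x z" for z
  proof -
    have "(\<Sum>y\<leftarrow>ys. if z = y then x y else 0) = (\<Sum>y\<in>{y. x y \<noteq> 0}. if z = y then x y else 0)"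
      using ys by (simp add: sum_list_distinct_conv_sum_set)
    also have "\<dots> = x z" using assms by (subst sum.delta') auto
    finally show ?thesis by simp
  qed
  have "x = key_list (map (\<lambda>y. (y, x y)) ys)"
    by (rule ext) (simp add: key_list_def o_def *)
  then show ?thesis by blast
qed

definition coact_code ::
  "('k::field, ('k, 'c) keyspace) coalgebra \<Rightarrow> ('k, ('k, 'c) keyspace) coord_comodule \<Rightarrow>
    (nat \<Rightarrow> 'k) \<Rightarrow> ((nat \<Rightarrow> 'k) \<times> (('k, 'c) key \<times> 'k) list) list" where
  "coact_code D M m = (if m \<in> carrier M
     then SOME e. coact M m = (\<Sum>(x, ks)\<leftarrow>e. tens M D x (key_list ks)) else [])"

lemma coact_code:
  assumes D: "level n D" and M: "comodule D M" and m: "m \<in> carrier M"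
  shows "coact M m = (\<Sum>(x, ks)\<leftarrow>coact_code D M m. tens M D x (key_list ks))"
proof -
  obtain xs where xs: "set xs \<subseteq> carrier M \<times> carrier D" "coact M m = (\<Sum>(x, c)\<leftarrow>xs. tens M D x c)"
    using coact_repr[OF M m] .
  have "\<exists>f. \<forall>c\<in>carrier D. c = key_list (f c)"
    using D key_list_exists unfolding level_def by metis
  then obtain f where f: "\<And>c. c \<in> carrier D \<Longrightarrow> c = key_list (f c)" by blast
  have "coact M m = (\<Sum>(x, ks)\<leftarrow>map (map_prod id f) xs. tens M D x (key_list ks))"
    unfolding xs(2) map_map o_def
    by (rule arg_cong[where f = sum_list], rule map_cong) (use xs(1) f in auto)
  from someI[of "\<lambda>e. coact M m = (\<Sum>(x, ks)\<leftarrow>e. tens M D x (key_list ks))", OF this]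
  show ?thesis unfolding coact_code_def if_P[OF m] .
qed

lemma finite_support_add:
  assumes "finite {M. F M \<noteq> 0}" "finite {M. G M \<noteq> 0}"
  shows "finite {M. F M + G M \<noteq> (0::'z::ab_group_add)}"
  by (rule finite_subset[of _ "{M. F M \<noteq> 0} \<union> {M. G M \<noteq> 0}"]) (use assms in auto)

lemma finite_support_smult:
  assumes "finite {M. F M \<noteq> 0}"
  shows "finite {M. (\<lambda>i. (a::'k::field) * F M i) \<noteq> 0}"
  by (rule finite_subset[OF _ assms]) (auto simp: fun_eq_iff)

lemma vspace_prime:
  assumes C: "vspace C" and R: "representatives C R"
  shows "vspace (prime_space R C)"
proof -
  interpret C: vector_space "smult C" using C by (simp add: vspace_def)
  have sC: "C.subspace (carrier C)" using C by (simp add: vspace_def)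
  have "vector_space (smult (prime_space R C))"
    by unfold_locales
      (auto simp: prime_space_def fun_eq_iff algebra_simps C.scale_left_distrib C.scale_right_distrib)
  then interpret P: vector_space "smult (prime_space R C)" .
  have sM: "0 \<in> carrier M \<and> (\<forall>x\<in>carrier M. \<forall>y\<in>carrier M. x + y \<in> carrier M) \<and>
      (\<forall>a. \<forall>x\<in>carrier M. (\<lambda>i. a * x i) \<in> carrier M)" if M: "M \<in> R" for M
  proof -
    have 1: "vspace M" "smult M = (\<lambda>a x i. a * x i)"
      using M R by (auto simp: representatives_def fd_coord_comodules_def comodule_def)
    interpret M: vector_space "smult M" using 1 by (simp add: vspace_def)
    have "M.subspace (carrier M)" using 1 by (simp add: vspace_def)
    then show ?thesis using M.subspace_0 M.subspace_add M.subspace_scale 1(2) by metis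
  qed
  have sE: "0 \<in> carrier (end_coalgebra C M) \<and>
      (\<forall>x\<in>carrier (end_coalgebra C M). \<forall>y\<in>carrier (end_coalgebra C M). x + y \<in> carrier (end_coalgebra C M)) \<and>
      (\<forall>a. \<forall>x\<in>carrier (end_coalgebra C M). (\<lambda>f. a * x f) \<in> carrier (end_coalgebra C M))"
    for M :: "('a, 'b) coord_comodule"
    by (auto simp: end_coalgebra_def dual_coalgebra_def dual_space_def linear_map_def ground_def
        algebra_simps)
  have "P.subspace (carrier (prime_space R C))"
  proof (rule P.subspaceI)
    show "0 \<in> carrier (prime_space R C)"
      using sM sE C.subspace_0[OF sC] by (auto simp: prime_space_def zero_prod_def)
    show "x + y \<in> carrier (prime_space R C)"
      if "x \<in> carrier (prime_space R C)" "y \<in> carrier (prime_space R C)" for x y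
      using that sM sE C.subspace_add[OF sC]
      by (cases x; cases y) (simp add: prime_space_def finite_support_add)
    show "smult (prime_space R C) a x \<in> carrier (prime_space R C)"
      if "x \<in> carrier (prime_space R C)" for x a
      using that sM sE C.subspace_scale[OF sC]
        finite_support_smult[of "fst x" a] finite_support_smult[of "fst (snd x)" a]
      by (cases x) (auto simp: prime_space_def fun_eq_iff)
  qed
  then show ?thesis unfolding vspace_def using P.vector_space_axioms by blast
qed


lemma coordinates:
  fixes s :: "'k::field \<Rightarrow> 'v::ab_group_add \<Rightarrow> 'v"
  assumes "vector_space s"
  obtains r :: "'v \<Rightarrow> 'v \<Rightarrow> 'k" where "\<And>x y b. r (x + y) b = r x b + r y b"
    "\<And>a x b. r (s a x) b = a * r x b" "inj r" "\<And>x. finite {b. r x b \<noteq> 0}"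
proof -
  interpret vector_space s by fact
  let ?B = "extend_basis {}"
  have B: "independent ?B" "span ?B = UNIV"
    using independent_extend_basis[OF independent_empty] span_extend_basis[OF independent_empty] by auto
  show thesis
  proof (rule that[of "representation ?B"])
    show "representation ?B (x + y) b = representation ?B x b + representation ?B y b" for x y b
      using B by (simp add: representation_add)
    show "representation ?B (s a x) b = a * representation ?B x b" for a x b
      using B by (simp add: representation_scale)
    show "inj (representation ?B)"
      by (rule injI) (metis B UNIV_I sum_nonzero_representation_eq)
  qed (rule finite_representation)
qed

lemma tower_base:
  fixes C :: "('k::field, 'c::ab_group_add) coalgebra"
  assumes C: "coalgebra C"
  shows "\<exists>D \<phi>. level 0 (D :: ('k, ('k, 'c) keyspace) coalgebra) \<and> coalgebra_iso C D \<phi>"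
proof -
  have vC: "vspace C" using C by (simp add: coalgebra_def)
  then have "vector_space (smult C)" by (simp add: vspace_def)
  then obtain r :: "'c \<Rightarrow> 'c \<Rightarrow> 'k" where r: "\<And>x y b. r (x + y) b = r x b + r y b"
    "\<And>a x b. r (smult C a x) b = a * r x b" "inj r" "\<And>x. finite {b. r x b \<noteq> 0}"
    by (rule coordinates) blast
  define \<phi> :: "'c \<Rightarrow> ('k, 'c) keyspace" where
    "\<phi> c = (\<lambda>y. case y of BaseKey b \<Rightarrow> r c b | _ \<Rightarrow> 0)" for c
  have \<phi>: "\<phi> c (BaseKey b) = r c b" "\<phi> c (EndKey l S e f) = 0" "\<phi> c (ModKey l S e m) = 0"
    for c b l S e f m by (simp_all add: \<phi>_def)
  have key_ext: "x = y" if "\<And>b. x (BaseKey b) = y (BaseKey b)" "\<And>l S e f. x (EndKey l S e f) = y (EndKey l S e f)"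
    "\<And>l S e f. x (ModKey l S e f) = y (ModKey l S e f)" for x y :: "('k, 'c) keyspace"
    using that by (intro ext) (metis key.exhaust)
  have ne: "\<exists>b. y = BaseKey b \<and> r x b \<noteq> 0" if "\<phi> x y \<noteq> 0" for x y
    using that by (cases y) (auto simp: \<phi>)
  have "inj_on \<phi> (carrier C)"
  proof (rule inj_onI)
    fix x y assume "\<phi> x = \<phi> y"
    then have "r x b = r y b" for b by (metis \<phi>(1))
    then show "x = y" using r(3) by (meson ext injD)
  qed
  moreover have "\<phi> (x + y) = \<phi> x + \<phi> y" "\<phi> (smult C a x) = key_smult a (\<phi> x)" for x y a
    by (rule key_ext; simp add: \<phi> r key_smult_def)+
  moreover have "finite {y. \<phi> x y \<noteq> 0}" for x
    by (rule finite_subset[of _ "BaseKey ` {b. r x b \<noteq> 0}"]) (use r(4) in \<open>auto dest!: ne\<close>)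
  moreover have "key_below 0 y" if "\<phi> x y \<noteq> 0" for x y using ne[OF that] by auto
  ultimately show ?thesis using transport[OF vC, of \<phi> 0] by blast
qed

lemma tower_step:
  fixes D :: "('k::field, ('k, 'c) keyspace) coalgebra"
  assumes D: "level n D"
  shows "\<exists>E R \<phi>. level (Suc n) (E :: ('k, ('k, 'c) keyspace) coalgebra) \<and> representatives D R \<and>
    coalgebra_iso (prime_coalgebra R D) E \<phi> \<and> (\<forall>c\<in>carrier D. \<phi> (in_base c) = c)"
proof -
  have vD: "vspace D" and sD: "smult D = key_smult"
    using D vector_space_key by (auto simp: level_def vspace_def)
  obtain R where R: "representatives D R" using representatives_exist[OF vD] by blast
  have RF: "R \<subseteq> fd_coord_comodules D" using R by (simp add: representatives_def)
  define nm where "nm M = (carrier M, coact_code D M)" for M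
  have inj: "inj_on nm R"
  proof (rule inj_onI)
    fix M N assume MN: "M \<in> R" "N \<in> R" "nm M = nm N"
    have cM: "comodule D M" and cN: "comodule D N" and s: "smult N = smult M"
      using subsetD[OF RF MN(1)] subsetD[OF RF MN(2)] by (simp_all add: fd_coord_comodules_def)
    have car: "carrier N = carrier M" and code: "coact_code D N = coact_code D M"
      using MN by (auto simp: nm_def)
    have "tens N D = tens M D" by (simp add: tens_def fun_eq_iff s)
    then have "coact N m = coact M m" if "m \<in> carrier M" for m
      using coact_code[OF D cM that] coact_code[OF D cN, of m] that car code by simp
    then have "comodule_isomorphic D M N" "comodule_isomorphic D M M"
      using comodule_isomorphic_same[OF vD cM] s car by auto
    then show "M = N" using R MN unfolding representatives_def by blast
  qed
  define pick where "pick = inv_into R nm"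
  have pick: "pick (nm M) = M" if "M \<in> R" for M using that inj by (simp add: pick_def)
  obtain p :: "(((nat \<Rightarrow> 'k) \<Rightarrow> (nat \<Rightarrow> 'k)) \<Rightarrow> 'k) \<Rightarrow> (((nat \<Rightarrow> 'k) \<Rightarrow> (nat \<Rightarrow> 'k)) \<Rightarrow> 'k) \<Rightarrow> 'k"
    where p: "\<And>x y b. p (x + y) b = p x b + p y b" "\<And>a x b. p (\<lambda>f. a * x f) b = a * p x b" "inj p"
    "\<And>x. finite {b. p x b \<noteq> 0}"
    by (rule coordinates[of "\<lambda>a x f. a * x f"]; (unfold_locales)?)
      (auto simp: fun_eq_iff algebra_simps)
  obtain q :: "(nat \<Rightarrow> 'k) \<Rightarrow> (nat \<Rightarrow> 'k) \<Rightarrow> 'k"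
    where q: "\<And>x y b. q (x + y) b = q x b + q y b" "\<And>a x b. q (\<lambda>i. a * x i) b = a * q x b" "inj q"
    "\<And>x. finite {b. q x b \<noteq> 0}"
    by (rule coordinates[of "\<lambda>a x f. a * x f"]; (unfold_locales)?)
      (auto simp: fun_eq_iff algebra_simps)
  have p0: "p 0 b = 0" for b
  proof -
    have "p 0 b + 0 = p 0 b + p 0 b" using p(1)[of 0 0 b] by (simp only: add_0_right)
    then show ?thesis by (simp only: add_left_cancel)
  qed
  have q0: "q 0 b = 0" for b
  proof -
    have "q 0 b + 0 = q 0 b + q 0 b" using q(1)[of 0 0 b] by (simp only: add_0_right)
    then show ?thesis by (simp only: add_left_cancel)
  qed
  define \<phi> :: "('k, ('k, 'c) keyspace) prime_elem \<Rightarrow> ('k, 'c) keyspace" where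
    "\<phi> = (\<lambda>(\<alpha>, \<mu>, c) y. c y + (case y of BaseKey _ \<Rightarrow> 0
       | EndKey l S e b \<Rightarrow> if l = n \<and> (S, e) \<in> nm ` R then p (\<alpha> (pick (S, e))) b else 0
       | ModKey l S e b \<Rightarrow> if l = n \<and> (S, e) \<in> nm ` R then q (\<mu> (pick (S, e))) b else 0))"
  have \<phi>: "\<phi> (\<alpha>, \<mu>, c) (BaseKey b0) = c (BaseKey b0)"
    "\<phi> (\<alpha>, \<mu>, c) (EndKey l S e f) = c (EndKey l S e f) +
       (if l = n \<and> (S, e) \<in> nm ` R then p (\<alpha> (pick (S, e))) f else 0)"
    "\<phi> (\<alpha>, \<mu>, c) (ModKey l S e m) = c (ModKey l S e m) +
       (if l = n \<and> (S, e) \<in> nm ` R then q (\<mu> (pick (S, e))) m else 0)"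
    for \<alpha> \<mu> c b0 l S e f m by (simp_all add: \<phi>_def)
  have key_ext: "x = y" if "\<And>b. x (BaseKey b) = y (BaseKey b)" "\<And>l S e f. x (EndKey l S e f) = y (EndKey l S e f)"
    "\<And>l S e f. x (ModKey l S e f) = y (ModKey l S e f)" for x y :: "('k, 'c) keyspace"
    using that by (intro ext) (metis key.exhaust)
  have low: "c (EndKey n S e f) = 0" "c (ModKey n S e m) = 0" if "c \<in> carrier D" for c S e f m
    using that D unfolding level_def by fastforce+
  let ?P = "prime_coalgebra R D"
  have sp: "smult ?P = smult (prime_space R D)" "carrier ?P = carrier (prime_space R D)"
    by (simp_all add: prime_coalgebra_def)
  have vP: "vspace ?P" using vspace_prime[OF vD R] by (simp add: vspace_def sp)
  have memP: "finite {M. \<alpha> M \<noteq> 0}" "finite {M. \<mu> M \<noteq> 0}" "c \<in> carrier D"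
    "M \<notin> R \<Longrightarrow> \<alpha> M = 0" "M \<notin> R \<Longrightarrow> \<mu> M = 0"
    if "(\<alpha>, \<mu>, c) \<in> carrier ?P" for \<alpha> \<mu> c M using that by (auto simp: sp prime_space_def)
  have inj_\<phi>: "inj_on \<phi> (carrier ?P)"
  proof (rule inj_onI)
    fix x x' assume x: "x \<in> carrier ?P" and x': "x' \<in> carrier ?P" and eq: "\<phi> x = \<phi> x'"
    obtain \<alpha> \<mu> c where x_eq: "x = (\<alpha>, \<mu>, c)" by (cases x)
    obtain \<alpha>' \<mu>' c' where x'_eq: "x' = (\<alpha>', \<mu>', c')" by (cases x')
    note m = memP(4,5)[OF x[unfolded x_eq]] memP(4,5)[OF x'[unfolded x'_eq]]
    note low' = low[OF memP(3)[OF x[unfolded x_eq]]] low[OF memP(3)[OF x'[unfolded x'_eq]]]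
    have "\<alpha> M = \<alpha>' M" for M
    proof (cases "M \<in> R")
      case True
      have "p (\<alpha> M) f = p (\<alpha>' M) f" for f
        using fun_cong[OF eq, of "EndKey n (fst (nm M)) (snd (nm M)) f"] True
        by (simp add: x_eq x'_eq \<phi> pick low')
      then show ?thesis using p(3) by (meson ext injD)
    qed (use m in auto)
    then have \<alpha>: "\<alpha> = \<alpha>'" by blast
    have "\<mu> M = \<mu>' M" for M
    proof (cases "M \<in> R")
      case True
      have "q (\<mu> M) f = q (\<mu>' M) f" for f
        using fun_cong[OF eq, of "ModKey n (fst (nm M)) (snd (nm M)) f"] True
        by (simp add: x_eq x'_eq \<phi> pick low')
      then show ?thesis using q(3) by (meson ext injD)
    qed (use m in auto)
    then have \<mu>: "\<mu> = \<mu>'" by blast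
    have "c y = c' y" for y
      using fun_cong[OF eq, of y] by (simp add: x_eq x'_eq \<phi>_def \<alpha> \<mu>)
    then show "x = x'" by (auto simp: x_eq x'_eq \<alpha> \<mu>)
  qed
  have add: "\<phi> (x + y) = \<phi> x + \<phi> y" for x y
    by (cases x; cases y; rule key_ext) (auto simp: \<phi> p(1) q(1) algebra_simps)
  have scale: "\<phi> (smult ?P a x) = key_smult a (\<phi> x)" for a x
    by (cases x; rule key_ext) (auto simp: \<phi> p(2) q(2) key_smult_def sD sp prime_space_def algebra_simps)
  have ne: "c y \<noteq> 0 \<or>
      y \<in> (\<Union>M\<in>{M. \<alpha> M \<noteq> 0}. EndKey n (fst (nm M)) (snd (nm M)) ` {b. p (\<alpha> M) b \<noteq> 0}) \<or>
      y \<in> (\<Union>M\<in>{M. \<mu> M \<noteq> 0}. ModKey n (fst (nm M)) (snd (nm M)) ` {b. q (\<mu> M) b \<noteq> 0})"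
    if "\<phi> (\<alpha>, \<mu>, c) y \<noteq> 0" for \<alpha> \<mu> c y
  proof (cases y)
    case (BaseKey b)
    then show ?thesis using that by (simp add: \<phi>)
  next
    case (EndKey l S e f)
    show ?thesis
    proof (cases "c y = 0")
      case True
      with that have *: "l = n" "(S, e) \<in> nm ` R" "p (\<alpha> (pick (S, e))) f \<noteq> 0"
        by (auto simp: EndKey \<phi> simp del: image_iff split: if_splits)
      then obtain M where "M \<in> R" "(S, e) = nm M" by blast
      with * have "l = n" "(S, e) = nm M" "p (\<alpha> M) f \<noteq> 0" by (simp_all add: pick)
      moreover from this have "\<alpha> M \<noteq> 0" using p0 by auto
      ultimately have "M \<in> {M. \<alpha> M \<noteq> 0}" "y = EndKey n (fst (nm M)) (snd (nm M)) f"
        "f \<in> {b. p (\<alpha> M) b \<noteq> 0}"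
        by (simp_all add: EndKey flip: \<open>(S, e) = nm M\<close>)
      then show ?thesis by blast
    qed simp
  next
    case (ModKey l S e f)
    show ?thesis
    proof (cases "c y = 0")
      case True
      with that have *: "l = n" "(S, e) \<in> nm ` R" "q (\<mu> (pick (S, e))) f \<noteq> 0"
        by (auto simp: ModKey \<phi> simp del: image_iff split: if_splits)
      then obtain M where "M \<in> R" "(S, e) = nm M" by blast
      with * have "l = n" "(S, e) = nm M" "q (\<mu> M) f \<noteq> 0" by (simp_all add: pick)
      moreover from this have "\<mu> M \<noteq> 0" using q0 by auto
      ultimately have "M \<in> {M. \<mu> M \<noteq> 0}" "y = ModKey n (fst (nm M)) (snd (nm M)) f"
        "f \<in> {b. q (\<mu> M) b \<noteq> 0}"
        by (simp_all add: ModKey flip: \<open>(S, e) = nm M\<close>)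
      then show ?thesis by blast
    qed simp
  qed
  have fin: "finite {y. \<phi> x y \<noteq> 0}" if x: "x \<in> carrier ?P" for x
  proof -
    obtain \<alpha> \<mu> c where x_eq: "x = (\<alpha>, \<mu>, c)" by (cases x)
    note m = memP[OF x[unfolded x_eq]]
    have "finite {y. c y \<noteq> 0}" using m D by (auto simp: level_def)
    moreover have "finite (\<Union>M\<in>{M. \<alpha> M \<noteq> 0}. EndKey n (fst (nm M)) (snd (nm M)) ` {b. p (\<alpha> M) b \<noteq> 0})"
      using m p(4) by blast
    moreover have "finite (\<Union>M\<in>{M. \<mu> M \<noteq> 0}. ModKey n (fst (nm M)) (snd (nm M)) ` {b. q (\<mu> M) b \<noteq> 0})"
      using m q(4) by blast
    ultimately show ?thesis
      by (rule finite_subset[rotated, OF finite_UnI[OF _ finite_UnI]]) (unfold x_eq, rule subsetI, drule CollectD, drule ne, simp only: Un_iff mem_Collect_eq)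
  qed
  have below: "key_below (Suc n) y" if x: "x \<in> carrier ?P" and y: "\<phi> x y \<noteq> 0" for x y
  proof -
    obtain \<alpha> \<mu> c where x_eq: "x = (\<alpha>, \<mu>, c)" by (cases x)
    have "key_below n y" if "c y \<noteq> 0" using memP(3)[OF x[unfolded x_eq]] D that by (auto simp: level_def)
    then have "key_below (Suc n) y" if "c y \<noteq> 0" using that by (cases y) auto
    then show ?thesis using ne[OF y[unfolded x_eq]] by auto
  qed
  have base: "\<phi> (in_base c) = c" for c
    by (rule key_ext) (auto simp: in_base_def \<phi> p0 q0)
  have "coalgebra_iso ?P (transport ?P \<phi>) \<phi>"
    by (rule transport(1)[OF vP inj_\<phi> add scale fin below])
  moreover have "level (Suc n) (transport ?P \<phi>)"
    by (rule transport(2)[OF vP inj_\<phi> add scale fin below])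
  ultimately show ?thesis using R base by blast
qed

theorem tower_exists:
  fixes C :: "('k::field, 'c::ab_group_add) coalgebra"
  assumes C: "coalgebra C"
  shows "\<exists>R (Cs :: nat \<Rightarrow> ('k, ('k, 'c) keyspace) coalgebra). is_tower C R Cs"
proof -
  obtain D0 :: "('k, ('k, 'c) keyspace) coalgebra" and j where D0: "level 0 D0" "coalgebra_iso C D0 j"
    using tower_base[OF C] by blast
  define step where "step D E \<longleftrightarrow> (\<exists>R \<phi>. representatives D R \<and>
    coalgebra_iso (prime_coalgebra R D) E \<phi> \<and> (\<forall>c\<in>carrier D. \<phi> (in_base c) = c))"
    for D E :: "('k, ('k, 'c) keyspace) coalgebra"
  have "\<exists>Cs. \<forall>n. (level n (Cs n) \<and> (n = 0 \<longrightarrow> Cs n = D0)) \<and> step (Cs n) (Cs (Suc n))"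
  proof (rule dependent_nat_choice)
    show "\<exists>x. level 0 x \<and> (0 = (0::nat) \<longrightarrow> x = D0)" using D0 by blast
    show "\<exists>y. (level (Suc n) y \<and> (Suc n = 0 \<longrightarrow> y = D0)) \<and> step x y"
      if "level n x \<and> (n = 0 \<longrightarrow> x = D0)" for x n
      using tower_step[of n x] that unfolding step_def by blast
  qed
  then obtain Cs where Cs: "\<And>n. level n (Cs n)" "Cs 0 = D0" "\<And>n. step (Cs n) (Cs (Suc n))" by blast
  from Cs(3) have "\<exists>R. \<forall>n. representatives (Cs n) (R n) \<and>
      (\<exists>\<phi>. coalgebra_iso (prime_coalgebra (R n) (Cs n)) (Cs (Suc n)) \<phi> \<and>
        (\<forall>c\<in>carrier (Cs n). \<phi> (in_base c) = c))"
    unfolding step_def by (intro choice) blast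
  then obtain R where R: "\<And>n. representatives (Cs n) (R n) \<and>
      (\<exists>\<phi>. coalgebra_iso (prime_coalgebra (R n) (Cs n)) (Cs (Suc n)) \<phi> \<and>
        (\<forall>c\<in>carrier (Cs n). \<phi> (in_base c) = c))"
    by blast
  have "smult (Cs n) = key_smult" for n using Cs(1)[of n] by (simp add: level_def)
  then have "is_tower C R Cs"
    using R D0(2) Cs(2) vector_space_key unfolding is_tower_def by auto
  then show ?thesis by blast
qed

end

theory Submission
  imports Defs
begin

text \<open>
  The construction adds to \<open>C\<close>, for every finite dimensional right \<open>C\<close>-comodule \<open>M\<close> up to isomorphism,
  the summands \<open>A\<^sub>M\<close> and \<open>M\<close>, with \<open>\<delta>(a) \<in> A\<^sub>M \<otimes> A\<^sub>M\<close> and \<open>\<delta>(m) \<in> A\<^sub>M \<otimes> M + M \<otimes> C\<close>. Two projections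
  of \<open>C'\<close> are therefore right \<open>C'\<close>-comodule maps: if \<open>p\<close> kills every \<open>A\<^sub>N\<close>, then \<open>(p \<otimes> 1)\<delta>\<close> kills
  \<open>A\<^sub>N\<close> and sends \<open>m\<close> to \<open>(p \<otimes> 1)\<rho>(m)\<close>. Taking for \<open>p\<close> the projection on one summand \<open>M\<close> shows
  that \<open>M\<close> is a quotient of \<open>C'\<close>; taking the projection on \<open>C\<close> shows that \<open>C\<close> is a direct summand of
  \<open>C'\<close> as a right comodule. Both are contained in \<open>tower_step_projections\<close>.

  A finite dimensional comodule \<open>M\<close> over \<open>C\<^sub>\<infinity>\<close> has a coaction with finitely many coefficients, so it
  is a comodule over some \<open>C\<^sup>(\<^sup>n\<^sup>)\<close> and hence a quotient of \<open>C\<^sup>(\<^sup>n\<^sup>+\<^sup>1\<^sup>)\<close> by the first projection.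
  The second projections, applied at all later stages, retract \<open>C\<^sub>\<infinity>\<close> onto \<open>C\<^sup>(\<^sup>n\<^sup>+\<^sup>1\<^sup>)\<close>
  (\<open>level_retraction\<close>), so \<open>M\<close> is a quotient of \<open>C\<^sub>\<infinity>\<close> (\<open>finite_dim_quotient\<close>). An arbitrary comodule is
  the sum of its finite dimensional subcomodules (\<open>finite_dim_subcomodule\<close>), so it is the image of a
  direct sum of copies of \<open>C\<^sub>\<infinity>\<close>, one for each of its elements (\<open>copies_quotient\<close>).

  Identities between tensors are avoided by letting a functional \<open>\<psi>\<close> on the coalgebra act on a comodule
  by \<open>m \<mapsto> \<Sum> \<psi>(m\<^sub>1) m\<^sub>0\<close>. In these terms coassociativity says that \<open>\<psi>\<close> after \<open>\<chi>\<close> is the convolution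
  product of \<open>\<psi>\<close> and \<open>\<chi>\<close> (\<open>comodule_iff_act\<close>), and comodule maps are the linear maps that commute with
  the action (\<open>comodule_hom_iff_act\<close>). The remaining work is to see that the structure maps of \<open>C'\<close>
  are linear with values in the right spaces (\<open>precoalgebra_prime\<close>). The comultiplication of \<open>A\<^sub>M\<close> and
  the left coaction of \<open>M\<close>, which enter there, are given by a unique existence that rests on the finite
  dimension of \<open>M\<close> (\<open>dual_comult\<close>, \<open>left_coact_linear\<close>).
\<close>

section \<open>Linear maps, functionals and finite bases\<close>

lemma
  assumes "vspace V"
  shows vspace_zero: "0 \<in> carrier V"
    and vspace_add: "x \<in> carrier V \<Longrightarrow> y \<in> carrier V \<Longrightarrow> x + y \<in> carrier V"
    and vspace_smult: "x \<in> carrier V \<Longrightarrow> smult V a x \<in> carrier V"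
    and vspace_diff: "x \<in> carrier V \<Longrightarrow> y \<in> carrier V \<Longrightarrow> x - y \<in> carrier V"
    and vspace_sum: "(\<And>i. i \<in> I \<Longrightarrow> F i \<in> carrier V) \<Longrightarrow> sum F I \<in> carrier V"
proof -
  interpret vector_space "smult V" using assms by (simp add: vspace_def)
  have s: "subspace (carrier V)" using assms by (simp add: vspace_def)
  show "0 \<in> carrier V"
    "x \<in> carrier V \<Longrightarrow> y \<in> carrier V \<Longrightarrow> x + y \<in> carrier V"
    "x \<in> carrier V \<Longrightarrow> smult V a x \<in> carrier V"
    "x \<in> carrier V \<Longrightarrow> y \<in> carrier V \<Longrightarrow> x - y \<in> carrier V"
    "(\<And>i. i \<in> I \<Longrightarrow> F i \<in> carrier V) \<Longrightarrow> sum F I \<in> carrier V"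
    using subspace_0[OF s] subspace_add[OF s] subspace_scale[OF s] subspace_diff[OF s]
      subspace_sum[OF s] by blast+
qed

lemma
  assumes "vspace V"
  shows smult_add_right: "smult V a (x + y) = smult V a x + smult V a y"
    and smult_add_left: "smult V (a + b) x = smult V a x + smult V b x"
    and smult_smult: "smult V a (smult V b x) = smult V (a * b) x"
    and smult_zero_left: "smult V 0 x = 0"
    and smult_zero_right: "smult V a 0 = 0"
proof -
  interpret vector_space "smult V" using assms by (simp add: vspace_def)
  show "smult V a (x + y) = smult V a x + smult V a y"
    "smult V (a + b) x = smult V a x + smult V b x"
    "smult V a (smult V b x) = smult V (a * b) x" "smult V 0 x = 0"
    "smult V a 0 = 0"
    by (simp_all add: scale_left_distrib scale_right_distrib)
qed

lemma vspaceI: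
  assumes "vector_space (smult V)" "0 \<in> carrier V"
    "\<And>x y. x \<in> carrier V \<Longrightarrow> y \<in> carrier V \<Longrightarrow> x + y \<in> carrier V"
    "\<And>a x. x \<in> carrier V \<Longrightarrow> smult V a x \<in> carrier V"
  shows "vspace V"
proof -
  interpret vector_space "smult V" by fact
  show ?thesis unfolding vspace_def using assms by (auto intro: subspaceI)
qed

lemma vector_space_ground: "vector_space ((*) :: 'k::field \<Rightarrow> 'k \<Rightarrow> 'k)"
  by unfold_locales (simp_all add: algebra_simps)

lemma vspace_ground: "vspace ground"
  by (rule vspaceI) (auto simp: ground_def vector_space_ground)

lemma ground_simps [simp]: "carrier ground = UNIV" "smult ground = (*)"
  by (simp_all add: ground_def)

lemma
  assumes "linear_map V W f"
  shows linear_map_mem: "x \<in> carrier V \<Longrightarrow> f x \<in> carrier W"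
    and linear_map_add: "x \<in> carrier V \<Longrightarrow> y \<in> carrier V \<Longrightarrow> f (x + y) = f x + f y"
    and linear_map_smult: "x \<in> carrier V \<Longrightarrow> f (smult V a x) = smult W a (f x)"
  using assms by (auto simp: linear_map_def)

lemma linear_mapI:
  assumes "\<And>x. x \<in> carrier V \<Longrightarrow> f x \<in> carrier W"
    "\<And>x y. x \<in> carrier V \<Longrightarrow> y \<in> carrier V \<Longrightarrow> f (x + y) = f x + f y"
    "\<And>a x. x \<in> carrier V \<Longrightarrow> f (smult V a x) = smult W a (f x)"
  shows "linear_map V W f"
  using assms by (auto simp: linear_map_def)

lemma linear_map_zero: "vspace V \<Longrightarrow> linear_map V W f \<Longrightarrow> f 0 = 0"
  using linear_map_add[of V W f 0 0] vspace_zero[of V] by simp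

lemma linear_map_diff:
  assumes V: "vspace V" and f: "linear_map V W f" and "x \<in> carrier V" "y \<in> carrier V"
  shows "f (x - y) = f x - f y"
  using linear_map_add[OF f vspace_diff[OF V assms(3,4)] assms(4)] by (simp add: algebra_simps)

lemma linear_map_sum:
  assumes V: "vspace V" and f: "linear_map V W f" and "\<And>i. i \<in> I \<Longrightarrow> F i \<in> carrier V"
  shows "f (sum F I) = (\<Sum>i\<in>I. f (F i))"
  using assms(3)
  by (induction I rule: infinite_finite_induct)
    (auto simp: linear_map_zero[OF V f] linear_map_add[OF f] vspace_sum[OF V])

lemma linear_map_comp:
  "linear_map U V f \<Longrightarrow> linear_map V W g \<Longrightarrow> linear_map U W (\<lambda>x. g (f x))"
  by (auto simp: linear_map_def)

lemma linear_map_scaled: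
  assumes "vspace W" "linear_map V W f"
  shows "linear_map V W (\<lambda>x. smult W a (f x))"
  using assms by (auto simp: linear_map_def vspace_smult smult_add_right smult_smult mult.commute)

lemma linear_map_plus:
  assumes "vspace W" "linear_map V W f" "linear_map V W g"
  shows "linear_map V W (\<lambda>x. f x + g x)"
  using assms by (auto simp: linear_map_def vspace_add smult_add_right)

abbreviation functional :: "('k::field, 'v::ab_group_add, 'z) vspace_scheme \<Rightarrow> ('v \<Rightarrow> 'k) \<Rightarrow> bool" where
  "functional V \<equiv> Vector_Spaces.linear (smult V) (*)"

lemma
  assumes "functional V f"
  shows functional_add: "f (x + y) = f x + f y" and functional_smult: "f (smult V a x) = a * f x"
proof -
  interpret Vector_Spaces.linear "smult V" "(*)" f by fact
  show "f (x + y) = f x + f y" "f (smult V a x) = a * f x" by (simp_all add: add scale)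
qed

lemma functional_linear_map: "functional V f \<Longrightarrow> linear_map V ground f"
  by (simp add: linear_map_def functional_add functional_smult)

lemma functionalI:
  assumes "vector_space (smult V)" "\<And>x y. f (x + y) = f x + f y" "\<And>a x. f (smult V a x) = a * f x"
  shows "functional V f"
  using assms vector_space_ground by (simp add: Vector_Spaces.linear_iff)

text \<open>
  Pure tensors evaluate to zero at functionals that are not linear on the whole ambient space. Maps
  that are linear only on the carrier, such as the counit, are replaced by such an extension.
\<close>

lemma extend_functional:
  assumes V: "vspace V" and f: "linear_map V ground f"
  obtains g where "functional V g" "\<And>x. x \<in> carrier V \<Longrightarrow> g x = f x"
proof -
  interpret V: vector_space "smult V" using V by (simp add: vspace_def)
  interpret vector_space_pair "smult V" "(*)"
    by (intro vector_space_pair.intro V.vector_space_axioms vector_space_ground)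
  obtain B where B: "B \<subseteq> carrier V" "V.independent B" "carrier V \<subseteq> V.span B"
    using V.maximal_independent_subset by blast
  obtain g where g: "functional V g" "\<forall>x\<in>B. g x = f x"
    using linear_independent_extend[OF B(2)] by blast
  have "x \<in> carrier V \<and> g x = f x" if "x \<in> V.span B" for x
    using that
  proof (induction rule: V.span_induct_alt)
    case base
    then show ?case
      using vspace_zero[OF V] linear_map_zero[OF V f] functional_smult[OF g(1), of 0 0] by simp
  next
    case (step a x y)
    then have "x \<in> carrier V" "smult V a x \<in> carrier V" using B(1) V by (auto intro: vspace_smult)
    with step show ?case
      using g V by (simp add: functional_add functional_smult linear_map_add[OF f]
          linear_map_smult[OF f] vspace_add)
  qed
  with g(1) B(3) that show thesis by blast
qed

lemma functional_separate:
  assumes "vspace V" "\<And>f. functional V f \<Longrightarrow> f x = f y"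
  shows "x = y"
  using vector_space.functionals_separate[of "smult V" x y] assms by (simp add: vspace_def)

text \<open>
  \<open>N\<close> has its own basis, and an independent subset of the span of a finite set is finite.
\<close>

lemma finite_dim_subspace:
  assumes V: "vspace V" and N: "vspace N" "smult N = smult V"
    and "finite B" "carrier N \<subseteq> module.span (smult V) B"
  shows "finite_dim N"
proof -
  interpret V: vector_space "smult V" using V by (simp add: vspace_def)
  obtain S where S: "S \<subseteq> carrier N" "V.independent S" "carrier N \<subseteq> V.span S"
    using V.maximal_independent_subset by blast
  have "finite S" using V.independent_span_bound[OF assms(4) S(2)] S(1) assms(5) by blast
  moreover have "V.span S = carrier N"
    using S N by (intro antisym V.span_minimal) (auto simp: vspace_def)
  ultimately show ?thesis unfolding finite_dim_def N(2) by metis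
qed

lemma finite_basis:
  assumes V: "vspace V" and "finite_dim V"
  obtains B r where "finite B" "B \<subseteq> carrier V" "\<And>b. b \<in> B \<Longrightarrow> functional V (r b)"
    "\<And>x. x \<in> carrier V \<Longrightarrow> x = (\<Sum>b\<in>B. smult V (r b x) b)"
proof -
  interpret V: vector_space "smult V" using V by (simp add: vspace_def)
  obtain S where S: "finite S" "carrier V = V.span S"
    using assms(2) by (auto simp: finite_dim_def)
  obtain B where B: "B \<subseteq> carrier V" "V.independent B" "carrier V \<subseteq> V.span B"
    using V.maximal_independent_subset by blast
  have fB: "finite B" using V.independent_span_bound[OF S(1) B(2)] B(1) S(2) by blast
  let ?E = "V.extend_basis B"
  have E: "V.independent ?E" "V.span ?E = UNIV" "B \<subseteq> ?E"
    using V.independent_extend_basis[OF B(2)] V.span_extend_basis[OF B(2)]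
      V.extend_basis_superset[OF B(2)] by auto
  show thesis
  proof (rule that[OF fB B(1)])
    show "functional V (\<lambda>x. V.representation ?E x b)" for b
      by (rule V.linear_representation[OF E(1,2)])
    fix x assume x: "x \<in> carrier V"
    have *: "V.representation ?E x = V.representation B x"
      using V.representation_extend[OF E(1) _ E(3)] B(3) x by blast
    have "(\<Sum>b\<in>B. smult V (V.representation ?E x b) b) = x"
      unfolding * by (rule V.sum_representation_eq[OF B(2)]) (use x B(3) fB in auto)
    then show "x = (\<Sum>b\<in>B. smult V (V.representation ?E x b) b)" by simp
  qed
qed

section \<open>Tensors\<close>

text \<open>
  Tensors are functions; their sums are kept as elements of a vector space instead of being
  unfolded pointwise.
\<close>

declare plus_fun_apply [simp del] zero_fun_apply [simp del]

lemma smult_tensor_prod [simp]: "smult (tensor_prod V W) = tensor_smult"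
  by (simp add: tensor_prod_def)

lemma vspace_tensor_prod:
  fixes V :: "('k::field, 'v::ab_group_add, 'y) vspace_scheme"
    and W :: "('k, 'w::ab_group_add, 'z) vspace_scheme"
  shows "vspace (tensor_prod V W)"
proof -
  interpret T: vector_space "tensor_smult :: 'k \<Rightarrow> ('k, 'v, 'w) tensor \<Rightarrow> _"
    by (rule vector_space_tensor)
  show ?thesis
    unfolding vspace_def tensor_prod_def using T.vector_space_axioms T.subspace_span by simp
qed

lemma tens_mem:
  fixes V :: "('k::field, 'v::ab_group_add, 'y) vspace_scheme"
    and W :: "('k, 'w::ab_group_add, 'z) vspace_scheme"
  assumes a: "v \<in> carrier V" "w \<in> carrier W"
  shows "tens V W v w \<in> carrier (tensor_prod V W)"
proof -
  interpret T: vector_space "tensor_smult :: 'k \<Rightarrow> ('k, 'v, 'w) tensor \<Rightarrow> _"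
    by (rule vector_space_tensor)
  show ?thesis unfolding tensor_prod_def using a by (auto intro!: T.span_base)
qed

lemma tens_zero: "tens V W 0 w = 0" "tens V W v 0 = 0"
  using tens_add_left[of V W 0 0 w] tens_add_right[of V W v 0 0] by simp_all

lemma tens_sum_right: "tens V W v (sum F I) = (\<Sum>i\<in>I. tens V W v (F i))"
  by (induction I rule: infinite_finite_induct) (simp_all add: tens_zero tens_add_right)

lemma tens_cong: "smult V = smult V' \<Longrightarrow> smult W = smult W' \<Longrightarrow> tens V W = tens V' W'"
  by (intro ext) (simp add: tens_def)

lemma tensor_prod_cong:
  "carrier V = carrier V' \<Longrightarrow> smult V = smult V' \<Longrightarrow> carrier W = carrier W' \<Longrightarrow> smult W = smult W' \<Longrightarrow>
    tensor_prod V W = tensor_prod V' W'"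
  using tens_cong[of V V' W W'] by (simp add: tensor_prod_def)

lemma tensor_lift_cong:
  "carrier V = carrier V' \<Longrightarrow> smult V = smult V' \<Longrightarrow> carrier W = carrier W' \<Longrightarrow> smult W = smult W' \<Longrightarrow>
    tensor_lift V W = tensor_lift V' W'"
  using tens_cong[of V V' W W'] by (intro ext) (simp add: tensor_lift_def)

lemma tensor_map_cong:
  "carrier V = carrier V' \<Longrightarrow> smult V = smult V' \<Longrightarrow> carrier W = carrier W' \<Longrightarrow> smult W = smult W' \<Longrightarrow>
   smult V2 = smult V2' \<Longrightarrow> smult W2 = smult W2' \<Longrightarrow>
    tensor_map V W V2 W2 = tensor_map V' W' V2' W2'"
  unfolding tensor_map_def
  by (intro ext) (metis tens_cong[of V2 V2' W2 W2'] tensor_lift_cong[of V V' W W'])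

text \<open>
  Tensors are sums of lists of pure tensors, so this is induction over such a list.
\<close>

lemma tensor_induct [consumes 2, case_names pure zero add]:
  assumes V: "vspace V" and t: "t \<in> carrier (tensor_prod V W)"
    and pure: "\<And>v w. v \<in> carrier V \<Longrightarrow> w \<in> carrier W \<Longrightarrow> P (tens V W v w)"
    and zero: "P 0"
    and add: "\<And>v w t. v \<in> carrier V \<Longrightarrow> w \<in> carrier W \<Longrightarrow> t \<in> carrier (tensor_prod V W) \<Longrightarrow>
      P t \<Longrightarrow> P (tens V W v w + t)"
  shows "P t"
proof -
  obtain xs where xs: "set xs \<subseteq> carrier V \<times> carrier W" "t = (\<Sum>(v, w)\<leftarrow>xs. tens V W v w)"
    using tensor_prod_iff[OF V] t by blast
  have "P (\<Sum>(v, w)\<leftarrow>xs. tens V W v w)"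
    using xs(1)
  proof (induction xs)
    case (Cons a xs)
    obtain v w where a: "a = (v, w)" by (cases a)
    have "(\<Sum>(v, w)\<leftarrow>xs. tens V W v w) \<in> carrier (tensor_prod V W)"
      using tensor_prod_iff[OF V] Cons.prems by auto
    then have "P (tens V W v w + (\<Sum>(v, w)\<leftarrow>xs. tens V W v w))"
      using add Cons by (auto simp: a)
    then show ?case by (simp only: a list.map sum_list.Cons prod.case)
  qed (use zero in simp)
  then show ?thesis using xs(2) by simp
qed

text \<open>
  The main device for computations: both sides of an identity are linear in the tensor, so it is
  enough to look at pure tensors.
\<close>

lemma linear_map_tensor_eqI:
  assumes V: "vspace V"
    and f: "linear_map (tensor_prod V W) X f" and g: "linear_map (tensor_prod V W) X g"
    and eq: "\<And>v w. v \<in> carrier V \<Longrightarrow> w \<in> carrier W \<Longrightarrow> f (tens V W v w) = g (tens V W v w)"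
    and t: "t \<in> carrier (tensor_prod V W)"
  shows "f t = g t"
  using V t
proof (induction rule: tensor_induct)
  case zero
  show ?case using linear_map_zero[OF vspace_tensor_prod f] linear_map_zero[OF vspace_tensor_prod g] by simp
next
  case (add v w t)
  then show ?case
    using linear_map_add[OF f tens_mem add(3)] linear_map_add[OF g tens_mem add(3)] eq by simp
qed (rule eq)

lemma tensor_lift_pure:
  assumes "vspace V" "vspace W" "bilinear_map V W s \<beta>" "v \<in> carrier V" "w \<in> carrier W"
  shows "tensor_lift V W \<beta> (tens V W v w) = \<beta> v w"
  using tensor_lift_eval[OF assms(1-3), of "[(v, w)]"] assms(4,5) by simp

lemma tensor_lift_linear:
  fixes V :: "('k::field, 'v::ab_group_add, 'y) vspace_scheme"
    and W :: "('k, 'w::ab_group_add, 'z) vspace_scheme"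
  assumes V: "vspace V" and W: "vspace W" and X: "vspace X" and b: "bilinear_map V W (smult X) \<beta>"
    and cl: "\<And>v w. v \<in> carrier V \<Longrightarrow> w \<in> carrier W \<Longrightarrow> \<beta> v w \<in> carrier X"
  shows "linear_map (tensor_prod V W) X (tensor_lift V W \<beta>)"
proof -
  note ev = tensor_lift_eval[OF V W b]
  have mem: "(\<Sum>(v, w)\<leftarrow>xs. \<beta> v w) \<in> carrier X" if "set xs \<subseteq> carrier V \<times> carrier W" for xs
    using that by (induction xs) (auto intro!: vspace_zero[OF X] vspace_add[OF X] cl)
  show ?thesis
  proof (rule linear_mapI)
    fix t assume "t \<in> carrier (tensor_prod V W)"
    then obtain xs where xs: "set xs \<subseteq> carrier V \<times> carrier W" "t = (\<Sum>(v, w)\<leftarrow>xs. tens V W v w)"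
      using tensor_prod_iff[OF V] by blast
    then show "tensor_lift V W \<beta> t \<in> carrier X" using ev mem by simp
    fix t' assume "t' \<in> carrier (tensor_prod V W)"
    then obtain ys where ys: "set ys \<subseteq> carrier V \<times> carrier W" "t' = (\<Sum>(v, w)\<leftarrow>ys. tens V W v w)"
      using tensor_prod_iff[OF V] by blast
    have "t + t' = (\<Sum>(v, w)\<leftarrow>xs @ ys. tens V W v w)" using xs ys by simp
    then show "tensor_lift V W \<beta> (t + t') = tensor_lift V W \<beta> t + tensor_lift V W \<beta> t'"
      using ev[of "xs @ ys"] ev[of xs] ev[of ys] xs ys by simp
  next
    fix a t assume "t \<in> carrier (tensor_prod V W)"
    then obtain xs where xs: "set xs \<subseteq> carrier V \<times> carrier W" "t = (\<Sum>(v, w)\<leftarrow>xs. tens V W v w)"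
      using tensor_prod_iff[OF V] by blast
    let ?ys = "map (\<lambda>(v, w). (smult V a v, w)) xs"
    interpret T: vector_space "tensor_smult :: 'k \<Rightarrow> ('k, 'v, 'w) tensor \<Rightarrow> _"
      by (rule vector_space_tensor)
    have "tensor_smult a (\<Sum>(v, w)\<leftarrow>xs. tens V W v w) = (\<Sum>(v, w)\<leftarrow>?ys. tens V W v w)"
      by (induction xs) (auto simp: tens_scale_left T.scale_right_distrib)
    moreover have ys: "set ?ys \<subseteq> carrier V \<times> carrier W" using xs(1) V by (auto intro: vspace_smult)
    moreover have "(\<Sum>(v, w)\<leftarrow>?ys. \<beta> v w) = smult X a (\<Sum>(v, w)\<leftarrow>xs. \<beta> v w)"
      using xs(1) b by (induction xs) (auto simp: bilinear_map_def smult_add_right[OF X] smult_zero_right[OF X])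
    ultimately show "tensor_lift V W \<beta> (smult (tensor_prod V W) a t) = smult X a (tensor_lift V W \<beta> t)"
      using ev[OF ys] ev[OF xs(1)] xs(2) by simp
  qed
qed

lemma bilinear_map_tens:
  assumes "linear_map V V2 f" "linear_map W W2 g"
  shows "bilinear_map V W tensor_smult (\<lambda>v w. tens V2 W2 (f v) (g w))"
  using assms unfolding bilinear_map_def linear_map_def
  by (auto simp: tens_add_left tens_add_right tens_scale_left tens_scale_right)

lemma tensor_map_pure:
  assumes "vspace V" "vspace W" "linear_map V V2 f" "linear_map W W2 g" "v \<in> carrier V" "w \<in> carrier W"
  shows "tensor_map V W V2 W2 f g (tens V W v w) = tens V2 W2 (f v) (g w)"
  unfolding tensor_map_def
  by (rule tensor_lift_pure[OF assms(1,2) bilinear_map_tens[OF assms(3,4)] assms(5,6)])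

lemma tensor_map_linear:
  assumes "vspace V" "vspace W" "linear_map V V2 f" "linear_map W W2 g"
  shows "linear_map (tensor_prod V W) (tensor_prod V2 W2) (tensor_map V W V2 W2 f g)"
  unfolding tensor_map_def
  by (rule tensor_lift_linear[OF assms(1,2) vspace_tensor_prod])
    (use bilinear_map_tens[OF assms(3,4)] assms in \<open>auto intro: tens_mem linear_map_mem\<close>)

lemma tensor_prod_mono:
  assumes V: "vspace V" and "vspace V'" "carrier V \<subseteq> carrier V'" "carrier W \<subseteq> carrier W'"
    "smult V = smult V'" "smult W = smult W'"
  shows "carrier (tensor_prod V W) \<subseteq> carrier (tensor_prod V' W')"
  using tensor_prod_iff[OF V, of _ W] tensor_prod_iff[OF assms(2), of _ W'] assms(3,4)
    tens_cong[of V V' W W', OF assms(5,6)] by (auto simp: subset_iff) blast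

text \<open>
  A list of pure tensors with entries in the subspaces also represents the tensor in the larger
  product, and the value of the lifted map can be read off from any such list.
\<close>

lemma tensor_lift_subspace:
  assumes V: "vspace V" "vspace V'" "carrier V \<subseteq> carrier V'" "smult V = smult V'"
    and W: "vspace W" "vspace W'" "carrier W \<subseteq> carrier W'" "smult W = smult W'"
    and b: "bilinear_map V' W' s \<beta>" and t: "t \<in> carrier (tensor_prod V W)"
  shows "tensor_lift V W \<beta> t = tensor_lift V' W' \<beta> t"
proof -
  obtain xs where xs: "set xs \<subseteq> carrier V \<times> carrier W" "t = (\<Sum>(v, w)\<leftarrow>xs. tens V W v w)"
    using tensor_prod_iff[OF V(1)] t by blast
  have b': "bilinear_map V W s \<beta>"
    using b V(3,4) W(3,4) by (auto simp: bilinear_map_def subset_iff)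
  have xs': "set xs \<subseteq> carrier V' \<times> carrier W'" "t = (\<Sum>(v, w)\<leftarrow>xs. tens V' W' v w)"
    using xs V(3) W(3) tens_cong[of V V' W W', OF V(4) W(4)] by auto
  show ?thesis
    using tensor_lift_eval[OF V(1) W(1) b' xs(1)] tensor_lift_eval[OF V(2) W(2) b xs'(1)] xs(2) xs'(2) by simp
qed

section \<open>Contraction by a functional\<close>

text \<open>
  The map \<open>1 \<otimes> \<psi>\<close>, with \<open>V \<otimes> K\<close> identified with \<open>V\<close>.
\<close>

definition contract ::
  "('k::field, 'v::ab_group_add, 'y) vspace_scheme \<Rightarrow> ('k, 'w::ab_group_add, 'z) vspace_scheme \<Rightarrow>
    ('w \<Rightarrow> 'k) \<Rightarrow> ('k, 'v, 'w) tensor \<Rightarrow> 'v" where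
  "contract V W \<psi> = tensor_lift V W (\<lambda>v w. smult V (\<psi> w) v)"

lemma bilinear_contract:
  assumes "vspace V" "linear_map W ground \<psi>"
  shows "bilinear_map V W (smult V) (\<lambda>v w. smult V (\<psi> w) v)"
  using assms by (auto simp: bilinear_map_def linear_map_def smult_add_left smult_add_right smult_smult mult.commute)

lemma contract_pure:
  assumes "vspace V" "vspace W" "linear_map W ground \<psi>" "v \<in> carrier V" "w \<in> carrier W"
  shows "contract V W \<psi> (tens V W v w) = smult V (\<psi> w) v"
  unfolding contract_def
  by (rule tensor_lift_pure[OF assms(1,2) bilinear_contract[OF assms(1,3)] assms(4,5)])

lemma contract_linear:
  assumes "vspace V" "vspace W" "linear_map W ground \<psi>"
  shows "linear_map (tensor_prod V W) V (contract V W \<psi>)"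
  unfolding contract_def
  by (rule tensor_lift_linear[OF assms(1,2,1) bilinear_contract[OF assms(1,3)]]) (rule vspace_smult[OF assms(1)])

lemma contract_mem:
  assumes "vspace V" "vspace W" "linear_map W ground \<psi>" "t \<in> carrier (tensor_prod V W)"
  shows "contract V W \<psi> t \<in> carrier V"
  using linear_map_mem[OF contract_linear[OF assms(1-3)] assms(4)] .

lemma contract_subspace:
  assumes V: "vspace V" "vspace V'" "carrier V \<subseteq> carrier V'" "smult V = smult V'"
    and W: "vspace W" "vspace W'" "carrier W \<subseteq> carrier W'" "smult W = smult W'"
    and "linear_map W' ground \<psi>" "t \<in> carrier (tensor_prod V W)"
  shows "contract V W \<psi> t = contract V' W' \<psi> t"
  unfolding contract_def
  using tensor_lift_subspace[OF V W bilinear_contract[OF V(2) assms(9)] assms(10)] V(4) by simp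

lemma contract_add_functional:
  assumes V: "vspace V" and W: "vspace W" and p: "linear_map W ground \<psi>" and q: "linear_map W ground \<chi>"
    and t: "t \<in> carrier (tensor_prod V W)"
  shows "contract V W (\<lambda>w. \<psi> w + \<chi> w) t = contract V W \<psi> t + contract V W \<chi> t"
proof -
  have pq: "linear_map W ground (\<lambda>w. \<psi> w + \<chi> w)" using linear_map_plus[OF vspace_ground p q] .
  show ?thesis
    by (rule linear_map_tensor_eqI[OF V contract_linear[OF V W pq]
          linear_map_plus[OF V contract_linear[OF V W p] contract_linear[OF V W q]] _ t])
      (simp add: contract_pure V W p q pq smult_add_left)
qed

lemma contract_smult_functional:
  assumes V: "vspace V" and W: "vspace W" and p: "linear_map W ground \<psi>"
    and t: "t \<in> carrier (tensor_prod V W)"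
  shows "contract V W (\<lambda>w. a * \<psi> w) t = smult V a (contract V W \<psi> t)"
proof -
  have ap: "linear_map W ground (\<lambda>w. a * \<psi> w)" using linear_map_scaled[OF vspace_ground p] by simp
  show ?thesis
    by (rule linear_map_tensor_eqI[OF V contract_linear[OF V W ap]
          linear_map_scaled[OF V contract_linear[OF V W p]] _ t])
      (simp add: contract_pure V W p ap smult_smult)
qed

lemma contract_cong:
  assumes V: "vspace V" and W: "vspace W" and p: "linear_map W ground \<psi>"
    and eq: "\<And>w. w \<in> carrier W \<Longrightarrow> \<psi> w = \<chi> w" and t: "t \<in> carrier (tensor_prod V W)"
  shows "contract V W \<psi> t = contract V W \<chi> t"
proof -
  have q: "linear_map W ground \<chi>"
    using p eq vspace_add[OF W] vspace_smult[OF W] by (auto simp: linear_map_def)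
  show ?thesis
    by (rule linear_map_tensor_eqI[OF V contract_linear[OF V W p] contract_linear[OF V W q] _ t])
      (simp add: contract_pure V W p q eq)
qed

lemma contract_tensor_map:
  assumes V: "vspace V" and W: "vspace W" and V2: "vspace V2" and W2: "vspace W2"
    and f: "linear_map V V2 f" and g: "linear_map W W2 g" and p: "linear_map W2 ground \<psi>"
    and t: "t \<in> carrier (tensor_prod V W)"
  shows "contract V2 W2 \<psi> (tensor_map V W V2 W2 f g t) = f (contract V W (\<lambda>w. \<psi> (g w)) t)"
proof -
  have pg: "linear_map W ground (\<lambda>w. \<psi> (g w))" using linear_map_comp[OF g p] .
  show ?thesis
    by (rule linear_map_tensor_eqI[OF V linear_map_comp[OF tensor_map_linear[OF V W f g] contract_linear[OF V2 W2 p]]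
          linear_map_comp[OF contract_linear[OF V W pg] f] _ t])
      (simp add: contract_pure tensor_map_pure[OF V W f g] V W V2 W2 p pg linear_map_smult[OF f]
         linear_map_mem[OF f] linear_map_mem[OF g])
qed

text \<open>
  Contracting both factors gives the value of the tensor as a function of two functionals.
\<close>

lemma functional_contract:
  assumes V: "vspace V" and W: "vspace W" and f: "functional V f" and p: "functional W p"
    and t: "t \<in> carrier (tensor_prod V W)"
  shows "f (contract V W p t) = t f p"
proof -
  have ev: "linear_map (tensor_prod V W) ground (\<lambda>t. t f p)"
    by (auto simp: linear_map_def tensor_smult_def plus_fun_apply)
  show ?thesis
    by (rule linear_map_tensor_eqI[OF V linear_map_comp[OF contract_linear[OF V W functional_linear_map[OF p]]
            functional_linear_map[OF f]] ev _ t])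
      (use f p in \<open>simp add: contract_pure V W functional_linear_map functional_smult, simp add: tens_def\<close>)
qed

lemma tensor_nonlinear:
  assumes V: "vspace V" and t: "t \<in> carrier (tensor_prod V W)" and n: "\<not> (functional V f \<and> functional W p)"
  shows "t f p = 0"
  using V t by (induction rule: tensor_induct) (use n in \<open>auto simp: tens_def plus_fun_apply zero_fun_apply\<close>)

text \<open>
  Writing the second factors in a basis of \<open>W\<close> gives \<open>t = \<Sum> u\<^sub>b \<otimes> b\<close> with \<open>b\<close> in a finite independent
  set; the coordinate functional of \<open>b\<close> recovers \<open>u\<^sub>b\<close> as a contraction of \<open>t\<close>. All statements that
  a tensor is determined by, or has coefficients in a space given by, its contractions follow.
\<close>

lemma tensor_expand:
  assumes V: "vspace V" and W: "vspace W" and t: "t \<in> carrier (tensor_prod V W)"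
  obtains F r where "finite F" "F \<subseteq> carrier W" "\<And>b. functional W (r b)"
    "\<And>b b'. b \<in> F \<Longrightarrow> b' \<in> F \<Longrightarrow> r b b' = (if b = b' then 1 else 0)"
    "t = (\<Sum>b\<in>F. tens V W (contract V W (r b) t) b)"
proof -
  interpret W: vector_space "smult W" using W by (simp add: vspace_def)
  obtain xs where xs: "set xs \<subseteq> carrier V \<times> carrier W" "t = (\<Sum>(v, w)\<leftarrow>xs. tens V W v w)"
    using tensor_prod_iff[OF V] t by blast
  obtain B where B: "B \<subseteq> carrier W" "W.independent B" "carrier W \<subseteq> W.span B"
    using W.maximal_independent_subset by blast
  let ?E = "W.extend_basis B"
  have E: "W.independent ?E" "W.span ?E = UNIV" "B \<subseteq> ?E"
    using W.independent_extend_basis[OF B(2)] W.span_extend_basis[OF B(2)]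
      W.extend_basis_superset[OF B(2)] by auto
  define r where "r b w = W.representation ?E w b" for b w
  have rB: "W.representation ?E w = W.representation B w" if "w \<in> carrier W" for w
    using W.representation_extend[OF E(1) _ E(3)] B(3) that by blast
  have lin: "functional W (r b)" for b
    unfolding r_def by (rule W.linear_representation[OF E(1,2)])
  \<comment> \<open>only the basis elements that occur in the chosen representation of \<open>t\<close>\<close>
  define F where "F = (\<Union>(v, w)\<in>set xs. {b. r b w \<noteq> 0})"
  have finF: "finite F" unfolding F_def r_def by (auto intro: W.finite_representation)
  have "b \<in> B" if "r b w \<noteq> 0" "(v, w) \<in> set xs" for v w b
    using that xs(1) rB[of w] W.representation_ne_zero[of B w b] by (auto simp: r_def)
  then have FB: "F \<subseteq> B" unfolding F_def by auto
  have expand: "w = (\<Sum>b\<in>F. smult W (r b w) b)" if "(v, w) \<in> set xs" for v w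
  proof -
    have "w = (\<Sum>b | r b w \<noteq> 0. smult W (r b w) b)"
      using W.sum_nonzero_representation_eq[OF E(1), of w] E(2) by (simp add: r_def)
    also have "\<dots> = (\<Sum>b\<in>F. smult W (r b w) b)"
      by (rule sum.mono_neutral_left) (use finF that in \<open>auto simp: F_def\<close>)
    finally show ?thesis .
  qed
  have key: "(\<Sum>(v, w)\<leftarrow>ys. tens V W v w) =
      (\<Sum>b\<in>F. tens V W (contract V W (r b) (\<Sum>(v, w)\<leftarrow>ys. tens V W v w)) b)" if "set ys \<subseteq> set xs" for ys
    using that
  proof (induction ys)
    case Nil
    have "contract V W (r b) 0 = 0" for b
      using linear_map_zero[OF vspace_tensor_prod contract_linear[OF V W functional_linear_map[OF lin]]] .
    then show ?case by (simp add: tens_zero)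
  next
    case (Cons y ys)
    obtain v w where y: "y = (v, w)" by (cases y)
    define s where "s = (\<Sum>(v, w)\<leftarrow>ys. tens V W v w)"
    have mem: "v \<in> carrier V" "w \<in> carrier W" using Cons.prems xs(1) y by auto
    have "set ys \<subseteq> carrier V \<times> carrier W" using Cons.prems xs(1) by auto
    then have s: "s \<in> carrier (tensor_prod V W)" unfolding s_def tensor_prod_iff[OF V] by blast
    have "contract V W (r b) (tens V W v w + s) = smult V (r b w) v + contract V W (r b) s" for b
      using linear_map_add[OF contract_linear[OF V W functional_linear_map[OF lin[of b]]] tens_mem[OF mem] s]
      by (simp add: contract_pure[OF V W functional_linear_map[OF lin]] mem)
    moreover have "tens V W v w = (\<Sum>b\<in>F. tens V W (smult V (r b w) v) b)"
    proof -
      have "tens V W v w = tens V W v (\<Sum>b\<in>F. smult W (r b w) b)"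
        using expand[of v w] Cons.prems y by simp
      also have "\<dots> = (\<Sum>b\<in>F. tens V W (smult V (r b w) v) b)"
        unfolding tens_sum_right by (simp add: tens_scale_left tens_scale_right)
      finally show ?thesis .
    qed
    ultimately have "tens V W v w + s = (\<Sum>b\<in>F. tens V W (contract V W (r b) (tens V W v w + s)) b)"
      using Cons.IH Cons.prems by (simp add: tens_add_left sum.distrib flip: s_def)
    then show ?case by (simp only: y list.map sum_list.Cons prod.case s_def)
  qed
  show thesis
  proof (rule that[OF finF])
    show "F \<subseteq> carrier W" using FB B(1) by blast
    show "functional W (r b)" for b by (rule lin)
    show "r b b' = (if b = b' then 1 else 0)" if "b \<in> F" "b' \<in> F" for b b'
      using W.representation_basis[OF E(1), of b'] that FB E(3) by (auto simp: r_def)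
    show "t = (\<Sum>b\<in>F. tens V W (contract V W (r b) t) b)" using key[of xs] xs(2) by simp
  qed
qed

lemma tensor_eqI_contract:
  assumes V: "vspace V" and W: "vspace W"
    and s: "s \<in> carrier (tensor_prod V W)" and t: "t \<in> carrier (tensor_prod V W)"
    and eq: "\<And>\<psi>. functional W \<psi> \<Longrightarrow> contract V W \<psi> s = contract V W \<psi> t"
  shows "s = t"
proof -
  have st: "s - t \<in> carrier (tensor_prod V W)" using vspace_diff[OF vspace_tensor_prod s t] .
  obtain F r where F: "finite F" "F \<subseteq> carrier W" "\<And>b. functional W (r b)"
    "\<And>b b'. b \<in> F \<Longrightarrow> b' \<in> F \<Longrightarrow> r b b' = (if b = b' then 1 else 0)"
    "s - t = (\<Sum>b\<in>F. tens V W (contract V W (r b) (s - t)) b)"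
    by (rule tensor_expand[OF V W st], rule that)
  have "contract V W (r b) (s - t) = 0" for b
    using linear_map_diff[OF vspace_tensor_prod contract_linear[OF V W functional_linear_map[OF F(3)]] s t] eq[OF F(3)]
    by simp
  with F(5) show ?thesis by (simp add: tens_zero)
qed

text \<open>
  If all contractions lie in \<open>N\<close>, so do the coefficients \<open>u\<^sub>b\<close> of an expansion \<open>t = \<Sum> u\<^sub>b \<otimes> b\<close>.
\<close>

lemma tensor_mem_contract:
  assumes V: "vspace V" and W: "vspace W" and t: "t \<in> carrier (tensor_prod V W)"
    and N: "smult N = smult V"
    and mem: "\<And>\<psi>. functional W \<psi> \<Longrightarrow> contract V W \<psi> t \<in> carrier N"
  shows "t \<in> carrier (tensor_prod N W)"
proof -
  obtain F r where F: "finite F" "F \<subseteq> carrier W" "\<And>b. functional W (r b)"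
    "\<And>b b'. b \<in> F \<Longrightarrow> b' \<in> F \<Longrightarrow> r b b' = (if b = b' then 1 else 0)"
    "t = (\<Sum>b\<in>F. tens V W (contract V W (r b) (t)) b)"
    by (rule tensor_expand[OF V W t], rule that)
  have "(\<Sum>b\<in>F. tens N W (contract V W (r b) t) b) \<in> carrier (tensor_prod N W)"
    using F mem by (intro vspace_sum[OF vspace_tensor_prod] tens_mem) auto
  then show ?thesis using F(5) tens_cong[of N V W W, OF N refl] by simp
qed


section \<open>Comodules through the action of functionals\<close>

text \<open>
  The linear data of a coalgebra. This is the property that is carried from \<open>C\<close> to \<open>C'\<close> and up the tower.
\<close>

definition precoalgebra :: "('k::field, 'v::ab_group_add) coalgebra \<Rightarrow> bool" where
  "precoalgebra C \<longleftrightarrow>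
     vspace C \<and> linear_map C (tensor_prod C C) (comult C) \<and> linear_map C ground (counit C)"

text \<open>
  The left action of the dual algebra of \<open>C\<close> on the right comodule \<open>M\<close>.
\<close>

definition act ::
  "('k::field, 'v::ab_group_add) coalgebra \<Rightarrow> ('k, 'm::ab_group_add, 'v) comodule \<Rightarrow>
    ('v \<Rightarrow> 'k) \<Rightarrow> 'm \<Rightarrow> 'm" where
  "act C M \<psi> m = contract M C \<psi> (coact M m)"

lemma bilinear_assoc_inner:
  "bilinear_map U V tensor_smult (\<lambda>u v. tens U (tensor_prod V W) u (tens V W v w))"
proof -
  have "tens U (tensor_prod V W) x (tensor_smult a t) = tensor_smult a (tens U (tensor_prod V W) x t)" for a x t
    using tens_scale_right[of U "tensor_prod V W" x a t] by simp
  then show ?thesis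
    by (simp add: bilinear_map_def tens_add_left tens_add_right tens_scale_left)
qed

lemma assoc_inner_linear:
  assumes U: "vspace U" and V: "vspace V" and w: "w \<in> carrier W"
  shows "linear_map (tensor_prod U V) (tensor_prod U (tensor_prod V W))
    (tensor_lift U V (\<lambda>u v. tens U (tensor_prod V W) u (tens V W v w)))"
  by (rule tensor_lift_linear[OF U V vspace_tensor_prod])
    (use bilinear_assoc_inner w in \<open>auto intro: tens_mem\<close>)

lemma bilinear_assoc_outer:
  assumes U: "vspace U" and V: "vspace V" and W: "vspace W"
  shows "bilinear_map (tensor_prod U V) W tensor_smult
    (\<lambda>s w. tensor_lift U V (\<lambda>u v. tens U (tensor_prod V W) u (tens V W v w)) s)"
proof -
  let ?L = "\<lambda>w. tensor_lift U V (\<lambda>u v. tens U (tensor_prod V W) u (tens V W v w))"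
  note lin = assoc_inner_linear[OF U V]
  note pure = tensor_lift_pure[OF U V bilinear_assoc_inner]
  note vT = vspace_tensor_prod[of U "tensor_prod V W"]
  have "?L (w + w') s = ?L w s + ?L w' s"
    if "w \<in> carrier W" "w' \<in> carrier W" "s \<in> carrier (tensor_prod U V)" for w w' s
    by (rule linear_map_tensor_eqI[OF U lin[OF vspace_add[OF W that(1,2)]]
          linear_map_plus[OF vT lin[OF that(1)] lin[OF that(2)]] _ that(3)])
      (simp only: pure, simp only: tens_add_right)
  moreover have "?L (smult W a w) s = tensor_smult a (?L w s)"
    if "w \<in> carrier W" "s \<in> carrier (tensor_prod U V)" for w a s
  proof -
    have sc: "tens U (tensor_prod V W) u (tensor_smult a t) = tensor_smult a (tens U (tensor_prod V W) u t)" for u t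
      using tens_scale_right[of U "tensor_prod V W" u a t] by simp
    have "?L (smult W a w) s = smult (tensor_prod U (tensor_prod V W)) a (?L w s)"
      by (rule linear_map_tensor_eqI[OF U lin[OF vspace_smult[OF W that(1)]]
          linear_map_scaled[OF vT lin[OF that(1)]] _ that(2)])
        (simp only: pure, simp only: tens_scale_right[of V] sc smult_tensor_prod)
    then show ?thesis by simp
  qed
  ultimately show ?thesis
    using lin linear_map_smult[OF lin] by (auto simp: bilinear_map_def linear_map_add[OF lin])
qed

lemma tensor_assoc_linear:
  assumes U: "vspace U" and V: "vspace V" and W: "vspace W"
  shows "linear_map (tensor_prod (tensor_prod U V) W) (tensor_prod U (tensor_prod V W)) (tensor_assoc U V W)"
  unfolding tensor_assoc_def
  by (rule tensor_lift_linear[OF vspace_tensor_prod W vspace_tensor_prod])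
    (use bilinear_assoc_outer[OF U V W] linear_map_mem[OF assoc_inner_linear[OF U V]] in auto)

lemma functional_eval: "functional (tensor_prod V W) (\<lambda>s. s \<psi> \<chi>)"
  by (rule functionalI) (simp_all add: vector_space_tensor plus_fun_apply tensor_smult_def)

text \<open>
  An expansion \<open>d = \<Sum> u\<^sub>b \<otimes> b\<close> of the difference has independent \<open>b\<close> in \<open>V \<otimes> W\<close>. For a functional \<open>f\<close>
  on \<open>U\<close> the hypothesis says that \<open>\<Sum> f(u\<^sub>b) b\<close> vanishes at all pairs \<open>(\<psi>, \<chi>)\<close>, hence is zero, and then
  all \<open>f(u\<^sub>b)\<close> are zero by independence.
\<close>

lemma tensor_eqI_eval:
  fixes U :: "('k::field, 'u::ab_group_add, 'x) vspace_scheme"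
    and V :: "('k, 'v::ab_group_add, 'y) vspace_scheme" and W :: "('k, 'w::ab_group_add, 'z) vspace_scheme"
  assumes U: "vspace U" and V: "vspace V" and W: "vspace W"
    and s: "s \<in> carrier (tensor_prod U (tensor_prod V W))" and t: "t \<in> carrier (tensor_prod U (tensor_prod V W))"
    and eq: "\<And>\<psi> \<chi>. functional V \<psi> \<Longrightarrow> functional W \<chi> \<Longrightarrow>
      contract U (tensor_prod V W) (\<lambda>s. s \<psi> \<chi>) s = contract U (tensor_prod V W) (\<lambda>s. s \<psi> \<chi>) t"
  shows "s = t"
proof -
  let ?T = "tensor_prod V W"
  note vT = vspace_tensor_prod[of V W]
  define d where "d = s - t"
  have d: "d \<in> carrier (tensor_prod U ?T)" unfolding d_def by (rule vspace_diff[OF vspace_tensor_prod s t])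
  obtain F r where F: "finite F" "F \<subseteq> carrier ?T" "\<And>b. functional ?T (r b)"
    "\<And>b b'. b \<in> F \<Longrightarrow> b' \<in> F \<Longrightarrow> r b b' = (if b = b' then 1 else 0)"
    "d = (\<Sum>b\<in>F. tens U ?T (contract U ?T (r b) d) b)"
    by (rule tensor_expand[OF U vT d], rule that)
  define u where "u b = contract U ?T (r b) d" for b
  have d_eq: "d = (\<Sum>b\<in>F. tens U ?T (u b) b)" using F(5) by (simp add: u_def)
  have zero: "contract U ?T (\<lambda>s. s \<psi> \<chi>) d = 0" if "functional V \<psi>" "functional W \<chi>" for \<psi> \<chi>
    using linear_map_diff[OF vspace_tensor_prod contract_linear[OF U vT functional_linear_map[OF functional_eval]] s t] eq[OF that]
    by (simp add: d_def)
  have "u b = 0" if b: "b \<in> F" for b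
  proof (rule functional_separate[OF U])
    fix f assume f: "functional U f"
    have f0: "f 0 = 0" using linear_map_zero[OF U functional_linear_map[OF f]] .
    define z where "z = (\<Sum>b\<in>F. tensor_smult (f (u b)) b)"
    have zT: "z \<in> carrier ?T"
      unfolding z_def using F(2) vspace_smult[OF vT] by (auto intro!: vspace_sum[OF vT])
    have ev: "(\<Sum>i\<in>F. g i) \<psi> \<chi> = (\<Sum>i\<in>F. g i \<psi> \<chi>)" for g :: "_ \<Rightarrow> ('k, 'v, 'w) tensor" and \<psi> \<chi>
      using F(1) by (induction F rule: finite_induct) (simp_all add: zero_fun_apply plus_fun_apply)
    have ev': "(\<Sum>i\<in>F. g i) \<psi> \<chi> = (\<Sum>i\<in>F. g i \<psi> \<chi>)" for g :: "_ \<Rightarrow> ('k, 'u, ('k, 'v, 'w) tensor) tensor" and \<psi> \<chi>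
      using F(1) by (induction F rule: finite_induct) (simp_all add: zero_fun_apply plus_fun_apply)
    have "z \<psi> \<chi> = 0" for \<psi> \<chi>
    proof (cases "functional V \<psi> \<and> functional W \<chi>")
      case True
      have "z \<psi> \<chi> = (\<Sum>b\<in>F. tens U ?T (u b) b f (\<lambda>s. s \<psi> \<chi>))"
        unfolding z_def ev by (rule sum.cong) (use f functional_eval[of V W] in \<open>simp_all add: tensor_smult_def tens_def\<close>)
      also have "\<dots> = d f (\<lambda>s. s \<psi> \<chi>)"
        by (subst d_eq, subst ev') rule
      also have "\<dots> = f (contract U ?T (\<lambda>s. s \<psi> \<chi>) d)"
        using functional_contract[OF U vT f functional_eval d] by simp
      also have "\<dots> = 0" using zero True f0 by simp
      finally show ?thesis .
    qed (rule tensor_nonlinear[OF V zT])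
    then have "z = 0" by (intro ext) (simp add: zero_fun_apply)
    then have "r b z = 0" using linear_map_zero[OF vT functional_linear_map[OF F(3)]] by simp
    moreover have "r b z = (\<Sum>b'\<in>F. r b (tensor_smult (f (u b')) b'))"
      unfolding z_def using F(2) vspace_smult[OF vT]
      by (intro linear_map_sum[OF vT functional_linear_map[OF F(3)]]) auto
    moreover have "\<dots> = (\<Sum>b'\<in>F. if b = b' then f (u b) else 0)"
      using functional_smult[OF F(3)] F(4)[OF b] by (intro sum.cong) auto
    ultimately have "f (u b) = 0" using F(1) b by simp
    then show "f (u b) = f 0" using f0 by simp
  qed
  then have "d = 0" using d_eq by (simp add: tens_zero)
  then show ?thesis by (simp add: d_def)
qed

text \<open>
  For \<open>t = m \<otimes> c\<close> with \<open>\<rho>(m) = \<Sum> m\<^sub>0 \<otimes> m\<^sub>1\<close> both sides are \<open>\<Sum> \<psi>(m\<^sub>1) \<chi>(c) m\<^sub>0\<close>.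
\<close>

lemma contract_coassoc_left:
  assumes M: "vspace M" and C: "vspace C" and \<rho>: "linear_map M (tensor_prod M C) \<rho>"
    and p: "functional C \<psi>" and q: "functional C \<chi>" and t: "t \<in> carrier (tensor_prod M C)"
  shows "contract M (tensor_prod C C) (\<lambda>s. s \<psi> \<chi>)
      (tensor_assoc M C C (tensor_map M C (tensor_prod M C) C \<rho> id t)) =
    contract M C \<psi> (\<rho> (contract M C \<chi> t))"
proof -
  note vT = vspace_tensor_prod
  note P = functional_linear_map[OF p] and Q = functional_linear_map[OF q]
  note cev = contract_linear[OF M vT functional_linear_map[OF functional_eval[of C C \<psi> \<chi>]]]
  have inner: "contract M (tensor_prod C C) (\<lambda>s. s \<psi> \<chi>)
       (tensor_lift M C (\<lambda>u v. tens M (tensor_prod C C) u (tens C C v c)) s) =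
      smult M (\<chi> c) (contract M C \<psi> s)"
    if c: "c \<in> carrier C" and s: "s \<in> carrier (tensor_prod M C)" for c s
  proof (rule linear_map_tensor_eqI[OF M linear_map_comp[OF assoc_inner_linear[OF M C c] cev]
          linear_map_scaled[OF M contract_linear[OF M C P]] _ s])
    have pq: "tens C C w c \<psi> \<chi> = \<chi> c * \<psi> w" for w
      using p q by (simp add: tens_def mult.commute)
    fix v w assume vw: "v \<in> carrier M" "w \<in> carrier C"
    have "contract M (tensor_prod C C) (\<lambda>s. s \<psi> \<chi>) (tens M (tensor_prod C C) v (tens C C w c)) =
        smult M (tens C C w c \<psi> \<chi>) v"
      by (rule contract_pure[OF M vT functional_linear_map[OF functional_eval] vw(1) tens_mem[OF vw(2) c]])
    then show "contract M (tensor_prod C C) (\<lambda>s. s \<psi> \<chi>)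
        (tensor_lift M C (\<lambda>u v. tens M (tensor_prod C C) u (tens C C v c)) (tens M C v w)) =
       smult M (\<chi> c) (contract M C \<psi> (tens M C v w))"
      using vw tensor_lift_pure[OF M C bilinear_assoc_inner[where W = C] vw] pq[of w]
      by (simp add: contract_pure[OF M C P] smult_smult[OF M])
  qed
  show ?thesis
  proof (rule linear_map_tensor_eqI[OF M _ _ _ t])
    show "linear_map (tensor_prod M C) M (\<lambda>t. contract M (tensor_prod C C) (\<lambda>s. s \<psi> \<chi>)
      (tensor_assoc M C C (tensor_map M C (tensor_prod M C) C \<rho> id t)))"
      by (rule linear_map_comp[OF linear_map_comp[OF tensor_map_linear[OF M C \<rho> linear_map_id]
              tensor_assoc_linear[OF M C C]] cev])
    show "linear_map (tensor_prod M C) M (\<lambda>t. contract M C \<psi> (\<rho> (contract M C \<chi> t)))"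
      by (rule linear_map_comp[OF linear_map_comp[OF contract_linear[OF M C Q] \<rho>] contract_linear[OF M C P]])
    fix m c assume mc: "m \<in> carrier M" "c \<in> carrier C"
    have "tensor_assoc M C C (tensor_map M C (tensor_prod M C) C \<rho> id (tens M C m c)) =
        tensor_lift M C (\<lambda>u v. tens M (tensor_prod C C) u (tens C C v c)) (\<rho> m)"
      using tensor_lift_pure[OF vT C bilinear_assoc_outer[OF M C C] linear_map_mem[OF \<rho> mc(1)] mc(2)]
      by (simp add: tensor_map_pure[OF M C \<rho> linear_map_id mc] tensor_assoc_def)
    then show "contract M (tensor_prod C C) (\<lambda>s. s \<psi> \<chi>)
        (tensor_assoc M C C (tensor_map M C (tensor_prod M C) C \<rho> id (tens M C m c))) =
       contract M C \<psi> (\<rho> (contract M C \<chi> (tens M C m c)))"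
      using mc by (simp add: inner linear_map_mem[OF \<rho>] contract_pure[OF M C Q] linear_map_smult[OF \<rho>])
        (simp add: linear_map_smult[OF contract_linear[OF M C P], simplified] linear_map_mem[OF \<rho>])
  qed
qed

lemma linear_map_convolution:
  assumes "linear_map C (tensor_prod C C) (comult C)"
  shows "linear_map C ground (\<lambda>c. comult C c \<psi> \<chi>)"
  using assms by (auto simp: linear_map_def tensor_smult_def plus_fun_apply)

text \<open>
  The functionals \<open>\<psi> \<otimes> \<chi>\<close> separate \<open>M \<otimes> (C \<otimes> C)\<close>, and contracting the two sides of coassociativity by
  \<open>\<psi> \<otimes> \<chi>\<close> gives the action of \<open>\<psi>\<close> after \<open>\<chi>\<close> and the action of the convolution product
  \<open>c \<mapsto> \<Delta>(c)(\<psi>, \<chi>)\<close>.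
\<close>

lemma comodule_iff_act:
  assumes C: "precoalgebra C"
  shows "comodule C M \<longleftrightarrow> vspace M \<and> linear_map M (tensor_prod M C) (coact M) \<and>
    (\<forall>m\<in>carrier M. act C M (counit C) m = m \<and>
      (\<forall>\<psi> \<chi>. functional C \<psi> \<longrightarrow> functional C \<chi> \<longrightarrow>
         act C M \<psi> (act C M \<chi> m) = act C M (\<lambda>c. comult C c \<psi> \<chi>) m))"
proof -
  have vC: "vspace C" and \<Delta>: "linear_map C (tensor_prod C C) (comult C)"
    using C by (simp_all add: precoalgebra_def)
  have "tensor_assoc M C C (tensor_map M C (tensor_prod M C) C (coact M) id (coact M m)) =
          tensor_map M C M (tensor_prod C C) id (comult C) (coact M m) \<longleftrightarrow>
      (\<forall>\<psi> \<chi>. functional C \<psi> \<longrightarrow> functional C \<chi> \<longrightarrow>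
         act C M \<psi> (act C M \<chi> m) = act C M (\<lambda>c. comult C c \<psi> \<chi>) m)" (is "?l = ?r \<longleftrightarrow> _")
    if M: "vspace M" and \<rho>: "linear_map M (tensor_prod M C) (coact M)" and m: "m \<in> carrier M" for m
  proof -
    have t: "coact M m \<in> carrier (tensor_prod M C)" using linear_map_mem[OF \<rho> m] .
    have l: "?l \<in> carrier (tensor_prod M (tensor_prod C C))"
      by (rule linear_map_mem[OF linear_map_comp[OF tensor_map_linear[OF M vC \<rho> linear_map_id]
              tensor_assoc_linear[OF M vC vC]] t])
    have r: "?r \<in> carrier (tensor_prod M (tensor_prod C C))"
      by (rule linear_map_mem[OF tensor_map_linear[OF M vC linear_map_id \<Delta>] t])
    have cr: "contract M (tensor_prod C C) (\<lambda>s. s \<psi> \<chi>) ?r = act C M (\<lambda>c. comult C c \<psi> \<chi>) m" for \<psi> \<chi>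
      using contract_tensor_map[OF M vC M vspace_tensor_prod linear_map_id \<Delta>
          functional_linear_map[OF functional_eval[of C C \<psi> \<chi>]] t]
      by (simp add: act_def)
    have cl: "contract M (tensor_prod C C) (\<lambda>s. s \<psi> \<chi>) ?l = act C M \<psi> (act C M \<chi> m)"
      if "functional C \<psi>" "functional C \<chi>" for \<psi> \<chi>
      using contract_coassoc_left[OF M vC \<rho> that t] by (simp add: act_def)
    show ?thesis using tensor_eqI_eval[OF M vC vC l r] cl cr by metis
  qed
  then show ?thesis
    unfolding comodule_def by (auto simp: act_def contract_def)
qed

lemma
  assumes "comodule C M"
  shows comodule_vspace: "vspace M" and coact_linear: "linear_map M (tensor_prod M C) (coact M)"
    and coact_mem: "m \<in> carrier M \<Longrightarrow> coact M m \<in> carrier (tensor_prod M C)"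
    and coact_image: "coact M ` carrier M \<subseteq> carrier (tensor_prod M C)"
  using assms by (auto simp: comodule_def linear_map_def)

lemma act_linear:
  assumes "vspace C" "vspace M" "linear_map M (tensor_prod M C) (coact M)" "linear_map C ground \<psi>"
  shows "linear_map M M (act C M \<psi>)"
  using linear_map_comp[OF assms(3) contract_linear[OF assms(2,1,4)]] by (simp add: act_def[abs_def])

text \<open>
  Contracting \<open>(f \<otimes> 1)\<rho>(m)\<close> by \<open>\<psi>\<close> gives \<open>f(\<psi> \<cdot> m)\<close>, and contractions separate tensors.
\<close>

lemma comodule_hom_iff_act:
  assumes C: "vspace C" and M: "vspace M" and N: "vspace N"
    and rM: "coact M ` carrier M \<subseteq> carrier (tensor_prod M C)"
    and rN: "coact N ` carrier N \<subseteq> carrier (tensor_prod N C)"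
  shows "comodule_hom C M N f \<longleftrightarrow> linear_map M N f \<and>
    (\<forall>m\<in>carrier M. \<forall>\<psi>. functional C \<psi> \<longrightarrow> act C N \<psi> (f m) = f (act C M \<psi> m))"
proof -
  have "coact N (f m) = tensor_map M C N C f id (coact M m) \<longleftrightarrow>
      (\<forall>\<psi>. functional C \<psi> \<longrightarrow> act C N \<psi> (f m) = f (act C M \<psi> m))"
    if f: "linear_map M N f" and m: "m \<in> carrier M" for m
  proof -
    have rm: "coact M m \<in> carrier (tensor_prod M C)" and rfm: "coact N (f m) \<in> carrier (tensor_prod N C)"
      using rM rN m linear_map_mem[OF f m] by auto
    have r: "tensor_map M C N C f id (coact M m) \<in> carrier (tensor_prod N C)"
      by (rule linear_map_mem[OF tensor_map_linear[OF M C f linear_map_id] rm])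
    have "contract N C \<psi> (tensor_map M C N C f id (coact M m)) = f (act C M \<psi> m)" if "functional C \<psi>" for \<psi>
      using contract_tensor_map[OF M C N C f linear_map_id functional_linear_map[OF that] rm]
      by (simp add: act_def)
    then show ?thesis
      using tensor_eqI_contract[OF N C rfm r] by (auto simp: act_def)
  qed
  then show ?thesis unfolding comodule_hom_def by blast
qed

text \<open>
  Stability under the action puts the coaction of \<open>N\<close> into \<open>N \<otimes> C\<close>, by \<open>tensor_mem_contract\<close>.
\<close>

lemma subcomodule:
  assumes C: "precoalgebra C" and M: "comodule C M"
    and N: "vspace N" "smult N = smult M" "coact N = coact M" "carrier N \<subseteq> carrier M"
    and closed: "\<And>\<psi> m. functional C \<psi> \<Longrightarrow> m \<in> carrier N \<Longrightarrow> act C M \<psi> m \<in> carrier N"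
  shows "comodule C N"
proof -
  have vC: "vspace C" and \<Delta>: "linear_map C (tensor_prod C C) (comult C)" and \<epsilon>: "linear_map C ground (counit C)"
    using C by (simp_all add: precoalgebra_def)
  note vM = comodule_vspace[OF M]
  have mem: "coact M m \<in> carrier (tensor_prod N C)" if "m \<in> carrier N" for m
    by (rule tensor_mem_contract[OF vM vC coact_mem[OF M] N(2)]) (use closed that N(4) in \<open>auto simp: act_def\<close>)
  have act_eq: "act C N \<psi> m = act C M \<psi> m" if "linear_map C ground \<psi>" "m \<in> carrier N" for \<psi> m
    using contract_subspace[OF N(1) vM N(4,2) vC vC subset_refl refl that(1) mem[OF that(2)]]
    by (simp add: act_def N(3))
  have "linear_map N (tensor_prod N C) (coact N)"
    using N(4) mem
    by (intro linear_mapI) (auto simp: N(2,3) subset_iff linear_map_add[OF coact_linear[OF M]]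
        linear_map_smult[OF coact_linear[OF M]])
  then show ?thesis
    using M N(1,4) closed linear_map_convolution[OF \<Delta>] \<epsilon> unfolding comodule_iff_act[OF C]
    by (auto simp: act_eq[OF functional_linear_map] act_eq subset_iff)
qed

text \<open>
  The orbit of \<open>m\<close> under the functionals is a subcomodule because the action is multiplicative for
  convolution. It is spanned by the finitely many left coefficients of \<open>\<rho>(m)\<close>, and it contains
  \<open>m = \<epsilon> \<cdot> m\<close>.
\<close>

lemma finite_dim_subcomodule:
  fixes C :: "('k::field, 'v::ab_group_add) coalgebra" and M :: "('k, 'm::ab_group_add, 'v) comodule"
  assumes C: "precoalgebra C" and M: "comodule C M" and m: "m \<in> carrier M"
  obtains N :: "('k, 'm, 'v) comodule" where "comodule C N" "finite_dim N" "m \<in> carrier N"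
    "carrier N \<subseteq> carrier M" "smult N = smult M" "coact N = coact M"
proof -
  have vC: "vspace C" and \<Delta>: "linear_map C (tensor_prod C C) (comult C)" and \<epsilon>: "linear_map C ground (counit C)"
    using C by (simp_all add: precoalgebra_def)
  have vsC: "vector_space (smult C)" using vC by (simp add: vspace_def)
  note vM = comodule_vspace[OF M]
  note t = coact_mem[OF M m]
  define N where "N = M\<lparr>carrier := {act C M \<chi> m | \<chi>. functional C \<chi>}\<rparr>"
  have N: "smult N = smult M" "coact N = coact M" "carrier N = {act C M \<chi> m | \<chi>. functional C \<chi>}"
    by (simp_all add: N_def)
  have mem: "act C M \<psi> m \<in> carrier N" if \<psi>: "linear_map C ground \<psi>" for \<psi>
  proof -
    obtain \<chi> where \<chi>: "functional C \<chi>" "\<And>c. c \<in> carrier C \<Longrightarrow> \<chi> c = \<psi> c"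
      using extend_functional[OF vC \<psi>] by blast
    have "act C M \<psi> m = act C M \<chi> m"
      unfolding act_def by (rule contract_cong[OF vM vC \<psi> _ t]) (simp add: \<chi>)
    then show ?thesis using \<chi>(1) N(3) by blast
  qed
  have sub: "carrier N \<subseteq> carrier M"
    unfolding N(3) act_def using contract_mem[OF vM vC functional_linear_map t] by blast
  have "vspace N"
  proof (rule vspaceI)
    show "vector_space (smult N)" using vM by (simp add: N vspace_def)
    show smult: "smult N a x \<in> carrier N" if "x \<in> carrier N" for a x
    proof -
      obtain \<chi> where \<chi>: "functional C \<chi>" "x = act C M \<chi> m" using \<open>x \<in> carrier N\<close> unfolding N(3) by blast
      have "smult N a x = act C M (\<lambda>c. a * \<chi> c) m"
        using contract_smult_functional[OF vM vC functional_linear_map[OF \<chi>(1)] t] by (simp add: \<chi> N act_def)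
      moreover have "linear_map C ground (\<lambda>c. a * \<chi> c)"
        using linear_map_scaled[OF vspace_ground functional_linear_map[OF \<chi>(1)]] by simp
      ultimately show ?thesis using mem by simp
    qed
    \<comment> \<open>the zero vector, as a multiple of an element known to be in the orbit\<close>
    have "smult N 0 (act C M (counit C) m) \<in> carrier N" by (rule smult[OF mem[OF \<epsilon>]])
    then show "0 \<in> carrier N" using smult_zero_left[OF vM] by (simp add: N)
    show "x + y \<in> carrier N" if xy: "x \<in> carrier N" "y \<in> carrier N" for x y
    proof -
      obtain \<chi> where \<chi>: "functional C \<chi>" "x = act C M \<chi> m" using xy unfolding N(3) by blast
      obtain \<psi> where \<psi>: "functional C \<psi>" "y = act C M \<psi> m" using xy unfolding N(3) by blast
      note l = functional_linear_map[OF \<chi>(1)] functional_linear_map[OF \<psi>(1)]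
      have "x + y = act C M (\<lambda>c. \<chi> c + \<psi> c) m"
        using contract_add_functional[OF vM vC l t] by (simp add: \<chi> \<psi> act_def)
      then show ?thesis using mem[OF linear_map_plus[OF vspace_ground l]] by simp
    qed
  qed
  moreover have "act C M \<psi> x \<in> carrier N" if p: "functional C \<psi>" and x: "x \<in> carrier N" for \<psi> x
  proof -
    obtain \<chi> where \<chi>: "functional C \<chi>" "x = act C M \<chi> m" using x unfolding N(3) by blast
    have "act C M \<psi> x = act C M (\<lambda>c. comult C c \<psi> \<chi>) m"
      using M m p \<chi> unfolding comodule_iff_act[OF C] by blast
    then show ?thesis using mem[OF linear_map_convolution[OF \<Delta>]] by simp
  qed
  ultimately have "comodule C N" using subcomodule[OF C M _ N(1,2) sub] by blast
  moreover have "finite_dim N"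
  proof -
    obtain F r where F: "finite F" "F \<subseteq> carrier C" "\<And>b. functional C (r b)"
      "\<And>b b'. b \<in> F \<Longrightarrow> b' \<in> F \<Longrightarrow> r b b' = (if b = b' then 1 else 0)"
      "coact M m = (\<Sum>b\<in>F. tens M C (contract M C (r b) (coact M m)) b)"
      by (rule tensor_expand[OF vM vC t], rule that)
    define u where "u b = contract M C (r b) (coact M m)" for b
    have u: "u b \<in> carrier M" for b
      unfolding u_def by (rule contract_mem[OF vM vC functional_linear_map[OF F(3)] t])
    interpret V: vector_space "smult M" using vM by (simp add: vspace_def)
    have "act C M \<chi> m \<in> V.span (u ` F)" if \<chi>: "functional C \<chi>" for \<chi>
    proof -
      note l = functional_linear_map[OF \<chi>]
      have "act C M \<chi> m = contract M C \<chi> (\<Sum>b\<in>F. tens M C (u b) b)"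
        using F(5) by (simp add: act_def u_def)
      also have "\<dots> = (\<Sum>b\<in>F. contract M C \<chi> (tens M C (u b) b))"
        using F(2) u by (intro linear_map_sum[OF vspace_tensor_prod contract_linear[OF vM vC l]]) (auto intro: tens_mem)
      also have "\<dots> = (\<Sum>b\<in>F. smult M (\<chi> b) (u b))"
        using F(2) u by (intro sum.cong) (auto simp: contract_pure[OF vM vC l])
      finally have e: "act C M \<chi> m = (\<Sum>b\<in>F. smult M (\<chi> b) (u b))" .
      show ?thesis unfolding e by (intro V.span_sum V.span_scale V.span_base imageI)
    qed
    then show ?thesis
      using finite_dim_subspace[OF vM \<open>vspace N\<close> N(1), of "u ` F"] F(1) by (auto simp: N(3))
  qed
  moreover have "m \<in> carrier N"
  proof -
    have "act C M (counit C) m = m" using M m unfolding comodule_iff_act[OF C] by blast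
    then show ?thesis using mem[OF \<epsilon>] by simp
  qed
  ultimately show thesis using that sub N by blast
qed


section \<open>The coalgebra dual to a finite dimensional algebra\<close>

lemma dual_coalgebra_simps:
  "carrier (dual_coalgebra E) = carrier (dual_space E)" "smult (dual_coalgebra E) = (\<lambda>a \<alpha> x. a * \<alpha> x)"
  "smult (dual_space E) = (\<lambda>a \<alpha> x. a * \<alpha> x)" "counit (dual_coalgebra E) = (\<lambda>\<alpha>. \<alpha> (unit E))"
  by (simp_all add: dual_coalgebra_def dual_space_def)

lemma dual_mem:
  "\<alpha> \<in> carrier (dual_coalgebra E) \<longleftrightarrow> linear_map E ground \<alpha> \<and> (\<forall>x. x \<notin> carrier E \<longrightarrow> \<alpha> x = 0)"
  by (simp add: dual_coalgebra_def dual_space_def)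

lemma vspace_dual_coalgebra: "vspace (dual_coalgebra E)"
proof (rule vspaceI)
  show "vector_space (smult (dual_coalgebra E))"
    by unfold_locales (simp_all add: dual_coalgebra_simps fun_eq_iff plus_fun_apply algebra_simps)
qed (unfold dual_mem, auto simp: dual_coalgebra_simps(2) linear_map_def plus_fun_apply zero_fun_apply algebra_simps)

lemma restricted_dual_mem:
  assumes "vspace E" "linear_map E ground \<alpha>"
  shows "(\<lambda>f. if f \<in> carrier E then \<alpha> f else 0) \<in> carrier (dual_coalgebra E)"
  using assms vspace_add[OF assms(1)] vspace_smult[OF assms(1)] by (auto simp: dual_mem linear_map_def)

text \<open>
  Evaluation of the first factor at an element \<open>f\<close> of the algebra. The defining conditions of the dual
  comultiplication and of the left coaction prescribe all these contractions.
\<close>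

definition contract_dual ::
  "('k::field, 'e::ab_group_add) algebra \<Rightarrow> ('k, 'x::ab_group_add, 'z) vspace_scheme \<Rightarrow> 'e \<Rightarrow>
    ('k, 'e \<Rightarrow> 'k, 'x) tensor \<Rightarrow> 'x" where
  "contract_dual E X f = tensor_lift (dual_coalgebra E) X (\<lambda>\<alpha> x. smult X (\<alpha> f) x)"

lemma bilinear_contract_dual:
  "vspace X \<Longrightarrow> bilinear_map (dual_coalgebra E) X (smult X) (\<lambda>\<alpha> x. smult X (\<alpha> f) x)"
  by (auto simp: bilinear_map_def plus_fun_apply smult_add_left smult_add_right smult_smult
      dual_coalgebra_simps mult.commute)

lemma contract_dual_linear:
  assumes X: "vspace X"
  shows "linear_map (tensor_prod (dual_coalgebra E) X) X (contract_dual E X f)"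
  unfolding contract_dual_def
  by (rule tensor_lift_linear[OF vspace_dual_coalgebra X X bilinear_contract_dual[OF X]])
    (rule vspace_smult[OF X])

lemma contract_dual_pure:
  assumes X: "vspace X" and "\<alpha> \<in> carrier (dual_coalgebra E)" "x \<in> carrier X"
  shows "contract_dual E X f (tens (dual_coalgebra E) X \<alpha> x) = smult X (\<alpha> f) x"
  unfolding contract_dual_def
  by (rule tensor_lift_pure[OF vspace_dual_coalgebra X bilinear_contract_dual[OF X] assms(2,3)])

lemma contract_dual_sum:
  assumes X: "vspace X" and "\<And>b. b \<in> B \<Longrightarrow> u b \<in> carrier (dual_coalgebra E)" "\<And>b. b \<in> B \<Longrightarrow> w b \<in> carrier X"
  shows "contract_dual E X f (\<Sum>b\<in>B. tens (dual_coalgebra E) X (u b) (w b)) = (\<Sum>b\<in>B. smult X (u b f) (w b))"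
proof -
  have "contract_dual E X f (\<Sum>b\<in>B. tens (dual_coalgebra E) X (u b) (w b)) =
      (\<Sum>b\<in>B. contract_dual E X f (tens (dual_coalgebra E) X (u b) (w b)))"
    using assms(2,3) by (intro linear_map_sum[OF vspace_tensor_prod contract_dual_linear[OF X]] tens_mem)
  also have "\<dots> = (\<Sum>b\<in>B. smult X (u b f) (w b))"
    using assms(2,3) by (intro sum.cong refl contract_dual_pure[OF X])
  finally show ?thesis .
qed

text \<open>
  In an expansion \<open>\<Sum> u\<^sub>b \<otimes> b\<close> of the difference the \<open>b\<close> are independent, so all values \<open>u\<^sub>b(f)\<close>
  vanish; elements of the dual space are zero outside \<open>E\<close> by normalisation.
\<close>

lemma dual_tensor_eqI:
  assumes X: "vspace X"
    and s: "s \<in> carrier (tensor_prod (dual_coalgebra E) X)" and t: "t \<in> carrier (tensor_prod (dual_coalgebra E) X)"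
    and eq: "\<And>f. f \<in> carrier E \<Longrightarrow> contract_dual E X f s = contract_dual E X f t"
  shows "s = t"
proof -
  let ?A = "dual_coalgebra E"
  note vA = vspace_dual_coalgebra[of E]
  have d: "s - t \<in> carrier (tensor_prod ?A X)" by (rule vspace_diff[OF vspace_tensor_prod s t])
  obtain F r where F: "finite F" "F \<subseteq> carrier X" "\<And>b. functional X (r b)"
    "\<And>b b'. b \<in> F \<Longrightarrow> b' \<in> F \<Longrightarrow> r b b' = (if b = b' then 1 else 0)"
    "s - t = (\<Sum>b\<in>F. tens ?A X (contract ?A X (r b) (s - t)) b)"
    by (rule tensor_expand[OF vA X d], rule that)
  define u where "u b = contract ?A X (r b) (s - t)" for b
  have u: "u b \<in> carrier ?A" for b
    unfolding u_def by (rule contract_mem[OF vA X functional_linear_map[OF F(3)] d])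
  have "u b f = 0" if f: "f \<in> carrier E" and b: "b \<in> F" for b f
  proof -
    have "0 = contract_dual E X f (s - t)"
      using linear_map_diff[OF vspace_tensor_prod contract_dual_linear[OF X] s t] eq[OF f] by simp
    also have "\<dots> = contract_dual E X f (\<Sum>b\<in>F. tens ?A X (u b) b)" using F(5) by (simp add: u_def)
    also have "\<dots> = (\<Sum>b\<in>F. smult X (u b f) b)" using F(2) u by (intro contract_dual_sum[OF X]) auto
    finally have 0: "(\<Sum>b\<in>F. smult X (u b f) b) = 0" by simp
    have "0 = r b (\<Sum>b\<in>F. smult X (u b f) b)"
      using linear_map_zero[OF X functional_linear_map[OF F(3)]] 0 by simp
    also have "\<dots> = (\<Sum>b'\<in>F. r b (smult X (u b' f) b'))"
      using F(2) by (intro linear_map_sum[OF X functional_linear_map[OF F(3)]]) (auto intro: vspace_smult[OF X])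
    also have "\<dots> = (\<Sum>b'\<in>F. if b = b' then u b f else 0)"
      using F(4)[OF b] by (intro sum.cong) (auto simp: functional_smult[OF F(3)])
    finally show ?thesis using F(1) b by simp
  qed
  then have "u b = 0" if "b \<in> F" for b
    using u[of b] that unfolding dual_mem by (intro ext) (auto simp: zero_fun_apply)
  then have "s - t = 0" using F(5) by (simp add: tens_zero flip: u_def)
  then show ?thesis by simp
qed

text \<open>
  With a finite basis \<open>B\<close> of \<open>E\<close> and coordinates \<open>b\<^sup>*\<close>, the tensor \<open>\<Sum> \<alpha>(- \<cdot> b) \<otimes> b\<^sup>*\<close> satisfies the
  condition that defines the comultiplication; it is the only one by \<open>dual_tensor_eqI\<close>.
\<close>

lemma dual_comult:
  fixes E :: "('k::field, 'e::ab_group_add) algebra"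
  assumes E: "vspace E" "finite_dim E" and bil: "bilinear_map E E (smult E) (mult E)"
    and closed: "\<And>f g. f \<in> carrier E \<Longrightarrow> g \<in> carrier E \<Longrightarrow> mult E f g \<in> carrier E"
    and \<alpha>: "\<alpha> \<in> carrier (dual_coalgebra E)"
  shows "comult (dual_coalgebra E) \<alpha> \<in> carrier (tensor_prod (dual_coalgebra E) (dual_coalgebra E))"
    and "f \<in> carrier E \<Longrightarrow> g \<in> carrier E \<Longrightarrow>
      contract_dual E (dual_coalgebra E) f (comult (dual_coalgebra E) \<alpha>) g = \<alpha> (mult E f g)"
proof -
  let ?A = "dual_coalgebra E"
  note vA = vspace_dual_coalgebra[of E]
  have lin: "linear_map E ground \<alpha>" using \<alpha> by (simp add: dual_mem)
  have pair: "tensor_lift (dual_space E) (dual_space E) (\<lambda>\<alpha>1 \<alpha>2. \<alpha>1 f * \<alpha>2 g) t = contract_dual E ?A f t g"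
    if t: "t \<in> carrier (tensor_prod ?A ?A)" for t f g
  proof -
    have b: "bilinear_map ?A ?A (smult ground) (\<lambda>\<alpha>1 \<alpha>2. \<alpha>1 f * \<alpha>2 g)"
      by (auto simp: bilinear_map_def plus_fun_apply dual_coalgebra_simps algebra_simps)
    have ev: "linear_map ?A ground (\<lambda>\<alpha>. \<alpha> g)"
      by (simp add: linear_map_def plus_fun_apply dual_coalgebra_simps)
    have "tensor_lift ?A ?A (\<lambda>\<alpha>1 \<alpha>2. \<alpha>1 f * \<alpha>2 g) t = contract_dual E ?A f t g"
      by (rule linear_map_tensor_eqI[OF vA tensor_lift_linear[OF vA vA vspace_ground b]
            linear_map_comp[OF contract_dual_linear[OF vA] ev] _ t])
        (use vA in \<open>simp_all add: tensor_lift_pure[OF vA vA b] contract_dual_pure dual_coalgebra_simps\<close>)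
    moreover have "tensor_lift (dual_space E) (dual_space E) = tensor_lift ?A ?A"
      by (rule tensor_lift_cong) (simp_all add: dual_coalgebra_simps)
    ultimately show ?thesis by metis
  qed
  have tp: "tensor_prod (dual_space E) (dual_space E) = tensor_prod ?A ?A"
    by (rule tensor_prod_cong) (simp_all add: dual_coalgebra_simps)
  let ?Q = "\<lambda>t. t \<in> carrier (tensor_prod ?A ?A) \<and>
    (\<forall>f\<in>carrier E. \<forall>g\<in>carrier E. contract_dual E ?A f t g = \<alpha> (mult E f g))"
  let ?Q' = "\<lambda>t. t \<in> carrier (tensor_prod (dual_space E) (dual_space E)) \<and>
        (\<forall>f\<in>carrier E. \<forall>g\<in>carrier E.
           tensor_lift (dual_space E) (dual_space E) (\<lambda>\<alpha>1 \<alpha>2. \<alpha>1 f * \<alpha>2 g) t = \<alpha> (mult E f g))"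
  \<comment> \<open>the condition in the definition of the comultiplication, stated through \<open>contract_dual\<close>\<close>
  have "?Q' = ?Q" using pair unfolding tp by (intro ext) auto
  then have co: "comult ?A \<alpha> = (THE t. ?Q t)" by (simp add: dual_coalgebra_def)
  have "\<exists>!t. ?Q t"
  proof (rule ex_ex1I)
    obtain B r where B: "finite B" "B \<subseteq> carrier E" "\<And>b. b \<in> B \<Longrightarrow> functional E (r b)"
      "\<And>x. x \<in> carrier E \<Longrightarrow> x = (\<Sum>b\<in>B. smult E (r b x) b)"
      by (rule finite_basis[OF E], rule that)
    define u where "u b f = (if f \<in> carrier E then \<alpha> (mult E f b) else 0)" for b f
    define w where "w b f = (if f \<in> carrier E then r b f else 0)" for b f
    have u: "u b \<in> carrier ?A" if "b \<in> B" for b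
    proof -
      have "linear_map E E (\<lambda>f. mult E f b)"
        using bil closed that B(2) by (auto simp: linear_map_def bilinear_map_def)
      from restricted_dual_mem[OF E(1) linear_map_comp[OF this lin]]
      show ?thesis by (simp add: u_def[abs_def])
    qed
    have w: "w b \<in> carrier ?A" if "b \<in> B" for b
      using restricted_dual_mem[OF E(1) functional_linear_map[OF B(3)[OF that]]] by (simp add: w_def[abs_def])
    define t where "t = (\<Sum>b\<in>B. tens ?A ?A (u b) (w b))"
    have "t \<in> carrier (tensor_prod ?A ?A)"
      unfolding t_def using u w by (intro vspace_sum[OF vspace_tensor_prod] tens_mem)
    moreover have "contract_dual E ?A f t g = \<alpha> (mult E f g)" if f: "f \<in> carrier E" and g: "g \<in> carrier E" for f g
    proof -
      have lf: "linear_map E E (mult E f)"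
        using bil closed f by (auto simp: linear_map_def bilinear_map_def)
      have ev: "(\<Sum>b\<in>B. h b) g = (\<Sum>b\<in>B. h b g)" for h :: "'e \<Rightarrow> 'e \<Rightarrow> 'k"
        using B(1) by (induction B rule: finite_induct) (simp_all add: plus_fun_apply zero_fun_apply)
      have "\<alpha> (mult E f g) = \<alpha> (mult E f (\<Sum>b\<in>B. smult E (r b g) b))" using B(4)[OF g] by simp
      also have "\<dots> = (\<Sum>b\<in>B. \<alpha> (mult E f (smult E (r b g) b)))"
        using B(2) by (intro linear_map_sum[OF E(1) linear_map_comp[OF lf lin]]) (auto intro: vspace_smult[OF E(1)])
      also have "\<dots> = (\<Sum>b\<in>B. u b f * w b g)"
        using B(2) f g by (intro sum.cong refl)
          (auto simp: u_def w_def linear_map_smult[OF lf] linear_map_smult[OF lin] linear_map_mem[OF lf] subset_iff mult.commute)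
      also have "\<dots> = contract_dual E ?A f t g"
        using contract_dual_sum[of ?A B u E w f, OF vA u w] by (simp add: t_def ev dual_coalgebra_simps)
      finally show ?thesis by simp
    qed
    ultimately show "\<exists>t. ?Q t" by blast
  next
    fix s t assume s: "?Q s" and t: "?Q t"
    show "s = t"
    proof (rule dual_tensor_eqI[OF vA])
      fix f assume f: "f \<in> carrier E"
      have "contract_dual E ?A f s \<in> carrier ?A" "contract_dual E ?A f t \<in> carrier ?A"
        using linear_map_mem[OF contract_dual_linear[OF vA]] s t by blast+
      then show "contract_dual E ?A f s = contract_dual E ?A f t"
        using s t f unfolding dual_mem by (intro ext) metis
    qed (use s t in auto)
  qed
  from theI'[OF this] show "comult ?A \<alpha> \<in> carrier (tensor_prod ?A ?A)"
    and "f \<in> carrier E \<Longrightarrow> g \<in> carrier E \<Longrightarrow> contract_dual E ?A f (comult ?A \<alpha>) g = \<alpha> (mult E f g)"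
    unfolding co by blast+
qed

text \<open>
  Linearity follows from uniqueness: sums and multiples of solutions solve the condition for the sum or
  multiple.
\<close>

lemma precoalgebra_dual:
  fixes E :: "('k::field, 'e::ab_group_add) algebra"
  assumes E: "vspace E" "finite_dim E" and bil: "bilinear_map E E (smult E) (mult E)"
    and closed: "\<And>f g. f \<in> carrier E \<Longrightarrow> g \<in> carrier E \<Longrightarrow> mult E f g \<in> carrier E"
  shows "precoalgebra (dual_coalgebra E)"
proof -
  let ?A = "dual_coalgebra E"
  note vA = vspace_dual_coalgebra[of E]
  have spec: "comult ?A \<alpha> \<in> carrier (tensor_prod ?A ?A)"
    "f \<in> carrier E \<Longrightarrow> g \<in> carrier E \<Longrightarrow> contract_dual E ?A f (comult ?A \<alpha>) g = \<alpha> (mult E f g)"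
    if "\<alpha> \<in> carrier ?A" for \<alpha> f g
    by (rule dual_comult[OF E bil _ that]; simp add: closed)+
  note cl = contract_dual_linear[OF vA]
  note mem = linear_map_mem[OF cl]
  have eqI: "s = t" if "s \<in> carrier (tensor_prod ?A ?A)" "t \<in> carrier (tensor_prod ?A ?A)"
    "\<And>f g. f \<in> carrier E \<Longrightarrow> g \<in> carrier E \<Longrightarrow> contract_dual E ?A f s g = contract_dual E ?A f t g" for s t
  proof (rule dual_tensor_eqI[OF vA that(1,2)])
    fix f assume f: "f \<in> carrier E"
    have "contract_dual E ?A f s \<in> carrier ?A" "contract_dual E ?A f t \<in> carrier ?A"
      using mem that by blast+
    then show "contract_dual E ?A f s = contract_dual E ?A f t"
      using that(3)[OF f] unfolding dual_mem by (intro ext) metis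
  qed
  have "linear_map ?A (tensor_prod ?A ?A) (comult ?A)"
  proof (rule linear_mapI)
    fix \<alpha> \<beta> assume a: "\<alpha> \<in> carrier ?A" "\<beta> \<in> carrier ?A"
    show "comult ?A (\<alpha> + \<beta>) = comult ?A \<alpha> + comult ?A \<beta>"
      using spec[OF vspace_add[OF vA a]] spec[OF a(1)] spec[OF a(2)]
      by (intro eqI vspace_add[OF vspace_tensor_prod]) (auto simp: linear_map_add[OF cl] plus_fun_apply)
  next
    fix a \<alpha> assume \<alpha>: "\<alpha> \<in> carrier ?A"
    have "smult (tensor_prod ?A ?A) a (comult ?A \<alpha>) \<in> carrier (tensor_prod ?A ?A)"
      using spec(1)[OF \<alpha>] vspace_smult[OF vspace_tensor_prod] by blast
    then show "comult ?A (smult ?A a \<alpha>) = smult (tensor_prod ?A ?A) a (comult ?A \<alpha>)"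
      using spec[OF vspace_smult[OF vA \<alpha>]] spec[OF \<alpha>]
      by (intro eqI) (auto simp: linear_map_smult[OF cl, simplified] dual_coalgebra_simps)
  qed (rule spec(1))
  moreover have "linear_map ?A ground (counit ?A)"
    by (simp add: linear_map_def dual_coalgebra_simps plus_fun_apply)
  ultimately show ?thesis using vA by (simp add: precoalgebra_def)
qed

section \<open>The endomorphism algebra and the left coaction\<close>

lemma end_algebra_simps:
  "smult (end_algebra C M) = (\<lambda>a f m. smult M a (f m))" "mult (end_algebra C M) = (\<lambda>f g. g \<circ> f)"
  by (simp_all add: end_algebra_def)

lemma end_algebra_mem:
  assumes C: "vspace C" and M: "comodule C M"
  shows "f \<in> carrier (end_algebra C M) \<longleftrightarrow> linear_map M M f \<and> (\<forall>m. m \<notin> carrier M \<longrightarrow> f m = 0) \<and>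
    (\<forall>m\<in>carrier M. \<forall>\<psi>. functional C \<psi> \<longrightarrow> act C M \<psi> (f m) = f (act C M \<psi> m))"
  using comodule_hom_iff_act[OF C comodule_vspace[OF M] comodule_vspace[OF M] coact_image[OF M] coact_image[OF M]]
  by (auto simp: end_algebra_def)

text \<open>
  For the finite dimension, an endomorphism is a combination of the elementary maps \<open>m \<mapsto> b'\<^sup>*(m) b\<close>. These
  need not be comodule maps, but the endomorphism algebra is a subspace of their span.
\<close>

lemma
  fixes C :: "('k::field, 'v::ab_group_add) coalgebra" and M :: "('k, 'm::ab_group_add, 'v) comodule"
  assumes C: "vspace C" and M: "comodule C M"
  shows vspace_end_algebra: "vspace (end_algebra C M)"
    and end_algebra_closed: "f \<in> carrier (end_algebra C M) \<Longrightarrow> g \<in> carrier (end_algebra C M) \<Longrightarrow>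
      mult (end_algebra C M) f g \<in> carrier (end_algebra C M)"
    and bilinear_end_algebra:
      "bilinear_map (end_algebra C M) (end_algebra C M) (smult (end_algebra C M)) (mult (end_algebra C M))"
    and finite_dim_end_algebra: "finite_dim M \<Longrightarrow> finite_dim (end_algebra C M)"
proof -
  let ?E = "end_algebra C M"
  note vM = comodule_vspace[OF M] and mem = end_algebra_mem[OF C M]
  have al: "linear_map M M (act C M \<psi>)" if "functional C \<psi>" for \<psi>
    by (rule act_linear[OF C vM coact_linear[OF M] functional_linear_map[OF that]])
  show vE: "vspace ?E"
  proof (rule vspaceI)
    interpret M: vector_space "smult M" using vM by (simp add: vspace_def)
    show "vector_space (smult ?E)"
      by unfold_locales
        (simp_all add: end_algebra_simps fun_eq_iff plus_fun_apply M.scale_right_distrib M.scale_left_distrib)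
    show "0 \<in> carrier ?E"
      unfolding mem using vspace_zero[OF vM] linear_map_zero[OF vM al]
      by (auto simp: linear_map_def zero_fun_apply)
    show "f + g \<in> carrier ?E" if "f \<in> carrier ?E" "g \<in> carrier ?E" for f g
      using that linear_map_plus[OF vM, of M f g] linear_map_add[OF al] linear_map_mem[of M M f] linear_map_mem[of M M g]
      unfolding mem by (auto simp: plus_fun_def)
    show "smult ?E a f \<in> carrier ?E" if "f \<in> carrier ?E" for a f
      using that linear_map_scaled[OF vM, of M f a] linear_map_smult[OF al] linear_map_mem[of M M f]
      unfolding mem by (auto simp: end_algebra_simps smult_zero_right[OF vM])
  qed
  show "mult ?E f g \<in> carrier ?E" if "f \<in> carrier ?E" "g \<in> carrier ?E"
    using that linear_map_comp[of M M f M g] linear_map_mem[of M M f] linear_map_zero[OF vM, of M g]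
    unfolding mem by (auto simp: end_algebra_simps o_def)
  show "bilinear_map ?E ?E (smult ?E) (mult ?E)"
  proof -
    have "g (f m + f' m) = g (f m) + g (f' m)" "g (smult M a (f m)) = smult M a (g (f m))"
      if "f \<in> carrier ?E" "f' \<in> carrier ?E" "g \<in> carrier ?E" for f f' g m a
      using that linear_map_mem[of M M f m] linear_map_mem[of M M f' m] linear_map_zero[OF vM, of M g]
        linear_map_add[of M M g "f m" "f' m"] linear_map_smult[of M M g "f m" a]
        smult_zero_right[OF vM, of a] unfolding mem by (cases "m \<in> carrier M"; simp)+
    then show ?thesis
      by (auto simp: bilinear_map_def end_algebra_simps fun_eq_iff plus_fun_apply)
  qed
  show "finite_dim ?E" if fd: "finite_dim M"
  proof -
    obtain B r where B: "finite B" "B \<subseteq> carrier M" "\<And>b. b \<in> B \<Longrightarrow> functional M (r b)"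
      "\<And>x. x \<in> carrier M \<Longrightarrow> x = (\<Sum>b\<in>B. smult M (r b x) b)"
      by (rule finite_basis[OF vM fd], rule that)
    interpret E: vector_space "smult ?E" using vE by (simp add: vspace_def)
    define e where "e = (\<lambda>(b, b') m. if m \<in> carrier M then smult M (r b' m) b else 0)"
    have "f \<in> E.span (e ` (B \<times> B))" if "f \<in> carrier ?E" for f
    proof -
      have f: "linear_map M M f" "\<And>m. m \<notin> carrier M \<Longrightarrow> f m = 0" using that unfolding mem by auto
      have ev: "(\<Sum>p\<in>S. h p) m = (\<Sum>p\<in>S. h p m)" for h :: "'m \<times> 'm \<Rightarrow> 'm \<Rightarrow> 'm" and m S
        by (induction S rule: infinite_finite_induct) (simp_all add: plus_fun_apply zero_fun_apply)
      have "f m = (\<Sum>p\<in>B \<times> B. smult ?E (r (fst p) (f (snd p))) (e p)) m" for m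
      proof (cases "m \<in> carrier M")
        case True
        interpret M: vector_space "smult M" using vM by (simp add: vspace_def)
        have "f m = f (\<Sum>b\<in>B. smult M (r b m) b)" using B(4)[OF True] by simp
        also have "\<dots> = (\<Sum>b\<in>B. f (smult M (r b m) b))"
          using B(2) by (intro linear_map_sum[OF vM f(1)]) (auto intro: vspace_smult[OF vM])
        also have "\<dots> = (\<Sum>b\<in>B. smult M (r b m) (f b))"
          using B(2) by (intro sum.cong refl linear_map_smult[OF f(1)]) auto
        also have "\<dots> = (\<Sum>b\<in>B. smult M (r b m) (\<Sum>b'\<in>B. smult M (r b' (f b)) b'))"
          using B(2) linear_map_mem[OF f(1)] B(4) by (intro sum.cong refl arg_cong[where f = "smult M _"]) blast
        also have "\<dots> = (\<Sum>b\<in>B. \<Sum>b'\<in>B. smult M (r b' (f b)) (smult M (r b m) b'))"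
          by (simp add: M.scale_sum_right mult.commute)
        also have "\<dots> = (\<Sum>b'\<in>B. \<Sum>b\<in>B. smult M (r b' (f b)) (smult M (r b m) b'))"
          by (rule sum.swap)
        also have "\<dots> = (\<Sum>p\<in>B \<times> B. smult ?E (r (fst p) (f (snd p))) (e p) m)"
          using True by (simp add: sum.cartesian_product split_def e_def end_algebra_simps)
        finally show ?thesis by (simp add: ev)
      next
        case False
        then show ?thesis
          by (simp add: f ev e_def split_def end_algebra_simps smult_zero_right[OF vM])
      qed
      then have "f = (\<Sum>p\<in>B \<times> B. smult ?E (r (fst p) (f (snd p))) (e p))" by blast
      moreover have "(\<Sum>p\<in>B \<times> B. smult ?E (r (fst p) (f (snd p))) (e p)) \<in> E.span (e ` (B \<times> B))"
        by (intro E.span_sum E.span_scale E.span_base imageI)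
      ultimately show ?thesis by simp
    qed
    then show ?thesis using finite_dim_subspace[OF vE vE refl, of "e ` (B \<times> B)"] B(1) by auto
  qed
qed

lemma precoalgebra_end_coalgebra:
  assumes "vspace C" "comodule C M" "finite_dim M"
  shows "precoalgebra (end_coalgebra C M)"
  unfolding end_coalgebra_def
  by (rule precoalgebra_dual[OF vspace_end_algebra[OF assms(1,2)] finite_dim_end_algebra[OF assms]
        bilinear_end_algebra[OF assms(1,2)] end_algebra_closed[OF assms(1,2)]])

text \<open>
  With a finite basis \<open>B\<close> of \<open>M\<close>, the tensor \<open>\<Sum> (f \<mapsto> b\<^sup>*(f m)) \<otimes> b\<close> satisfies the condition that defines
  the left coaction at \<open>m\<close>; uniqueness gives linearity.
\<close>

lemma left_coact_linear:
  fixes C :: "('k::field, 'v::ab_group_add) coalgebra" and M :: "('k, 'm::ab_group_add, 'v) comodule"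
  assumes C: "vspace C" and M: "comodule C M" and fd: "finite_dim M"
  shows "linear_map M (tensor_prod (end_coalgebra C M) M) (left_coact C M)"
proof -
  let ?E = "end_algebra C M" and ?A = "end_coalgebra C M"
  note vM = comodule_vspace[OF M] and vE = vspace_end_algebra[OF C M]
  have vA: "vspace ?A" unfolding end_coalgebra_def by (rule vspace_dual_coalgebra)
  have f: "linear_map M M f" if "f \<in> carrier ?E" for f using that unfolding end_algebra_mem[OF C M] by blast
  have cl: "linear_map (tensor_prod ?A M) M (contract_dual ?E M f)" for f
    unfolding end_coalgebra_def by (rule contract_dual_linear[OF vM])
  note eqI = dual_tensor_eqI[OF vM, of _ ?E, folded end_coalgebra_def]
  let ?Q = "\<lambda>m t. t \<in> carrier (tensor_prod ?A M) \<and> (\<forall>f\<in>carrier ?E. contract_dual ?E M f t = f m)"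
  have "\<exists>t. ?Q m t" if m: "m \<in> carrier M" for m
  proof -
    obtain B r where B: "finite B" "B \<subseteq> carrier M" "\<And>b. b \<in> B \<Longrightarrow> functional M (r b)"
      "\<And>x. x \<in> carrier M \<Longrightarrow> x = (\<Sum>b\<in>B. smult M (r b x) b)"
      by (rule finite_basis[OF vM fd], rule that)
    define u where "u b f = (if f \<in> carrier ?E then r b (f m) else 0)" for b f
    have u: "u b \<in> carrier ?A" if "b \<in> B" for b
    proof -
      have "linear_map ?E M (\<lambda>f. f m)"
        using f m by (auto simp: linear_map_def plus_fun_apply end_algebra_simps)
      from restricted_dual_mem[OF vE linear_map_comp[OF this functional_linear_map[OF B(3)[OF that]]]]
      show ?thesis by (simp add: u_def[abs_def] end_coalgebra_def)
    qed
    define t where "t = (\<Sum>b\<in>B. tens ?A M (u b) b)"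
    have "t \<in> carrier (tensor_prod ?A M)"
      unfolding t_def using u B(2) by (intro vspace_sum[OF vspace_tensor_prod] tens_mem) auto
    moreover have "contract_dual ?E M f t = f m" if "f \<in> carrier ?E" for f
    proof -
      have "contract_dual ?E M f t = (\<Sum>b\<in>B. smult M (u b f) b)"
        unfolding t_def end_coalgebra_def
        by (rule contract_dual_sum[OF vM]) (use u B(2) in \<open>auto simp: end_coalgebra_def\<close>)
      also have "\<dots> = f m" using B(4)[OF linear_map_mem[OF f[OF that] m]] that by (simp add: u_def)
      finally show ?thesis .
    qed
    ultimately show ?thesis by blast
  qed
  moreover have "s = t" if "?Q m s" "?Q m t" for m s t using that eqI by auto
  ultimately have "\<exists>!t. ?Q m t" if "m \<in> carrier M" for m using that by blast
  then have spec: "?Q m (left_coact C M m)" if "m \<in> carrier M" for m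
    using theI'[of "?Q m"] that unfolding left_coact_def contract_dual_def end_coalgebra_def by blast
  show ?thesis
  proof (rule linear_mapI)
    fix x y assume xy: "x \<in> carrier M" "y \<in> carrier M"
    show "left_coact C M (x + y) = left_coact C M x + left_coact C M y"
      using spec[OF vspace_add[OF vM xy]] spec[OF xy(1)] spec[OF xy(2)]
      by (intro eqI vspace_add[OF vspace_tensor_prod])
        (auto simp: linear_map_add[OF cl] linear_map_add[OF f] xy)
  next
    fix a x assume x: "x \<in> carrier M"
    have "smult (tensor_prod ?A M) a (left_coact C M x) \<in> carrier (tensor_prod ?A M)"
      using spec[OF x] vspace_smult[OF vspace_tensor_prod] by blast
    then show "left_coact C M (smult M a x) = smult (tensor_prod ?A M) a (left_coact C M x)"
      using spec[OF vspace_smult[OF vM x]] spec[OF x]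
      by (intro eqI) (auto simp: linear_map_smult[OF cl, simplified] linear_map_smult[OF f] x)
  qed (use spec in blast)
qed


section \<open>The coalgebra \<open>C'\<close> and its projections\<close>

lemma sum_on_support:
  assumes "finite F" "{M. x M \<noteq> 0} \<subseteq> F" "\<And>M. M \<in> F \<Longrightarrow> G M 0 = 0"
  shows "(\<Sum>M | x M \<noteq> 0. G M (x M)) = (\<Sum>M\<in>F. G M (x M))"
  by (rule sum.mono_neutral_left) (use assms in auto)

text \<open>
  The sum over the support of \<open>h x\<close> can be taken over any larger finite set, so the supports of \<open>x\<close>, \<open>y\<close>
  and \<open>x + y\<close> can be replaced by a common one.
\<close>

lemma linear_map_support_sum:
  fixes V :: "'i \<Rightarrow> ('k::field, 'x::ab_group_add, 'z) vspace_scheme"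
  assumes X: "vspace X"
    and V: "\<And>M. M \<in> R \<Longrightarrow> vspace (V M)" and G: "\<And>M. M \<in> R \<Longrightarrow> linear_map (V M) X (G M)"
    and fin: "\<And>x. x \<in> carrier P \<Longrightarrow> finite {M. h x M \<noteq> 0}"
    and supp: "\<And>x M. x \<in> carrier P \<Longrightarrow> M \<notin> R \<Longrightarrow> h x M = 0"
    and mem: "\<And>x M. x \<in> carrier P \<Longrightarrow> M \<in> R \<Longrightarrow> h x M \<in> carrier (V M)"
    and add: "\<And>x y M. x \<in> carrier P \<Longrightarrow> y \<in> carrier P \<Longrightarrow> h (x + y) M = h x M + h y M"
    and scale: "\<And>a x M. x \<in> carrier P \<Longrightarrow> M \<in> R \<Longrightarrow> h (smult P a x) M = smult (V M) a (h x M)"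
    and P: "vspace P"
  shows "linear_map P X (\<lambda>x. \<Sum>M | h x M \<noteq> 0. G M (h x M))"
proof -
  have G0: "G M 0 = 0" if "M \<in> R" for M using linear_map_zero[OF V[OF that] G[OF that]] .
  have sub: "{M. h x M \<noteq> 0} \<subseteq> R" if "x \<in> carrier P" for x using supp[OF that] by blast
  show ?thesis
  proof (rule linear_mapI)
    show "(\<Sum>M | h x M \<noteq> 0. G M (h x M)) \<in> carrier X" if "x \<in> carrier P" for x
      using sub[OF that] mem[OF that] by (intro vspace_sum[OF X] linear_map_mem[OF G]) auto
  next
    fix x y assume xy: "x \<in> carrier P" "y \<in> carrier P"
    let ?F = "{M. h x M \<noteq> 0} \<union> {M. h y M \<noteq> 0}"
    have F: "finite ?F" "?F \<subseteq> R" using fin sub xy by auto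
    have "{M. h (x + y) M \<noteq> 0} \<subseteq> ?F" using add[OF xy] by auto
    then have "(\<Sum>M | h (x + y) M \<noteq> 0. G M (h (x + y) M)) = (\<Sum>M\<in>?F. G M (h (x + y) M))"
      using F G0 by (intro sum_on_support) auto
    also have "\<dots> = (\<Sum>M\<in>?F. G M (h x M) + G M (h y M))"
      using F(2) xy by (intro sum.cong refl) (auto simp: add linear_map_add[OF G] mem)
    also have "\<dots> = (\<Sum>M | h x M \<noteq> 0. G M (h x M)) + (\<Sum>M | h y M \<noteq> 0. G M (h y M))"
    proof -
      have "(\<Sum>M | h x M \<noteq> 0. G M (h x M)) = (\<Sum>M\<in>?F. G M (h x M))"
        "(\<Sum>M | h y M \<noteq> 0. G M (h y M)) = (\<Sum>M\<in>?F. G M (h y M))"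
        using F(2) G0 by (intro sum_on_support[OF F(1)]; blast)+
      then show ?thesis by (simp add: sum.distrib)
    qed
    finally show "(\<Sum>M | h (x + y) M \<noteq> 0. G M (h (x + y) M)) =
      (\<Sum>M | h x M \<noteq> 0. G M (h x M)) + (\<Sum>M | h y M \<noteq> 0. G M (h y M))" .
  next
    fix a x assume x: "x \<in> carrier P"
    let ?F = "{M. h x M \<noteq> 0}"
    have F: "finite ?F" "?F \<subseteq> R" using fin sub x by auto
    have "h (smult P a x) M = 0" if "h x M = 0" for M
    proof (cases "M \<in> R")
      case True
      then show ?thesis using scale[OF x] that smult_zero_right[OF V] by simp
    qed (use supp vspace_smult[OF P x] in blast)
    then have "{M. h (smult P a x) M \<noteq> 0} \<subseteq> ?F" by blast
    then have "(\<Sum>M | h (smult P a x) M \<noteq> 0. G M (h (smult P a x) M)) = (\<Sum>M\<in>?F. G M (h (smult P a x) M))"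
      using F G0 by (intro sum_on_support) auto
    also have "\<dots> = (\<Sum>M\<in>?F. smult X a (G M (h x M)))"
      using F(2) x by (intro sum.cong refl) (auto simp: scale linear_map_smult[OF G] mem subset_iff)
    also have "\<dots> = smult X a (\<Sum>M\<in>?F. G M (h x M))"
      by (rule linear_map_sum[OF X, of X "smult X a", symmetric])
        (use x F(2) mem in \<open>auto simp: linear_map_def vspace_smult[OF X] smult_add_right[OF X] smult_smult[OF X] mult.commute
          intro!: linear_map_mem[OF G]\<close>)
    finally show "(\<Sum>M | h (smult P a x) M \<noteq> 0. G M (h (smult P a x) M)) = smult X a (\<Sum>M\<in>?F. G M (h x M))" .
  qed
qed

lemma representatives_coord:
  assumes "representatives C R" "M \<in> R"
  shows "comodule C M" "finite_dim M" "smult M = (\<lambda>a x i. a * x i)"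
  using assms by (auto simp: representatives_def fd_coord_comodules_def)

lemma prime_space_simps:
  "carrier (prime_coalgebra R C) = carrier (prime_space R C)" "smult (prime_coalgebra R C) = smult (prime_space R C)"
  "smult (prime_space R C) = (\<lambda>a (\<alpha>, \<mu>, c). (\<lambda>M f. a * \<alpha> M f, \<lambda>M i. a * \<mu> M i, smult C a c))"
  by (simp_all add: prime_coalgebra_def prime_space_def)

lemma prime_space_mem:
  "x \<in> carrier (prime_space R C) \<longleftrightarrow> finite {M. fst x M \<noteq> 0} \<and> finite {M. fst (snd x) M \<noteq> 0} \<and>
     (\<forall>M\<in>R. fst x M \<in> carrier (end_coalgebra C M) \<and> fst (snd x) M \<in> carrier M) \<and>
     (\<forall>M. M \<notin> R \<longrightarrow> fst x M = 0 \<and> fst (snd x) M = 0) \<and> snd (snd x) \<in> carrier C"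
  by (cases x) (simp add: prime_space_def)

lemma single_simps:
  "single i (x + y :: 'x::ab_group_add) = single i x + single i y"
  "single M (\<lambda>f. (a :: 'k::field) * \<alpha> f) = (\<lambda>N f. a * single M \<alpha> N f)"
  by (auto simp: single_def fun_eq_iff plus_fun_apply zero_fun_apply)

lemma finite_support_single: "finite {M. single N x M \<noteq> 0}"
  by (rule finite_subset[of _ "{N}"]) (auto simp: single_def)

lemma support_zero: "{M. (0 :: 'i \<Rightarrow> 'x::zero) M \<noteq> 0} = {}"
  by (simp add: zero_fun_apply)

lemma constant_zero_fun: "(\<lambda>x y. 0) = 0"
  by (simp add: fun_eq_iff zero_fun_apply)

lemma end_coalgebra_simps: "smult (end_coalgebra C M) = (\<lambda>a \<alpha> x. a * \<alpha> x)"
  by (simp add: end_coalgebra_def dual_coalgebra_simps)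

context
  fixes C :: "('k::field, 'v::ab_group_add) coalgebra" and R
  assumes C: "precoalgebra C" and R: "representatives C R"
begin

private lemma vC: "vspace C" using C by (simp add: precoalgebra_def)
private lemma vP: "vspace (prime_space R C)" by (rule vspace_prime[OF vC R])
private lemma vM: "M \<in> R \<Longrightarrow> vspace M" using representatives_coord(1)[OF R] comodule_vspace by blast
private lemma pA: "M \<in> R \<Longrightarrow> precoalgebra (end_coalgebra C M)"
  using precoalgebra_end_coalgebra[OF vC representatives_coord(1,2)[OF R]] .
private lemma vA: "vspace (end_coalgebra C M)"
  unfolding end_coalgebra_def by (rule vspace_dual_coalgebra)

lemma linear_in_base: "linear_map C (prime_space R C) in_base"
  using vspace_zero[OF vA] vspace_zero[OF vM]
  by (auto simp: linear_map_def prime_space_mem in_base_def prime_space_simps zero_fun_apply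
      constant_zero_fun support_zero)

lemma linear_in_end: "M \<in> R \<Longrightarrow> linear_map (end_coalgebra C M) (prime_space R C) (in_end M)"
  using vspace_zero[OF vA] vspace_zero[OF vM] vspace_zero[OF vC] smult_zero_right[OF vC]
  by (auto simp: linear_map_def prime_space_mem in_end_def prime_space_simps zero_fun_apply
      constant_zero_fun single_simps end_coalgebra_simps support_zero finite_support_single)
    (auto simp: single_def)

lemma linear_in_mod: "M \<in> R \<Longrightarrow> linear_map M (prime_space R C) (in_mod M)"
  using vspace_zero[OF vA] vspace_zero[OF vM] vspace_zero[OF vC] smult_zero_right[OF vC]
  by (auto simp: linear_map_def prime_space_mem in_mod_def prime_space_simps zero_fun_apply
      constant_zero_fun single_simps representatives_coord(3)[OF R] support_zero finite_support_single)
    (auto simp: single_def)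

abbreviation (input) "end_part M \<equiv> \<lambda>\<alpha>. tensor_map (end_coalgebra C M) (end_coalgebra C M) (prime_space R C) (prime_space R C)
             (in_end M) (in_end M) (comult (end_coalgebra C M) \<alpha>)"
abbreviation (input) "mod_part M \<equiv> \<lambda>\<mu>. tensor_map (end_coalgebra C M) M (prime_space R C) (prime_space R C)
             (in_end M) (in_mod M) (left_coact C M \<mu>) +
           tensor_map M C (prime_space R C) (prime_space R C) (in_mod M) in_base (coact M \<mu>)"
abbreviation (input) "base_part \<equiv> \<lambda>c. tensor_map C C (prime_space R C) (prime_space R C) in_base in_base (comult C c)"

lemma comult_prime:
  "comult (prime_coalgebra R C) x = (\<Sum>M | fst x M \<noteq> 0. end_part M (fst x M)) +
    (\<Sum>M | fst (snd x) M \<noteq> 0. mod_part M (fst (snd x) M)) + base_part (snd (snd x))"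
  by (cases x) (simp add: prime_coalgebra_def)

private abbreviation (input) "P \<equiv> prime_space R C"

private lemma end_part_linear: "M \<in> R \<Longrightarrow> linear_map (end_coalgebra C M) (tensor_prod P P) (end_part M)"
  by (rule linear_map_comp[OF _ tensor_map_linear[OF vA vA linear_in_end linear_in_end]])
    (use pA in \<open>auto simp: precoalgebra_def\<close>)

private lemma mod_part_linear: "M \<in> R \<Longrightarrow> linear_map M (tensor_prod P P) (mod_part M)"
  using representatives_coord[OF R, of M] vM
  by (intro linear_map_plus[OF vspace_tensor_prod]
      linear_map_comp[OF left_coact_linear[OF vC] tensor_map_linear[OF vA _ linear_in_end linear_in_mod]]
      linear_map_comp[OF coact_linear tensor_map_linear[OF _ vC linear_in_mod linear_in_base]]) auto

private lemma base_part_linear: "linear_map C (tensor_prod P P) base_part"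
  by (rule linear_map_comp[OF _ tensor_map_linear[OF vC vC linear_in_base linear_in_base]])
    (use C in \<open>auto simp: precoalgebra_def\<close>)

lemma precoalgebra_prime: "precoalgebra (prime_coalgebra R C)"
proof -
  let ?T = "tensor_prod P P"
  have fst_h: "linear_map P X (\<lambda>x. \<Sum>M | fst x M \<noteq> 0. G M (fst x M))"
    if X: "vspace X" and G: "\<And>M. M \<in> R \<Longrightarrow> linear_map (end_coalgebra C M) X (G M)" for X :: "('k, 'y::ab_group_add, 'z) vspace_scheme" and G
    by (rule linear_map_support_sum[OF X vA G _ _ _ _ _ vP])
      (auto simp: prime_space_mem plus_fun_apply prime_space_simps end_coalgebra_simps)
  have snd_h: "linear_map P X (\<lambda>x. \<Sum>M | fst (snd x) M \<noteq> 0. G M (fst (snd x) M))"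
    if X: "vspace X" and G: "\<And>M. M \<in> R \<Longrightarrow> linear_map M X (G M)" for X :: "('k, 'y::ab_group_add, 'z) vspace_scheme" and G
    by (rule linear_map_support_sum[OF X vM G _ _ _ _ _ vP])
      (auto simp: prime_space_mem plus_fun_apply prime_space_simps representatives_coord(3)[OF R])
  have base: "linear_map P C (\<lambda>x. snd (snd x))"
    by (auto simp: linear_map_def prime_space_mem prime_space_simps)
  have "linear_map P ?T (comult (prime_coalgebra R C))"
    unfolding comult_prime[abs_def]
    by (intro linear_map_plus[OF vspace_tensor_prod] fst_h snd_h vspace_tensor_prod end_part_linear mod_part_linear
        linear_map_comp[OF base base_part_linear])
  moreover have "tensor_prod (prime_coalgebra R C) (prime_coalgebra R C) = ?T"
    by (rule tensor_prod_cong) (simp_all add: prime_space_simps(1,2))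
  moreover have "linear_map P ground (counit (prime_coalgebra R C))"
  proof -
    have "counit (prime_coalgebra R C) = (\<lambda>x. (\<Sum>M | fst x M \<noteq> 0. counit (end_coalgebra C M) (fst x M)) + counit C (snd (snd x)))"
      by (simp add: prime_coalgebra_def split_def)
    then show ?thesis
      using pA C by (auto simp: precoalgebra_def intro!: linear_map_plus[OF vspace_ground] fst_h[OF vspace_ground]
        linear_map_comp[OF base])
  qed
  ultimately show ?thesis
    using vP by (simp add: precoalgebra_def linear_map_def vspace_def prime_space_simps(1,2))
qed

lemma prime_in_base:
  shows "comult (prime_coalgebra R C) (in_base c) = base_part c"
    and "counit (prime_coalgebra R C) (in_base c) = counit C c"
  by (simp add: comult_prime in_base_def support_zero)
    (simp add: prime_coalgebra_def in_base_def support_zero)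

text \<open>
  Contraction of \<open>\<delta>(x)\<close> on the right sees only left factors. Those in some \<open>A\<^sub>M\<close> are killed by \<open>p\<close>, so
  the comultiplication of \<open>A\<^sub>M\<close> and the left coactions drop out.
\<close>

private lemma project_contract:
  assumes X: "vspace X" and p: "linear_map P X p" and \<psi>: "linear_map P ground \<psi>" and x: "x \<in> carrier P"
    and p_end: "\<And>M \<alpha>. M \<in> R \<Longrightarrow> p (in_end M \<alpha>) = 0"
  shows "p (contract P P \<psi> (comult (prime_coalgebra R C) x)) =
    (\<Sum>M | fst (snd x) M \<noteq> 0. p (in_mod M (act C M (\<lambda>c. \<psi> (in_base c)) (fst (snd x) M)))) +
      p (in_base (contract C C (\<lambda>c. \<psi> (in_base c)) (comult C (snd (snd x)))))"
proof -
  have x': "M \<in> R \<and> fst x M \<in> carrier (end_coalgebra C M)" if "fst x M \<noteq> 0" for M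
    using x that unfolding prime_space_mem by metis
  have x'': "M \<in> R \<and> fst (snd x) M \<in> carrier M" if "fst (snd x) M \<noteq> 0" for M
    using x that unfolding prime_space_mem by metis
  have xc: "snd (snd x) \<in> carrier C" using x unfolding prime_space_mem by blast
  note cl = contract_linear[OF vP vP \<psi>]
  note L = linear_map_comp[OF cl p]
  let ?L = "\<lambda>t. p (contract P P \<psi> t)"
  have e: "?L (end_part M \<alpha>) = 0" if M: "M \<in> R" and \<alpha>: "\<alpha> \<in> carrier (end_coalgebra C M)" for M \<alpha>
  proof -
    have "comult (end_coalgebra C M) \<alpha> \<in> carrier (tensor_prod (end_coalgebra C M) (end_coalgebra C M))"
      using pA[OF M] \<alpha> by (auto simp: precoalgebra_def linear_map_def)
    from contract_tensor_map[OF vA vA vP vP linear_in_end[OF M] linear_in_end[OF M] \<psi> this]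
    show ?thesis using p_end[OF M] by simp
  qed
  have m: "?L (mod_part M \<mu>) = p (in_mod M (act C M (\<lambda>c. \<psi> (in_base c)) \<mu>))" if M: "M \<in> R" and \<mu>: "\<mu> \<in> carrier M" for M \<mu>
  proof -
    note cM = representatives_coord(1,2)[OF R M]
    note l = linear_map_mem[OF left_coact_linear[OF vC cM] \<mu>] and r = coact_mem[OF cM(1) \<mu>]
    show ?thesis
      using linear_map_add[OF L linear_map_mem[OF tensor_map_linear[OF vA vM[OF M] linear_in_end[OF M] linear_in_mod[OF M]] l]
            linear_map_mem[OF tensor_map_linear[OF vM[OF M] vC linear_in_mod[OF M] linear_in_base] r]]
        contract_tensor_map[OF vA vM[OF M] vP vP linear_in_end[OF M] linear_in_mod[OF M] \<psi> l]
        contract_tensor_map[OF vM[OF M] vC vP vP linear_in_mod[OF M] linear_in_base \<psi> r] p_end[OF M]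
      by (simp add: act_def)
  qed
  have c: "contract P P \<psi> (base_part c) = in_base (contract C C (\<lambda>c. \<psi> (in_base c)) (comult C c))" if "c \<in> carrier C" for c
  proof -
    have "comult C c \<in> carrier (tensor_prod C C)"
      using C that by (auto simp: precoalgebra_def linear_map_def)
    from contract_tensor_map[OF vC vC vP vP linear_in_base linear_in_base \<psi> this] show ?thesis .
  qed
  have mem: "(\<Sum>M | fst x M \<noteq> 0. end_part M (fst x M)) \<in> carrier (tensor_prod P P)"
    "(\<Sum>M | fst (snd x) M \<noteq> 0. mod_part M (fst (snd x) M)) \<in> carrier (tensor_prod P P)"
    "base_part (snd (snd x)) \<in> carrier (tensor_prod P P)"
    using x' x'' xc by (intro vspace_sum[OF vspace_tensor_prod] linear_map_mem[OF end_part_linear]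
        linear_map_mem[OF mod_part_linear] linear_map_mem[OF base_part_linear]; blast)+
  have "?L (\<Sum>M | fst x M \<noteq> 0. end_part M (fst x M)) = (\<Sum>M | fst x M \<noteq> 0. ?L (end_part M (fst x M)))"
    by (rule linear_map_sum[OF vspace_tensor_prod L]) (use x' in \<open>auto intro: linear_map_mem[OF end_part_linear]\<close>)
  also have "\<dots> = 0" using x' e by (intro sum.neutral) auto
  finally have 1: "?L (\<Sum>M | fst x M \<noteq> 0. end_part M (fst x M)) = 0" .
  have "?L (\<Sum>M | fst (snd x) M \<noteq> 0. mod_part M (fst (snd x) M)) = (\<Sum>M | fst (snd x) M \<noteq> 0. ?L (mod_part M (fst (snd x) M)))"
    by (rule linear_map_sum[OF vspace_tensor_prod L]) (rule linear_map_mem[OF mod_part_linear]; use x'' in blast)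
  also have "\<dots> = (\<Sum>M | fst (snd x) M \<noteq> 0. p (in_mod M (act C M (\<lambda>c. \<psi> (in_base c)) (fst (snd x) M))))"
    by (rule sum.cong[OF refl]) (rule m; use x'' in blast)
  finally have 2: "?L (\<Sum>M | fst (snd x) M \<noteq> 0. mod_part M (fst (snd x) M)) =
    (\<Sum>M | fst (snd x) M \<noteq> 0. p (in_mod M (act C M (\<lambda>c. \<psi> (in_base c)) (fst (snd x) M))))" .
  show ?thesis
    unfolding comult_prime linear_map_add[OF L vspace_add[OF vspace_tensor_prod mem(1,2)] mem(3)]
      linear_map_add[OF L mem(1,2)] 1 2 c[OF xc] by simp
qed

lemma linear_project_mod: "N \<in> R \<Longrightarrow> linear_map P N (\<lambda>x. fst (snd x) N)"
  by (auto simp: linear_map_def prime_space_mem plus_fun_apply prime_space_simps representatives_coord(3)[OF R])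

lemma linear_project_base: "linear_map P C (\<lambda>x. snd (snd x))"
  by (auto simp: linear_map_def prime_space_mem prime_space_simps)

text \<open>
  The projection of \<open>C'\<close> on the summand \<open>N\<close> is a map of right comodules.
\<close>

lemma project_mod_contract:
  assumes N: "N \<in> R" and \<psi>: "linear_map P ground \<psi>" and x: "x \<in> carrier P"
  shows "fst (snd (contract P P \<psi> (comult (prime_coalgebra R C) x))) N =
    act C N (\<lambda>c. \<psi> (in_base c)) (fst (snd x) N)"
proof -
  have fin: "finite {M. fst (snd x) M \<noteq> 0}" using x unfolding prime_space_mem by blast
  have \<psi>': "linear_map C ground (\<lambda>c. \<psi> (in_base c))" by (rule linear_map_comp[OF linear_in_base \<psi>])
  have "linear_map N N (act C N (\<lambda>c. \<psi> (in_base c)))"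
    by (rule act_linear[OF vC vM[OF N] coact_linear[OF representatives_coord(1)[OF R N]] \<psi>'])
  then have 0: "act C N (\<lambda>c. \<psi> (in_base c)) 0 = 0" using linear_map_zero[OF vM[OF N]] by blast
  have "fst (snd (contract P P \<psi> (comult (prime_coalgebra R C) x))) N =
    (\<Sum>M | fst (snd x) M \<noteq> 0. if M = N then act C M (\<lambda>c. \<psi> (in_base c)) (fst (snd x) M) else 0)"
    by (subst project_contract[OF vM[OF N] linear_project_mod[OF N] \<psi> x])
      (auto simp: in_end_def in_mod_def in_base_def single_def zero_fun_apply intro!: sum.cong)
  also have "\<dots> = act C N (\<lambda>c. \<psi> (in_base c)) (fst (snd x) N)"
    using 0 fin by (simp add: sum.delta)
  finally show ?thesis .
qed

text \<open>
  The projection of \<open>C'\<close> on \<open>C\<close> is a map of right comodules.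
\<close>

lemma project_base_contract:
  assumes \<psi>: "linear_map P ground \<psi>" and x: "x \<in> carrier P"
  shows "snd (snd (contract P P \<psi> (comult (prime_coalgebra R C) x))) =
    contract C C (\<lambda>c. \<psi> (in_base c)) (comult C (snd (snd x)))"
  by (subst project_contract[OF vC linear_project_base \<psi> x])
    (simp_all add: in_end_def in_mod_def in_base_def)

end


section \<open>Towers and their unions\<close>

lemma linear_map_cong:
  assumes "vspace V" "linear_map V W f" "\<And>x. x \<in> carrier V \<Longrightarrow> g x = f x"
  shows "linear_map V W g"
  using assms by (auto simp: linear_map_def vspace_add vspace_smult)

lemma linear_inverse:
  assumes V: "vspace V" and f: "linear_map V W f" and b: "bij_betw f (carrier V) (carrier W)"
  shows "linear_map W V (inv_into (carrier V) f)"
proof -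
  let ?g = "inv_into (carrier V) f"
  have W: "carrier W = f ` carrier V" using b by (simp add: bij_betw_def)
  have gf: "?g (f x) = x" if "x \<in> carrier V" for x using b that by (rule bij_betw_inv_into_left)
  have "?g (f x + f y) = x + y" if "x \<in> carrier V" "y \<in> carrier V" for x y
    using gf[OF vspace_add[OF V that]] linear_map_add[OF f that] by simp
  moreover have "?g (smult W a (f x)) = smult V a x" if "x \<in> carrier V" for x a
    using gf[OF vspace_smult[OF V that]] linear_map_smult[OF f that] by simp
  ultimately show ?thesis unfolding linear_map_def W using gf by auto
qed

lemma vspace_iso_image:
  assumes V: "vspace V" and f: "linear_map V W f" and b: "f ` carrier V = carrier W"
    and W: "vector_space (smult W)"
  shows "vspace W"
proof (rule vspaceI[OF W])
  show "0 \<in> carrier W" using linear_map_mem[OF f vspace_zero[OF V]] linear_map_zero[OF V f] by simp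
  show "x + y \<in> carrier W" if xy: "x \<in> carrier W" "y \<in> carrier W" for x y
  proof -
    obtain x' y' where "x' \<in> carrier V" "y' \<in> carrier V" "x = f x'" "y = f y'" using xy unfolding b[symmetric] by blast
    then show ?thesis using linear_map_add[OF f] linear_map_mem[OF f] vspace_add[OF V] by metis
  qed
  show "smult W a x \<in> carrier W" if "x \<in> carrier W" for a x
  proof -
    obtain x' where "x' \<in> carrier V" "x = f x'" using \<open>x \<in> carrier W\<close> unfolding b[symmetric] by blast
    then show ?thesis using linear_map_smult[OF f] linear_map_mem[OF f] vspace_smult[OF V] by metis
  qed
qed

lemma precoalgebra_iso:
  assumes P: "precoalgebra P" and iso: "coalgebra_iso P E f" and E: "vector_space (smult E)"
  shows "precoalgebra E"
proof -
  have vP: "vspace P" and \<Delta>: "linear_map P (tensor_prod P P) (comult P)" and \<epsilon>: "linear_map P ground (counit P)"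
    using P by (simp_all add: precoalgebra_def)
  have f: "linear_map P E f" "bij_betw f (carrier P) (carrier E)"
    "\<And>c. c \<in> carrier P \<Longrightarrow> comult E (f c) = tensor_map P P E E f f (comult P c)"
    "\<And>c. c \<in> carrier P \<Longrightarrow> counit E (f c) = counit P c"
    using iso by (auto simp: coalgebra_iso_def)
  have vE: "vspace E" by (rule vspace_iso_image[OF vP f(1) _ E]) (use f(2) in \<open>simp add: bij_betw_def\<close>)
  let ?g = "inv_into (carrier P) f"
  have g: "linear_map E P ?g" by (rule linear_inverse[OF vP f(1,2)])
  have fg: "f (?g x) = x" if "x \<in> carrier E" for x using f(2) that by (rule bij_betw_inv_into_right)
  have "linear_map E (tensor_prod E E) (comult E)"
    by (rule linear_map_cong[OF vE linear_map_comp[OF linear_map_comp[OF g \<Delta>] tensor_map_linear[OF vP vP f(1,1)]]])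
      (use f(3) linear_map_mem[OF g] fg in metis)
  moreover have "linear_map E ground (counit E)"
    by (rule linear_map_cong[OF vE linear_map_comp[OF g \<epsilon>]]) (use f(4) linear_map_mem[OF g] fg in metis)
  ultimately show ?thesis using vE by (simp add: precoalgebra_def)
qed

lemma contract_cong_space:
  assumes "carrier V = carrier V'" "smult V = smult V'" "carrier W = carrier W'" "smult W = smult W'"
  shows "contract V W = contract V' W'"
  by (intro ext) (simp only: contract_def tensor_lift_cong[OF assms] assms(2))

text \<open>
  The two projections of \<open>C'\<close>, carried over to a copy \<open>E\<close> of \<open>C'\<close> that literally contains \<open>C\<close>.
  Under \<open>\<phi>\<close> a functional on \<open>E\<close> becomes one on \<open>C'\<close> whose restriction to the summand \<open>C\<close> is again \<open>\<psi>\<close>.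
\<close>

lemma tower_step_projections:
  fixes C :: "('k::field, 'v::ab_group_add) coalgebra"
  assumes C: "precoalgebra C" and R: "representatives C R"
    and iso: "coalgebra_iso (prime_coalgebra R C) E \<phi>" and s: "smult E = smult C"
    and base: "\<And>c. c \<in> carrier C \<Longrightarrow> \<phi> (in_base c) = c"
  shows "precoalgebra E" and "carrier C \<subseteq> carrier E"
    and "c \<in> carrier C \<Longrightarrow> comult E c = comult C c" and "c \<in> carrier C \<Longrightarrow> counit E c = counit C c"
    and "\<exists>p. linear_map E C p \<and> (\<forall>c\<in>carrier C. p c = c) \<and>
      (\<forall>x\<in>carrier E. \<forall>\<psi>. functional C \<psi> \<longrightarrow>
        p (contract E E \<psi> (comult E x)) = contract C C \<psi> (comult C (p x)))" (is ?retract)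
    and "N \<in> R \<Longrightarrow> \<exists>q. linear_map E N q \<and> q ` carrier E = carrier N \<and>
      (\<forall>x\<in>carrier E. \<forall>\<psi>. functional C \<psi> \<longrightarrow>
        q (contract E E \<psi> (comult E x)) = act C N \<psi> (q x))"
proof -
  let ?P = "prime_coalgebra R C" and ?S = "prime_space R C"
  have vC: "vspace C" and \<Delta>: "linear_map C (tensor_prod C C) (comult C)"
    using C by (simp_all add: precoalgebra_def)
  have vS: "vspace ?S" by (rule vspace_prime[OF vC R])
  have preP: "precoalgebra ?P" by (rule precoalgebra_prime[OF C R])
  have tm: "tensor_map ?P ?P E E = tensor_map ?S ?S E E"
    by (rule tensor_map_cong) (simp_all add: prime_space_simps(1,2))
  have tp: "tensor_prod ?P ?P = tensor_prod ?S ?S"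
    by (rule tensor_prod_cong) (simp_all add: prime_space_simps(1,2))
  have \<phi>: "linear_map ?S E \<phi>" "bij_betw \<phi> (carrier ?S) (carrier E)"
    "\<And>c. c \<in> carrier ?S \<Longrightarrow> comult E (\<phi> c) = tensor_map ?S ?S E E \<phi> \<phi> (comult ?P c)"
    "\<And>c. c \<in> carrier ?S \<Longrightarrow> counit E (\<phi> c) = counit ?P c"
    using iso by (auto simp: coalgebra_iso_def prime_space_simps(1,2) linear_map_def tm)
  have \<Delta>P: "comult ?P x \<in> carrier (tensor_prod ?S ?S)" if "x \<in> carrier ?S" for x
    using preP that by (auto simp: precoalgebra_def linear_map_def prime_space_simps(1) tp)
  show preE: "precoalgebra E"
    by (rule precoalgebra_iso[OF preP iso]) (use vC in \<open>simp add: s vspace_def\<close>)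
  then have vE: "vspace E" by (simp add: precoalgebra_def)
  note ib = linear_in_base[OF C R]
  show sub: "carrier C \<subseteq> carrier E"
  proof
    fix c assume c: "c \<in> carrier C"
    show "c \<in> carrier E" using linear_map_mem[OF \<phi>(1) linear_map_mem[OF ib c]] base[OF c] by simp
  qed
  show "comult E c = comult C c" if c: "c \<in> carrier C"
  proof -
    have "comult E (\<phi> (in_base c)) = tensor_map ?S ?S E E \<phi> \<phi> (tensor_map C C ?S ?S in_base in_base (comult C c))"
      by (simp add: \<phi>(3)[OF linear_map_mem[OF ib c]] prime_in_base(1)[OF C R])
    also have "\<dots> = id (comult C c)"
    proof (rule linear_map_tensor_eqI[OF vC linear_map_comp[OF tensor_map_linear[OF vC vC ib ib]
            tensor_map_linear[OF vS vS \<phi>(1,1)]] _ _ linear_map_mem[OF \<Delta> c]])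
      show "linear_map (tensor_prod C C) (tensor_prod E E) id"
        using tensor_prod_mono[OF vC vE sub sub s[symmetric] s[symmetric]]
        by (intro linear_mapI) (auto simp: subset_iff)
      show "tensor_map ?S ?S E E \<phi> \<phi> (tensor_map C C ?S ?S in_base in_base (tens C C v w)) = id (tens C C v w)"
        if "v \<in> carrier C" "w \<in> carrier C" for v w
        using that linear_map_mem[OF ib] tens_cong[of E C E C, OF s s]
        by (simp add: tensor_map_pure[OF vC vC ib ib] tensor_map_pure[OF vS vS \<phi>(1,1)] base)
    qed
    finally show ?thesis using base[OF c] by simp
  qed
  show "counit E c = counit C c" if c: "c \<in> carrier C"
    using \<phi>(4)[OF linear_map_mem[OF ib c]] base[OF c] prime_in_base(2)[OF C R] by metis
  define \<theta> where "\<theta> = inv_into (carrier ?S) \<phi>"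
  have \<theta>: "linear_map E ?S \<theta>" unfolding \<theta>_def by (rule linear_inverse[OF vS \<phi>(1,2)])
  have \<theta>\<phi>: "\<theta> (\<phi> x) = x" if "x \<in> carrier ?S" for x unfolding \<theta>_def using \<phi>(2) that by (rule bij_betw_inv_into_left)
  have \<phi>\<theta>: "\<phi> (\<theta> x) = x" if "x \<in> carrier E" for x unfolding \<theta>_def using \<phi>(2) that by (rule bij_betw_inv_into_right)
  have \<psi>E: "linear_map E ground \<psi>" if "functional C \<psi>" for \<psi>
    using functional_linear_map[of E \<psi>] that by (simp add: s)
  have \<psi>S: "linear_map ?S ground (\<lambda>z. \<psi> (\<phi> z))" if "functional C \<psi>" for \<psi>
    by (rule linear_map_comp[OF \<phi>(1) \<psi>E[OF that]])
  have key: "\<theta> (contract E E \<psi> (comult E x)) = contract ?S ?S (\<lambda>z. \<psi> (\<phi> z)) (comult ?P (\<theta> x))"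
    if x: "x \<in> carrier E" and \<psi>: "functional C \<psi>" for x \<psi>
  proof -
    have z: "\<theta> x \<in> carrier ?S" by (rule linear_map_mem[OF \<theta> x])
    have "contract E E \<psi> (comult E x) = contract E E \<psi> (tensor_map ?S ?S E E \<phi> \<phi> (comult ?P (\<theta> x)))"
      using \<phi>(3)[OF z] \<phi>\<theta>[OF x] by simp
    also have "\<dots> = \<phi> (contract ?S ?S (\<lambda>z. \<psi> (\<phi> z)) (comult ?P (\<theta> x)))"
      by (rule contract_tensor_map[OF vS vS vE vE \<phi>(1,1) \<psi>E[OF \<psi>] \<Delta>P[OF z]])
    finally show ?thesis using \<theta>\<phi> contract_mem[OF vS vS \<psi>S[OF \<psi>] \<Delta>P[OF z]] by simp
  qed
  have base_\<psi>: "linear_map C ground (\<lambda>c. \<psi> (\<phi> (in_base c)))" if "functional C \<psi>" for \<psi>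
    by (rule linear_map_comp[OF ib \<psi>S[OF that]])
  show ?retract
  proof (intro exI conjI ballI allI impI)
    let ?p = "\<lambda>x. snd (snd (\<theta> x))"
    show p: "linear_map E C ?p" by (rule linear_map_comp[OF \<theta> linear_project_base[OF C R]])
    show "?p c = c" if "c \<in> carrier C" for c
      using \<theta>\<phi>[OF linear_map_mem[OF ib that]] base[OF that] by (simp add: in_base_def)
    fix x \<psi> assume x: "x \<in> carrier E" and \<psi>: "functional C \<psi>"
    have "?p (contract E E \<psi> (comult E x)) = contract C C (\<lambda>c. \<psi> (\<phi> (in_base c))) (comult C (?p x))"
      unfolding key[OF x \<psi>] by (rule project_base_contract[OF C R \<psi>S[OF \<psi>] linear_map_mem[OF \<theta> x]])
    also have "\<dots> = contract C C \<psi> (comult C (?p x))"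
      by (rule contract_cong[OF vC vC base_\<psi>[OF \<psi>] _ linear_map_mem[OF \<Delta> linear_map_mem[OF p x]]]) (simp add: base)
    finally show "?p (contract E E \<psi> (comult E x)) = contract C C \<psi> (comult C (?p x))" .
  qed
  show "\<exists>q. linear_map E N q \<and> q ` carrier E = carrier N \<and>
      (\<forall>x\<in>carrier E. \<forall>\<psi>. functional C \<psi> \<longrightarrow>
        q (contract E E \<psi> (comult E x)) = act C N \<psi> (q x))" if N: "N \<in> R"
  proof (intro exI conjI ballI allI impI)
    let ?q = "\<lambda>x. fst (snd (\<theta> x)) N"
    have cN: "comodule C N" by (rule representatives_coord[OF R N])
    show q: "linear_map E N ?q" by (rule linear_map_comp[OF \<theta> linear_project_mod[OF C R N]])
    show "?q ` carrier E = carrier N"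
    proof
      show "?q ` carrier E \<subseteq> carrier N" using linear_map_mem[OF q] by (rule image_subsetI)
      show "carrier N \<subseteq> ?q ` carrier E"
      proof
        fix y assume y: "y \<in> carrier N"
        note m = linear_map_mem[OF linear_in_mod[OF C R N] y]
        \<comment> \<open>surjectivity: the summand \<open>N\<close> of \<open>C'\<close> maps onto \<open>N\<close>\<close>
        have "?q (\<phi> (in_mod N y)) = y" unfolding \<theta>\<phi>[OF m] by (simp add: in_mod_def single_def)
        then show "y \<in> ?q ` carrier E" using linear_map_mem[OF \<phi>(1) m] by (intro image_eqI) auto
      qed
    qed
    fix x \<psi> assume x: "x \<in> carrier E" and \<psi>: "functional C \<psi>"
    have "?q (contract E E \<psi> (comult E x)) = act C N (\<lambda>c. \<psi> (\<phi> (in_base c))) (?q x)"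
      unfolding key[OF x \<psi>] by (rule project_mod_contract[OF C R N \<psi>S[OF \<psi>] linear_map_mem[OF \<theta> x]])
    also have "\<dots> = act C N \<psi> (?q x)"
      unfolding act_def
      by (rule contract_cong[OF comodule_vspace[OF cN] vC base_\<psi>[OF \<psi>] _ coact_mem[OF cN linear_map_mem[OF q x]]]) (simp add: base)
    finally show "?q (contract E E \<psi> (comult E x)) = act C N \<psi> (?q x)" .
  qed
qed

locale tower =
  fixes C :: "('k::field, 'c::ab_group_add) coalgebra"
    and R :: "nat \<Rightarrow> ('k, 'v::ab_group_add) coord_comodule set"
    and Cs :: "nat \<Rightarrow> ('k, 'v) coalgebra"
  assumes coalgebra_base: "coalgebra C" and is_tower: "is_tower C R Cs"
begin

abbreviation Cinf :: "('k, 'v) coalgebra" where "Cinf \<equiv> union_coalgebra Cs"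

lemma smult_level: "smult (Cs n) = smult Cinf"
  using is_tower unfolding is_tower_def union_coalgebra_def by simp

lemma vector_space_union: "vector_space (smult Cinf)"
  using is_tower unfolding is_tower_def union_coalgebra_def by simp

lemma representatives_level: "representatives (Cs n) (R n)"
  using is_tower unfolding is_tower_def by blast

lemma step_iso:
  obtains \<phi> where "coalgebra_iso (prime_coalgebra (R n) (Cs n)) (Cs (Suc n)) \<phi>"
    "\<And>c. c \<in> carrier (Cs n) \<Longrightarrow> \<phi> (in_base c) = c"
  using is_tower unfolding is_tower_def by blast

lemma precoalgebra_level: "precoalgebra (Cs n)"
proof (induction n)
  case 0
  obtain j where "coalgebra_iso C (Cs 0) j" using is_tower unfolding is_tower_def by blast
  moreover have "precoalgebra C" using coalgebra_base by (simp add: coalgebra_def precoalgebra_def)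
  ultimately show ?case using precoalgebra_iso vector_space_union smult_level[of 0] by metis
next
  case (Suc n)
  obtain \<phi> where "coalgebra_iso (prime_coalgebra (R n) (Cs n)) (Cs (Suc n)) \<phi>"
    "\<And>c. c \<in> carrier (Cs n) \<Longrightarrow> \<phi> (in_base c) = c" by (rule step_iso[of n], rule that)
  from tower_step_projections(1)[OF Suc representatives_level this(1) _ this(2)] show ?case
    by (simp add: smult_level)
qed

lemma
  shows step_subset: "carrier (Cs n) \<subseteq> carrier (Cs (Suc n))"
    and step_comult: "c \<in> carrier (Cs n) \<Longrightarrow> comult (Cs (Suc n)) c = comult (Cs n) c"
    and step_counit: "c \<in> carrier (Cs n) \<Longrightarrow> counit (Cs (Suc n)) c = counit (Cs n) c"
    and step_retract: "\<exists>p. linear_map (Cs (Suc n)) (Cs n) p \<and> (\<forall>c\<in>carrier (Cs n). p c = c) \<and>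
      (\<forall>x\<in>carrier (Cs (Suc n)). \<forall>\<psi>. functional Cinf \<psi> \<longrightarrow>
        p (contract (Cs (Suc n)) (Cs (Suc n)) \<psi> (comult (Cs (Suc n)) x)) = contract (Cs n) (Cs n) \<psi> (comult (Cs n) (p x)))"
    and step_project: "N \<in> R n \<Longrightarrow> \<exists>q. linear_map (Cs (Suc n)) N q \<and> q ` carrier (Cs (Suc n)) = carrier N \<and>
      (\<forall>x\<in>carrier (Cs (Suc n)). \<forall>\<psi>. functional Cinf \<psi> \<longrightarrow>
        q (contract (Cs (Suc n)) (Cs (Suc n)) \<psi> (comult (Cs (Suc n)) x)) = act (Cs n) N \<psi> (q x))"
proof -
  obtain \<phi> where "coalgebra_iso (prime_coalgebra (R n) (Cs n)) (Cs (Suc n)) \<phi>"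
    "\<And>c. c \<in> carrier (Cs n) \<Longrightarrow> \<phi> (in_base c) = c" by (rule step_iso[of n], rule that)
  note * = tower_step_projections[OF precoalgebra_level representatives_level this(1) _ this(2), unfolded smult_level, OF refl]
  show "carrier (Cs n) \<subseteq> carrier (Cs (Suc n))" by (rule *(2))
  show "comult (Cs (Suc n)) c = comult (Cs n) c" "counit (Cs (Suc n)) c = counit (Cs n) c"
    if "c \<in> carrier (Cs n)" using that by (simp_all add: *(3,4))
  show "\<exists>p. linear_map (Cs (Suc n)) (Cs n) p \<and> (\<forall>c\<in>carrier (Cs n). p c = c) \<and>
      (\<forall>x\<in>carrier (Cs (Suc n)). \<forall>\<psi>. functional Cinf \<psi> \<longrightarrow>
        p (contract (Cs (Suc n)) (Cs (Suc n)) \<psi> (comult (Cs (Suc n)) x)) = contract (Cs n) (Cs n) \<psi> (comult (Cs n) (p x)))"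
    by (rule *(5)) simp
  show "\<exists>q. linear_map (Cs (Suc n)) N q \<and> q ` carrier (Cs (Suc n)) = carrier N \<and>
      (\<forall>x\<in>carrier (Cs (Suc n)). \<forall>\<psi>. functional Cinf \<psi> \<longrightarrow>
        q (contract (Cs (Suc n)) (Cs (Suc n)) \<psi> (comult (Cs (Suc n)) x)) = act (Cs n) N \<psi> (q x))"
    if "N \<in> R n"
    by (rule *(6)) (simp_all add: that)
qed

lemma level_mono: "m \<le> n \<Longrightarrow> carrier (Cs m) \<subseteq> carrier (Cs n)"
  by (rule lift_Suc_mono_le[of "\<lambda>n. carrier (Cs n)"]) (rule step_subset)

lemma level_comult: "m \<le> n \<Longrightarrow> c \<in> carrier (Cs m) \<Longrightarrow> comult (Cs n) c = comult (Cs m) c \<and> counit (Cs n) c = counit (Cs m) c"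
proof (induction rule: dec_induct)
  case (step n)
  then show ?case using step_comult[of c n] step_counit[of c n] level_mono[of m n] by auto
qed simp

lemma carrier_union: "carrier Cinf = (\<Union>n. carrier (Cs n))"
proof
  have "carrier (Cs n) \<subseteq> (\<Union>n\<in>{1..}. carrier (Cs n))" for n using step_subset[of n] by fastforce
  then show "(\<Union>n. carrier (Cs n)) \<subseteq> carrier Cinf" by (auto simp: union_coalgebra_def)
qed (auto simp: union_coalgebra_def)

lemma level_subset: "carrier (Cs n) \<subseteq> carrier Cinf"
  by (auto simp: carrier_union)

lemma
  assumes c: "c \<in> carrier (Cs n)"
  shows union_comult: "comult Cinf c = comult (Cs n) c" and union_counit: "counit Cinf c = counit (Cs n) c"
proof -
  let ?k = "LEAST n. 1 \<le> n \<and> c \<in> carrier (Cs n)"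
  \<comment> \<open>the union takes structure maps from levels at least 1, so \<open>n = 0\<close> has to be moved up\<close>
  have "1 \<le> Suc n \<and> c \<in> carrier (Cs (Suc n))" using c step_subset by auto
  then have k: "?k \<le> Suc n" "c \<in> carrier (Cs ?k)"
    using Least_le[of "\<lambda>n. 1 \<le> n \<and> c \<in> carrier (Cs n)" "Suc n"]
      LeastI[of "\<lambda>n. 1 \<le> n \<and> c \<in> carrier (Cs n)" "Suc n"] by auto
  then show "comult Cinf c = comult (Cs n) c" "counit Cinf c = counit (Cs n) c"
    using level_comult[OF k] level_comult[of n "Suc n" c] c by (simp_all add: union_coalgebra_def)
qed

lemma vspace_level: "vspace (Cs n)" using precoalgebra_level by (simp add: precoalgebra_def)

lemma level_of_finite: "finite F \<Longrightarrow> F \<subseteq> carrier Cinf \<Longrightarrow> \<exists>n. F \<subseteq> carrier (Cs n)"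
proof (induction rule: finite_induct)
  case (insert x F)
  then obtain m n where "x \<in> carrier (Cs m)" "F \<subseteq> carrier (Cs n)" unfolding carrier_union by auto
  then show ?case using level_mono[of m "max m n"] level_mono[of n "max m n"]
    by (intro exI[of _ "max m n"]) auto
qed simp

lemma vspace_union: "vspace Cinf"
proof (rule vspaceI[OF vector_space_union])
  show "0 \<in> carrier Cinf" using vspace_zero[OF vspace_level] level_subset by blast
  show "x + y \<in> carrier Cinf" if xy: "x \<in> carrier Cinf" "y \<in> carrier Cinf" for x y
  proof -
    obtain n where "{x, y} \<subseteq> carrier (Cs n)" using level_of_finite[of "{x, y}"] xy by auto
    then show ?thesis using vspace_add[OF vspace_level, of x n y] level_subset by auto
  qed
  show "smult Cinf a x \<in> carrier Cinf" if x: "x \<in> carrier Cinf" for a x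
  proof -
    obtain n where "x \<in> carrier (Cs n)" using x unfolding carrier_union by blast
    then show ?thesis using vspace_smult[OF vspace_level, of x n a] level_subset by (auto simp: smult_level)
  qed
qed

lemma tensor_level_subset: "carrier (tensor_prod (Cs n) (Cs n)) \<subseteq> carrier (tensor_prod Cinf Cinf)"
  by (rule tensor_prod_mono[OF vspace_level vspace_union level_subset level_subset smult_level smult_level])

lemma level_comult_linear: "linear_map (Cs n) (tensor_prod (Cs n) (Cs n)) (comult (Cs n))"
  and level_counit_linear: "linear_map (Cs n) ground (counit (Cs n))"
  using precoalgebra_level by (simp_all add: precoalgebra_def)

lemma precoalgebra_union: "precoalgebra Cinf"
proof -
  have "linear_map Cinf (tensor_prod Cinf Cinf) (comult Cinf) \<and> linear_map Cinf ground (counit Cinf)"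
  proof (intro conjI linear_mapI)
    fix x assume "x \<in> carrier Cinf"
    then obtain n where n: "x \<in> carrier (Cs n)" unfolding carrier_union by blast
    show "comult Cinf x \<in> carrier (tensor_prod Cinf Cinf)"
      using linear_map_mem[OF level_comult_linear n] tensor_level_subset by (auto simp: union_comult[OF n])
    fix a
    have an: "smult Cinf a x \<in> carrier (Cs n)" using vspace_smult[OF vspace_level n, of a] by (simp add: smult_level)
    show "comult Cinf (smult Cinf a x) = smult (tensor_prod Cinf Cinf) a (comult Cinf x)"
      "counit Cinf (smult Cinf a x) = smult ground a (counit Cinf x)"
      using linear_map_smult[OF level_comult_linear n, of a] linear_map_smult[OF level_counit_linear n, of a]
      by (simp_all add: union_comult[OF n] union_comult[OF an] union_counit[OF n] union_counit[OF an] smult_level)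
  next
    fix x y assume xy: "x \<in> carrier Cinf" "y \<in> carrier Cinf"
    obtain n where n: "x \<in> carrier (Cs n)" "y \<in> carrier (Cs n)" using xy level_of_finite[of "{x, y}"] by auto
    note xyn = vspace_add[OF vspace_level n]
    show "comult Cinf (x + y) = comult Cinf x + comult Cinf y" "counit Cinf (x + y) = counit Cinf x + counit Cinf y"
      using linear_map_add[OF level_comult_linear n] linear_map_add[OF level_counit_linear n]
      by (simp_all add: union_comult[OF n(1)] union_comult[OF n(2)] union_comult[OF xyn]
        union_counit[OF n(1)] union_counit[OF n(2)] union_counit[OF xyn])
  qed simp
  then show ?thesis using vspace_union by (simp add: precoalgebra_def)
qed

abbreviation reg_act :: "('v \<Rightarrow> 'k) \<Rightarrow> 'v \<Rightarrow> 'v" where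
  "reg_act \<psi> c \<equiv> act Cinf (regular_comodule Cinf) \<psi> c"

lemma reg_act_level:
  assumes c: "c \<in> carrier (Cs n)" and \<psi>: "functional Cinf \<psi>"
  shows "contract (Cs n) (Cs n) \<psi> (comult (Cs n) c) = reg_act \<psi> c"
proof -
  have "contract (Cs n) (Cs n) \<psi> (comult (Cs n) c) = contract Cinf Cinf \<psi> (comult (Cs n) c)"
    by (rule contract_subspace[OF vspace_level vspace_union level_subset smult_level
          vspace_level vspace_union level_subset smult_level functional_linear_map[OF \<psi>] linear_map_mem[OF level_comult_linear c]])
  also have "\<dots> = reg_act \<psi> c"
  proof -
    have "contract (regular_comodule Cinf) Cinf = contract Cinf Cinf"
      by (rule contract_cong_space) (simp_all add: regular_comodule_def)
    moreover have "coact (regular_comodule Cinf) c = comult (Cs n) c"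
      by (simp add: regular_comodule_def union_comult[OF c])
    ultimately show ?thesis by (simp add: act_def)
  qed
  finally show ?thesis .
qed

lemma reg_act_mem:
  assumes c: "c \<in> carrier (Cs n)" and \<psi>: "functional Cinf \<psi>"
  shows "reg_act \<psi> c \<in> carrier (Cs n)"
proof -
  have "functional (Cs n) \<psi>" using \<psi> by (simp add: smult_level)
  from contract_mem[OF vspace_level vspace_level functional_linear_map[OF this] linear_map_mem[OF level_comult_linear c]]
  show ?thesis by (simp add: reg_act_level[OF c \<psi>])
qed

text \<open>
  Composing the retractions \<open>C\<^sup>(\<^sup>i\<^sup>+\<^sup>1\<^sup>) \<rightarrow> C\<^sup>(\<^sup>i\<^sup>)\<close> for \<open>i \<ge> k\<close> gives compatible retractions of all
  later levels onto \<open>C\<^sup>(\<^sup>k\<^sup>)\<close>, because each one fixes the smaller level; so they glue on the union.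
\<close>

lemma level_retraction:
  obtains p where "linear_map Cinf (Cs k) p" "\<And>c. c \<in> carrier (Cs k) \<Longrightarrow> p c = c"
    "\<And>c \<psi>. c \<in> carrier Cinf \<Longrightarrow> functional Cinf \<psi> \<Longrightarrow> p (reg_act \<psi> c) = reg_act \<psi> (p c)"
proof -
  have "\<forall>n. \<exists>p. linear_map (Cs (Suc n)) (Cs n) p \<and> (\<forall>c\<in>carrier (Cs n). p c = c) \<and>
      (\<forall>x\<in>carrier (Cs (Suc n)). \<forall>\<psi>. functional Cinf \<psi> \<longrightarrow> p (reg_act \<psi> x) = reg_act \<psi> (p x))"
  proof
    fix n
    obtain p where p: "linear_map (Cs (Suc n)) (Cs n) p" "\<forall>c\<in>carrier (Cs n). p c = c"
      "\<forall>x\<in>carrier (Cs (Suc n)). \<forall>\<psi>. functional Cinf \<psi> \<longrightarrow>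
        p (contract (Cs (Suc n)) (Cs (Suc n)) \<psi> (comult (Cs (Suc n)) x)) = contract (Cs n) (Cs n) \<psi> (comult (Cs n) (p x))"
      using step_retract[of n] by blast
    show "\<exists>p. linear_map (Cs (Suc n)) (Cs n) p \<and> (\<forall>c\<in>carrier (Cs n). p c = c) \<and>
      (\<forall>x\<in>carrier (Cs (Suc n)). \<forall>\<psi>. functional Cinf \<psi> \<longrightarrow> p (reg_act \<psi> x) = reg_act \<psi> (p x))"
      using p reg_act_level linear_map_mem[OF p(1)] by (intro exI[of _ p]) auto
  qed
  from choice[OF this] obtain p where p: "\<And>n. linear_map (Cs (Suc n)) (Cs n) (p n)" "\<And>n c. c \<in> carrier (Cs n) \<Longrightarrow> p n c = c"
      "\<And>n x \<psi>. x \<in> carrier (Cs (Suc n)) \<Longrightarrow> functional Cinf \<psi> \<Longrightarrow> p n (reg_act \<psi> x) = reg_act \<psi> (p n x)"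
    by blast
  \<comment> \<open>\<open>r d\<close> is the composite of \<open>p (k + d - 1), \<dots>, p k\<close>, a retraction of level \<open>k + d\<close> onto level \<open>k\<close>\<close>
  define r where "r = rec_nat (\<lambda>x. x) (\<lambda>d f x. f (p (k + d) x))"
  have r: "r 0 x = x" "r (Suc d) x = r d (p (k + d) x)" for d x by (simp_all add: r_def)
  have r_lin: "linear_map (Cs (k + d)) (Cs k) (r d)" for d
  proof (induction d)
    case (Suc d)
    from linear_map_comp[OF p(1)[of "k + d"] this] show ?case by (simp add: r(2)[abs_def])
  qed (simp add: r linear_map_def)
  have r_act: "r d (reg_act \<psi> x) = reg_act \<psi> (r d x)" if "x \<in> carrier (Cs (k + d))" "functional Cinf \<psi>" for d x \<psi>
    using that(1)
  proof (induction d arbitrary: x)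
    case (Suc d)
    then show ?case using p(3)[OF _ that(2), of x "k + d"] linear_map_mem[OF p(1)[of "k + d"]] by (simp add: r)
  qed (simp add: r)
  have r_le: "r e x = r d x" if "d \<le> e" "x \<in> carrier (Cs (k + d))" for d e x
    using that
  proof (induction rule: dec_induct)
    case (step n)
    then show ?case using p(2)[of x "k + n"] level_mono[of "k + d" "k + n"] by (auto simp: r)
  qed simp
  define q where "q x = r (LEAST d. x \<in> carrier (Cs (k + d))) x" for x
  have q: "q x = r d x" if "x \<in> carrier (Cs (k + d))" for d x
    unfolding q_def
    by (rule r_le[symmetric]; (rule Least_le LeastI[of _ d])?; rule that)
  have lev: "\<exists>d. F \<subseteq> carrier (Cs (k + d))" if F: "finite F" "F \<subseteq> carrier Cinf" for F
  proof -
    obtain n where "F \<subseteq> carrier (Cs n)" using level_of_finite[OF F] by blast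
    then show ?thesis using level_mono[of n "k + n"] by (intro exI[of _ n]) auto
  qed
  show thesis
  proof (rule that[of q])
    show "linear_map Cinf (Cs k) q"
    proof (rule linear_mapI)
      fix x assume "x \<in> carrier Cinf"
      then obtain d where d: "x \<in> carrier (Cs (k + d))" using lev[of "{x}"] by auto
      show "q x \<in> carrier (Cs k)" using linear_map_mem[OF r_lin d] by (simp add: q[OF d])
      show "q (smult Cinf a x) = smult (Cs k) a (q x)" for a
        using linear_map_smult[OF r_lin d, of a] q[OF d] q[OF vspace_smult[OF vspace_level d], of a] by (simp add: smult_level)
    next
      fix x y assume xy: "x \<in> carrier Cinf" "y \<in> carrier Cinf"
      obtain d where d: "x \<in> carrier (Cs (k + d))" "y \<in> carrier (Cs (k + d))" using xy lev[of "{x, y}"] by auto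
      show "q (x + y) = q x + q y"
        using linear_map_add[OF r_lin d] q[OF d(1)] q[OF d(2)] q[OF vspace_add[OF vspace_level d]] by simp
    qed
    show "q c = c" if "c \<in> carrier (Cs k)" for c using q[of c 0] that by (simp add: r)
    fix c \<psi> assume "c \<in> carrier Cinf" and \<psi>: "functional Cinf \<psi>"
    then obtain d where d: "c \<in> carrier (Cs (k + d))" using lev[of "{c}"] by auto
    show "q (reg_act \<psi> c) = reg_act \<psi> (q c)"
      using r_act[OF d \<psi>] q[OF d] q[OF reg_act_mem[OF d \<psi>]] by simp
  qed
qed

end


section \<open>Finite dimensional comodules are quotients\<close>

lemma transport_comodule:
  fixes D :: "('k::field, 'v::ab_group_add) coalgebra" and M :: "('k, 'm::ab_group_add, 'v) comodule"
    and V :: "('k, 'n::ab_group_add) vspace"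
  assumes D: "precoalgebra D" and M: "comodule D M" and V: "vspace V"
    and g: "linear_map M V g" and bij: "bij_betw g (carrier M) (carrier V)"
  obtains N :: "('k, 'n, 'v) comodule" where "comodule D N" "carrier N = carrier V" "smult N = smult V"
    "comodule_isomorphic D M N"
proof -
  have vD: "vspace D" and \<Delta>: "linear_map D (tensor_prod D D) (comult D)" and \<epsilon>: "linear_map D ground (counit D)"
    using D by (simp_all add: precoalgebra_def)
  note vM = comodule_vspace[OF M]
  let ?g = "inv_into (carrier M) g"
  have ig: "linear_map V M ?g" by (rule linear_inverse[OF vM g bij])
  have gV: "carrier V = g ` carrier M" using bij by (simp add: bij_betw_def)
  have ig_g: "?g (g m) = m" if "m \<in> carrier M" for m using bij that by (rule bij_betw_inv_into_left)
  define N :: "('k, 'n, 'v) comodule" where "N = \<lparr>carrier = carrier V, smult = smult V,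
    coact = (\<lambda>y. tensor_map M D V D g id (coact M (?g y)))\<rparr>"
  have coact_N: "coact N (g m) = tensor_map M D V D g id (coact M m)" if "m \<in> carrier M" for m
    using ig_g[OF that] by (simp add: N_def)
  have Ns: "carrier N = carrier V" "smult N = smult V" by (simp_all add: N_def)
  have vN: "vspace N" using V by (simp add: vspace_def Ns)
  have tp: "tensor_prod N D = tensor_prod V D" by (rule tensor_prod_cong) (simp_all add: Ns)
  have "linear_map V (tensor_prod V D) (coact N)"
    using linear_map_comp[OF linear_map_comp[OF ig coact_linear[OF M]] tensor_map_linear[OF vM vD g linear_map_id]]
    by (simp add: N_def)
  then have lN: "linear_map N (tensor_prod N D) (coact N)" by (simp add: linear_map_def Ns tp)
  have gN: "linear_map M N g" using g by (simp add: linear_map_def Ns)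
  have act: "act D N \<psi> (g m) = g (act D M \<psi> m)" if m: "m \<in> carrier M" and \<psi>: "linear_map D ground \<psi>" for m \<psi>
  proof -
    have "act D N \<psi> (g m) = contract V D \<psi> (tensor_map M D V D g id (coact M m))"
      using contract_cong_space[of N V D D] by (simp add: act_def coact_N[OF m] Ns)
    also have "\<dots> = g (act D M \<psi> m)"
      using contract_tensor_map[OF vM vD V vD g linear_map_id \<psi> coact_mem[OF M m]] by (simp add: act_def)
    finally show ?thesis .
  qed
  have al: "act D M \<psi> m \<in> carrier M" if "m \<in> carrier M" "linear_map D ground \<psi>" for \<psi> m
    using linear_map_mem[OF act_linear[OF vD vM coact_linear[OF M] that(2)] that(1)] .
  have laws: "act D M (counit D) m = m" "functional D \<psi> \<Longrightarrow> functional D \<chi> \<Longrightarrow>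
      act D M \<psi> (act D M \<chi> m) = act D M (\<lambda>c. comult D c \<psi> \<chi>) m" if "m \<in> carrier M" for m \<psi> \<chi>
    using M that unfolding comodule_iff_act[OF D] by blast+
  have "comodule D N"
    unfolding comodule_iff_act[OF D] Ns gV
    using vN lN \<epsilon> by (auto simp: act al laws functional_linear_map linear_map_convolution[OF \<Delta>])
  moreover have "comodule_hom D M N g"
    using comodule_hom_iff_act[OF vD vM vN coact_image[OF M], of g] linear_map_mem[OF lN] gN act functional_linear_map
    by blast
  then have "comodule_isomorphic D M N" unfolding comodule_isomorphic_def using bij Ns by auto
  ultimately show thesis using that Ns by blast
qed

lemma finite_dim_image:
  assumes V: "vspace V" "finite_dim V" and f: "linear_map V W f" and W: "vspace W" "carrier W = f ` carrier V"
  shows "finite_dim W"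
proof -
  obtain B r where B: "finite B" "B \<subseteq> carrier V" "\<And>b. b \<in> B \<Longrightarrow> functional V (r b)"
      "\<And>x. x \<in> carrier V \<Longrightarrow> x = (\<Sum>b\<in>B. smult V (r b x) b)"
    by (rule finite_basis[OF V], rule that)
  interpret W: vector_space "smult W" using W by (simp add: vspace_def)
  have "f x \<in> W.span (f ` B)" if x: "x \<in> carrier V" for x
  proof -
    have "f x = f (\<Sum>b\<in>B. smult V (r b x) b)" using B(4)[OF x] by simp
    also have "\<dots> = (\<Sum>b\<in>B. f (smult V (r b x) b))"
      using B(2) by (intro linear_map_sum[OF V(1) f]) (auto intro: vspace_smult[OF V(1)])
    also have "\<dots> = (\<Sum>b\<in>B. smult W (r b x) (f b))"
      using B(2) by (intro sum.cong refl linear_map_smult[OF f]) auto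
    finally have e: "f x = (\<Sum>b\<in>B. smult W (r b x) (f b))" .
    show ?thesis unfolding e by (intro W.span_sum W.span_scale W.span_base imageI)
  qed
  then show ?thesis using finite_dim_subspace[OF W(1) W(1) refl, of "f ` B"] B(1) W(2) by auto
qed

text \<open>
  The coordinates with respect to a finite basis of \<open>M\<close> embed \<open>M\<close> into \<open>K\<^sup>\<nat>\<close>.
\<close>

lemma coordinate_comodule:
  fixes D :: "('k::field, 'v::ab_group_add) coalgebra" and M :: "('k, 'm::ab_group_add, 'v) comodule"
  assumes D: "precoalgebra D" and M: "comodule D M" and fd: "finite_dim M"
  obtains N where "N \<in> fd_coord_comodules D" "comodule_isomorphic D M N"
proof -
  note vM = comodule_vspace[OF M]
  obtain B r where B: "finite B" "B \<subseteq> carrier M" "\<And>b. b \<in> B \<Longrightarrow> functional M (r b)"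
      "\<And>x. x \<in> carrier M \<Longrightarrow> x = (\<Sum>b\<in>B. smult M (r b x) b)"
    by (rule finite_basis[OF vM fd], rule that)
  obtain e where e: "bij_betw e {0..<card B} B" using ex_bij_betw_nat_finite[OF B(1)] by blast
  define g where "g m i = (if i < card B then r (e i) m else 0)" for m i
  have eB: "e i \<in> B" if "i < card B" for i using e that by (auto simp: bij_betw_def)
  define V :: "('k, nat \<Rightarrow> 'k) vspace" where "V = \<lparr>carrier = g ` carrier M, smult = (\<lambda>a x i. a * x i)\<rparr>"
  have g: "linear_map M V g"
    by (auto simp: linear_map_def V_def g_def fun_eq_iff plus_fun_apply functional_add[OF B(3)[OF eB]]
        functional_smult[OF B(3)[OF eB]])
  have sV: "vector_space (smult V)"
    by unfold_locales (auto simp: V_def fun_eq_iff plus_fun_apply algebra_simps)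
  have vV: "vspace V" by (rule vspace_iso_image[OF vM g _ sV]) (simp add: V_def)
  have "inj_on g (carrier M)"
  proof (rule inj_onI)
    fix x y assume xy: "x \<in> carrier M" "y \<in> carrier M" "g x = g y"
    have "r b x = r b y" if "b \<in> B" for b
    proof -
      have "b \<in> e ` {0..<card B}" using e \<open>b \<in> B\<close> by (simp add: bij_betw_def)
      then obtain i where i: "i < card B" "b = e i" by auto
      show ?thesis using fun_cong[OF xy(3), of i] i by (simp add: g_def)
    qed
    then have "(\<Sum>b\<in>B. smult M (r b x) b) = (\<Sum>b\<in>B. smult M (r b y) b)" by simp
    then show "x = y" using B(4)[OF xy(1)] B(4)[OF xy(2)] by simp
  qed
  then have bij: "bij_betw g (carrier M) (carrier V)" by (simp add: bij_betw_def V_def)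
  obtain N :: "('k, nat \<Rightarrow> 'k, 'v) comodule" where N: "comodule D N" "carrier N = carrier V" "smult N = smult V"
    "comodule_isomorphic D M N"
    by (rule transport_comodule[OF D M vV g bij], rule that)
  have "finite_dim V" by (rule finite_dim_image[OF vM fd g vV]) (simp add: V_def)
  then have "N \<in> fd_coord_comodules D" using N by (simp add: fd_coord_comodules_def finite_dim_def V_def)
  then show thesis using that N(4) by blast
qed

context tower
begin

lemma tensor_of_level:
  assumes M: "vspace M" and t: "t \<in> carrier (tensor_prod M Cinf)"
  obtains n where "t \<in> carrier (tensor_prod M (Cs n))"
proof -
  obtain F r where F: "finite F" "F \<subseteq> carrier Cinf" "\<And>b. functional Cinf (r b)"
    "\<And>b b'. b \<in> F \<Longrightarrow> b' \<in> F \<Longrightarrow> r b b' = (if b = b' then 1 else 0)"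
    "t = (\<Sum>b\<in>F. tens M Cinf (contract M Cinf (r b) t) b)"
    by (rule tensor_expand[OF M vspace_union t], rule that)
  obtain n where n: "F \<subseteq> carrier (Cs n)" using level_of_finite[OF F(1,2)] by blast
  have "(\<Sum>b\<in>F. tens M (Cs n) (contract M Cinf (r b) t) b) \<in> carrier (tensor_prod M (Cs n))"
    using n contract_mem[OF M vspace_union functional_linear_map[OF F(3)] t]
    by (intro vspace_sum[OF vspace_tensor_prod] tens_mem) auto
  then show thesis using that[of n] F(5) tens_cong[of M M "Cs n" Cinf, OF refl smult_level] by simp
qed

lemma tensor_level_mono:
  assumes M: "vspace M" and "m \<le> n"
  shows "carrier (tensor_prod M (Cs m)) \<subseteq> carrier (tensor_prod M (Cs n))"
  by (rule tensor_prod_mono[OF M M subset_refl level_mono[OF assms(2)] refl]) (simp add: smult_level)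

lemma coaction_of_level:
  assumes M: "comodule Cinf M" and fd: "finite_dim M"
  obtains n where "\<And>m. m \<in> carrier M \<Longrightarrow> coact M m \<in> carrier (tensor_prod M (Cs n))"
proof -
  note vM = comodule_vspace[OF M]
  obtain B r where B: "finite B" "B \<subseteq> carrier M" "\<And>b. b \<in> B \<Longrightarrow> functional M (r b)"
      "\<And>x. x \<in> carrier M \<Longrightarrow> x = (\<Sum>b\<in>B. smult M (r b x) b)"
    by (rule finite_basis[OF vM fd], rule that)
  have "\<exists>n. \<forall>b\<in>B. coact M b \<in> carrier (tensor_prod M (Cs n))"
    using B(1,2)
  proof (induction B rule: finite_induct)
    case (insert b B)
    then obtain n where n: "\<forall>b\<in>B. coact M b \<in> carrier (tensor_prod M (Cs n))" by auto
    obtain k where k: "coact M b \<in> carrier (tensor_prod M (Cs k))"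
      by (rule tensor_of_level[OF vM coact_mem[OF M, of b]]) (use insert.prems in auto)
    show ?case
      using n k tensor_level_mono[OF vM, of n "max k n"] tensor_level_mono[OF vM, of k "max k n"]
      by (intro exI[of _ "max k n"]) auto
  qed simp
  then obtain n where n: "\<And>b. b \<in> B \<Longrightarrow> coact M b \<in> carrier (tensor_prod M (Cs n))" by blast
  have "coact M m \<in> carrier (tensor_prod M (Cs n))" if m: "m \<in> carrier M" for m
  proof -
    have "coact M m = coact M (\<Sum>b\<in>B. smult M (r b m) b)" using B(4)[OF m] by simp
    also have "\<dots> = (\<Sum>b\<in>B. coact M (smult M (r b m) b))"
      using B(2) by (intro linear_map_sum[OF vM coact_linear[OF M]]) (auto intro: vspace_smult[OF vM])
    also have "\<dots> = (\<Sum>b\<in>B. tensor_smult (r b m) (coact M b))"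
      using B(2) by (intro sum.cong) (auto simp: linear_map_smult[OF coact_linear[OF M]])
    finally have e: "coact M m = (\<Sum>b\<in>B. tensor_smult (r b m) (coact M b))" .
    show ?thesis
      unfolding e by (rule vspace_sum[OF vspace_tensor_prod]) (use vspace_smult[OF vspace_tensor_prod n] in simp)
  qed
  then show thesis using that by blast
qed

lemma act_level:
  assumes M: "vspace M" and m: "coact M m \<in> carrier (tensor_prod M (Cs n))" and \<psi>: "linear_map Cinf ground \<psi>"
  shows "act (Cs n) M \<psi> m = act Cinf M \<psi> m"
  unfolding act_def
  by (rule contract_subspace[OF M M subset_refl refl vspace_level vspace_union level_subset smult_level \<psi> m])

text \<open>
  The action of functionals is the same over \<open>C\<^sup>(\<^sup>n\<^sup>)\<close> and over \<open>C\<^sub>\<infinity>\<close>, hence so are the laws that it has to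
  satisfy.
\<close>

lemma comodule_level:
  assumes M: "comodule Cinf M" and lev: "\<And>m. m \<in> carrier M \<Longrightarrow> coact M m \<in> carrier (tensor_prod M (Cs n))"
  shows "comodule (Cs n) M"
proof -
  note vM = comodule_vspace[OF M]
  have \<Delta>: "linear_map Cinf (tensor_prod Cinf Cinf) (comult Cinf)" and \<epsilon>: "linear_map Cinf ground (counit Cinf)"
    using precoalgebra_union by (simp_all add: precoalgebra_def)
  have lin: "linear_map M (tensor_prod M (Cs n)) (coact M)"
    using coact_linear[OF M] lev by (simp add: linear_map_def)
  have laws: "act Cinf M (counit Cinf) m = m" "functional Cinf \<psi> \<Longrightarrow> functional Cinf \<chi> \<Longrightarrow>
      act Cinf M \<psi> (act Cinf M \<chi> m) = act Cinf M (\<lambda>c. comult Cinf c \<psi> \<chi>) m"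
    "functional Cinf \<psi> \<Longrightarrow> act Cinf M \<psi> m \<in> carrier M" if "m \<in> carrier M" for m \<psi> \<chi>
    using M that linear_map_mem[OF act_linear[OF vspace_union vM coact_linear[OF M] functional_linear_map] that, of \<psi>]
    unfolding comodule_iff_act[OF precoalgebra_union] by blast+
  have "act (Cs n) M (counit (Cs n)) m = act Cinf M (counit Cinf) m"
    "act (Cs n) M (\<lambda>c. comult (Cs n) c \<psi> \<chi>) m = act Cinf M (\<lambda>c. comult Cinf c \<psi> \<chi>) m" if m: "m \<in> carrier M" for m \<psi> \<chi>
    unfolding act_level[OF vM lev[OF m] \<epsilon>, symmetric] act_level[OF vM lev[OF m] linear_map_convolution[OF \<Delta>], symmetric]
    unfolding act_def
    by (rule contract_cong[OF vM vspace_level _ _ lev[OF m]];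
        simp add: union_counit union_comult level_counit_linear linear_map_convolution[OF level_comult_linear])+
  moreover have "act (Cs n) M \<psi> m = act Cinf M \<psi> m" if "functional Cinf \<psi>" "m \<in> carrier M" for \<psi> m
    by (rule act_level[OF vM lev[OF that(2)] functional_linear_map[OF that(1)]])
  ultimately show ?thesis
    unfolding comodule_iff_act[OF precoalgebra_level] smult_level
    using vM lin laws by simp
qed

lemma vspace_regular: "vspace (regular_comodule Cinf)"
  using vspace_union by (simp add: vspace_def regular_comodule_def)

lemma coact_regular_image:
  "coact (regular_comodule Cinf) ` carrier (regular_comodule Cinf) \<subseteq> carrier (tensor_prod (regular_comodule Cinf) Cinf)"
  using precoalgebra_union tensor_prod_cong[of "regular_comodule Cinf" Cinf Cinf Cinf]
  by (auto simp: precoalgebra_def linear_map_def regular_comodule_def)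

text \<open>
  The quotient map is the composite \<open>C\<^sub>\<infinity> \<rightarrow> C\<^sup>(\<^sup>n\<^sup>+\<^sup>1\<^sup>) \<rightarrow> L \<rightarrow> M\<close> of the retraction, the projection on the
  summand of \<open>C\<^sup>(\<^sup>n\<^sup>+\<^sup>1\<^sup>)\<close> belonging to the representative \<open>L\<close> of the isomorphism type of \<open>M\<close> as a
  \<open>C\<^sup>(\<^sup>n\<^sup>)\<close>-comodule, and an isomorphism of \<open>C\<^sup>(\<^sup>n\<^sup>)\<close>-comodules.
\<close>

theorem finite_dim_quotient:
  fixes M :: "('k, 'm::ab_group_add, 'v) comodule"
  assumes M: "comodule Cinf M" and fd: "finite_dim M"
  shows "is_quotient Cinf M (regular_comodule Cinf)"
proof -
  note vM = comodule_vspace[OF M]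
  obtain n where lev: "\<And>m. m \<in> carrier M \<Longrightarrow> coact M m \<in> carrier (tensor_prod M (Cs n))"
    by (rule coaction_of_level[OF M fd], rule that)
  let ?D = "Cs n"
  have Mn: "comodule ?D M" by (rule comodule_level[OF M lev])
  obtain N where N: "N \<in> fd_coord_comodules ?D" "comodule_isomorphic ?D M N"
    by (rule coordinate_comodule[OF precoalgebra_level Mn fd], rule that)
  have cN: "comodule ?D N" using N(1) by (simp add: fd_coord_comodules_def)
  obtain L where L: "L \<in> R n" "comodule_isomorphic ?D N L"
    using representatives_level[of n] N(1) unfolding representatives_def by blast
  have cL: "comodule ?D L" by (rule representatives_coord[OF representatives_level L(1)])
  have "comodule_isomorphic ?D L M"
    by (rule comodule_isomorphic_sym[OF vspace_level Mn cL
          comodule_isomorphic_trans[OF vspace_level Mn cN N(2) L(2)]])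
  then obtain h where h: "comodule_hom ?D L M h" "h ` carrier L = carrier M"
    unfolding comodule_isomorphic_def bij_betw_def by blast
  have h_lin: "linear_map L M h" and
    h_act: "\<And>y \<psi>. y \<in> carrier L \<Longrightarrow> functional Cinf \<psi> \<Longrightarrow> act ?D M \<psi> (h y) = h (act ?D L \<psi> y)"
    using h(1) unfolding comodule_hom_iff_act[OF vspace_level comodule_vspace[OF cL] vM coact_image[OF cL] coact_image[OF Mn]]
      smult_level by blast+
  obtain q where q: "linear_map (Cs (Suc n)) L q" "q ` carrier (Cs (Suc n)) = carrier L"
    "\<And>x \<psi>. x \<in> carrier (Cs (Suc n)) \<Longrightarrow> functional Cinf \<psi> \<Longrightarrow> q (reg_act \<psi> x) = act ?D L \<psi> (q x)"
    using step_project[OF L(1)] reg_act_level[of _ "Suc n"] by auto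
  obtain p where p: "linear_map Cinf (Cs (Suc n)) p" "\<And>c. c \<in> carrier (Cs (Suc n)) \<Longrightarrow> p c = c"
    "\<And>c \<psi>. c \<in> carrier Cinf \<Longrightarrow> functional Cinf \<psi> \<Longrightarrow> p (reg_act \<psi> c) = reg_act \<psi> (p c)"
    by (rule level_retraction[of "Suc n"], rule that)
  let ?f = "\<lambda>c. h (q (p c))"
  note pq = linear_map_comp[OF p(1) q(1)]
  have "linear_map (regular_comodule Cinf) M ?f"
    using linear_map_comp[OF pq h_lin] by (simp add: linear_map_def regular_comodule_def)
  moreover have "act Cinf M \<psi> (?f c) = ?f (reg_act \<psi> c)"
    if c: "c \<in> carrier (regular_comodule Cinf)" and \<psi>: "functional Cinf \<psi>" for c \<psi>
  proof -
    have c': "c \<in> carrier Cinf" using c by (simp add: regular_comodule_def)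
    note pc = linear_map_mem[OF p(1) c']
    note qpc = linear_map_mem[OF q(1) pc]
    have "?f (reg_act \<psi> c) = act ?D M \<psi> (?f c)"
      unfolding p(3)[OF c' \<psi>] q(3)[OF pc \<psi>] h_act[OF qpc \<psi>] ..
    also have "\<dots> = act Cinf M \<psi> (?f c)"
      by (rule act_level[OF vM lev[OF linear_map_mem[OF h_lin qpc]] functional_linear_map[OF \<psi>]])
    finally show ?thesis by simp
  qed
  ultimately have "comodule_hom Cinf (regular_comodule Cinf) M ?f"
    unfolding comodule_hom_iff_act[OF vspace_union vspace_regular vM coact_regular_image coact_image[OF M]] by blast
  moreover have "?f ` carrier (regular_comodule Cinf) = carrier M"
  proof -
    have "p ` carrier Cinf = carrier (Cs (Suc n))"
    proof
      show "p ` carrier Cinf \<subseteq> carrier (Cs (Suc n))" using linear_map_mem[OF p(1)] by (rule image_subsetI)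
      show "carrier (Cs (Suc n)) \<subseteq> p ` carrier Cinf"
        using p(2) level_subset by (intro subsetI image_eqI[of _ p]) (auto simp: subset_iff)
    qed
    then have "h ` q ` p ` carrier Cinf = carrier M" using q(2) h(2) by simp
    then show ?thesis by (simp add: regular_comodule_def image_image)
  qed
  ultimately show ?thesis unfolding is_quotient_def by blast
qed

end


section \<open>Arbitrary comodules and direct sums\<close>

lemma vspace_copies_space:
  assumes M: "vspace M"
  shows "vspace (copies_space I M)"
proof (rule vspaceI)
  interpret M: vector_space "smult M" using M by (simp add: vspace_def)
  show "vector_space (smult (copies_space I M))"
    by unfold_locales
      (simp_all add: copies_space_def fun_eq_iff plus_fun_apply M.scale_right_distrib M.scale_left_distrib)
  show "0 \<in> carrier (copies_space I M)"
    by (simp add: copies_space_def zero_fun_apply vspace_zero[OF M])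
  show "x + y \<in> carrier (copies_space I M)"
    if "x \<in> carrier (copies_space I M)" "y \<in> carrier (copies_space I M)" for x y
    using that finite_support_add[of x y] by (auto simp: copies_space_def plus_fun_apply vspace_add[OF M])
  show "smult (copies_space I M) a x \<in> carrier (copies_space I M)" if "x \<in> carrier (copies_space I M)" for a x
    using that by (auto simp: copies_space_def vspace_smult[OF M] elim!: rev_finite_subset)
qed

lemma linear_single:
  assumes M: "vspace M" and i: "i \<in> I"
  shows "linear_map M (copies_space I M) (single i)"
  by (rule linear_mapI)
    (use i vspace_zero[OF M] smult_zero_right[OF M] finite_support_single[of i] in
      \<open>auto simp: copies_space_def single_simps, auto simp: single_def\<close>)

lemma linear_copies_sum:
  assumes M: "vspace M" and N: "vspace N" and f: "\<And>i. i \<in> I \<Longrightarrow> linear_map M N (f i)"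
  shows "linear_map (copies_space I M) N (\<lambda>x. \<Sum>i | x i \<noteq> 0. f i (x i))"
  by (rule linear_map_support_sum[OF N M f _ _ _ _ _ vspace_copies_space[OF M]])
    (auto simp: copies_space_def plus_fun_apply)

text \<open>
  The maps \<open>f i\<close> induce the map \<open>x \<mapsto> \<Sum> f i (x i)\<close> on the direct sum, which extends each of them and is
  therefore surjective as soon as their images cover \<open>N\<close>.
\<close>

lemma copies_quotient:
  fixes C :: "('k::field, 'v::ab_group_add) coalgebra" and M :: "('k, 'm::ab_group_add, 'v) comodule"
    and N :: "('k, 'n::ab_group_add, 'v) comodule"
  assumes C: "vspace C" and M: "vspace M" and N: "comodule C N"
    and rM': "coact M ` carrier M \<subseteq> carrier (tensor_prod M C)"
    and hom: "\<And>i. i \<in> I \<Longrightarrow> comodule_hom C M N (f i)"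
    and cover: "\<And>y. y \<in> carrier N \<Longrightarrow> \<exists>i\<in>I. y \<in> f i ` carrier M"
  shows "is_quotient C N (copies C I M)"
proof -
  let ?S = "copies_space I M" and ?K = "copies C I M"
  note vN = comodule_vspace[OF N]
  have rM: "coact M m \<in> carrier (tensor_prod M C)" if "m \<in> carrier M" for m using rM' that by auto
  note vS = vspace_copies_space[OF M, of I]
  have S: "carrier ?K = carrier ?S" "smult ?K = smult ?S" by (simp_all add: copies_def)
  have vK: "vspace ?K" using vS by (simp add: vspace_def S)
  have tp: "tensor_prod ?K C = tensor_prod ?S C" by (rule tensor_prod_cong) (simp_all add: S)
  have f: "linear_map M N (f i)"
    "\<And>m \<psi>. m \<in> carrier M \<Longrightarrow> functional C \<psi> \<Longrightarrow> act C N \<psi> (f i m) = f i (act C M \<psi> m)" if "i \<in> I" for i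
    using hom[OF that] unfolding comodule_hom_iff_act[OF C M vN rM' coact_image[OF N]] by blast+
  define F where "F x = (\<Sum>i | x i \<noteq> 0. f i (x i))" for x
  have F: "linear_map ?S N F" unfolding F_def[abs_def] by (rule linear_copies_sum[OF M vN f(1)])
  have F_single: "F (single i y) = f i y" if i: "i \<in> I" for i y
  proof -
    have "F (single i y) = (\<Sum>j\<in>{i}. f j (single i y j))"
      unfolding F_def
      by (rule sum_on_support) (use i linear_map_zero[OF M f(1)] in \<open>auto simp: single_def\<close>)
    then show ?thesis by (simp add: single_def)
  qed
  have supp: "i \<in> I \<and> x i \<in> carrier M" if "x \<in> carrier ?S" "x i \<noteq> 0" for x i
    using that by (auto simp: copies_space_def)
  have part: "tensor_map M C ?S C (single i) id (coact M (x i)) \<in> carrier (tensor_prod ?S C)"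
    if "x \<in> carrier ?S" "x i \<noteq> 0" for x i
  proof -
    have i: "i \<in> I" "x i \<in> carrier M" using supp[OF that] by auto
    show ?thesis by (rule linear_map_mem[OF tensor_map_linear[OF M C linear_single[OF M i(1)] linear_map_id] rM[OF i(2)]])
  qed
  have coact_K: "coact ?K x = (\<Sum>i | x i \<noteq> 0. tensor_map M C ?S C (single i) id (coact M (x i)))" for x
    by (simp add: copies_def)
  have rK: "coact ?K x \<in> carrier (tensor_prod ?K C)" if "x \<in> carrier ?K" for x
    unfolding tp coact_K by (rule vspace_sum[OF vspace_tensor_prod]) (use part that in \<open>simp add: S\<close>)
  have act_K: "act C ?K \<psi> x = (\<Sum>i | x i \<noteq> 0. single i (act C M \<psi> (x i)))"
    if x: "x \<in> carrier ?S" and \<psi>: "functional C \<psi>" for x \<psi>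
  proof -
    have "act C ?K \<psi> x = contract ?S C \<psi> (\<Sum>i | x i \<noteq> 0. tensor_map M C ?S C (single i) id (coact M (x i)))"
      unfolding act_def coact_K by (simp only: contract_cong_space[of ?K ?S C C, OF S refl refl])
    also have "\<dots> = (\<Sum>i | x i \<noteq> 0. contract ?S C \<psi> (tensor_map M C ?S C (single i) id (coact M (x i))))"
      using part[OF x] by (intro linear_map_sum[OF vspace_tensor_prod contract_linear[OF vS C functional_linear_map[OF \<psi>]]]) auto
    also have "\<dots> = (\<Sum>i | x i \<noteq> 0. single i (act C M \<psi> (x i)))"
    proof (rule sum.cong[OF refl])
      fix i assume "i \<in> {i. x i \<noteq> 0}"
      then have i: "i \<in> I" "x i \<in> carrier M" using supp[OF x, of i] by auto
      show "contract ?S C \<psi> (tensor_map M C ?S C (single i) id (coact M (x i))) = single i (act C M \<psi> (x i))"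
        using contract_tensor_map[OF M C vS C linear_single[OF M i(1)] linear_map_id functional_linear_map[OF \<psi>] rM[OF i(2)]]
        by (simp add: act_def)
    qed
    finally show ?thesis .
  qed
  have "act C N \<psi> (F x) = F (act C ?K \<psi> x)" if x: "x \<in> carrier ?S" and \<psi>: "functional C \<psi>" for x \<psi>
  proof -
    have actM: "act C M \<psi> m \<in> carrier M" if "m \<in> carrier M" for m
      unfolding act_def by (rule contract_mem[OF M C functional_linear_map[OF \<psi>] rM[OF that]])
    have i: "i \<in> I" "x i \<in> carrier M" if "x i \<noteq> 0" for i using supp[OF x that] by auto
    have "F (act C ?K \<psi> x) = (\<Sum>i | x i \<noteq> 0. F (single i (act C M \<psi> (x i))))"
      unfolding act_K[OF x \<psi>]
      by (rule linear_map_sum[OF vS F]) (use i actM in \<open>auto intro!: linear_map_mem[OF linear_single[OF M]]\<close>)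
    also have "\<dots> = (\<Sum>i | x i \<noteq> 0. act C N \<psi> (f i (x i)))"
      using i by (intro sum.cong refl) (auto simp: F_single f(2) \<psi>)
    also have "\<dots> = act C N \<psi> (F x)"
    proof -
      have mem: "f i (x i) \<in> carrier N" if "x i \<noteq> 0" for i using linear_map_mem[OF f(1)] i[OF that] by blast
      have "linear_map N N (act C N \<psi>)"
        by (rule act_linear[OF C vN coact_linear[OF N] functional_linear_map[OF \<psi>]])
      from linear_map_sum[OF vN this, of "{i. x i \<noteq> 0}" "\<lambda>i. f i (x i)"]
      show ?thesis unfolding F_def using mem by simp
    qed
    finally show ?thesis by simp
  qed
  then have "comodule_hom C ?K N F"
    using comodule_hom_iff_act[OF C vK vN _ coact_image[OF N], of F] rK F by (auto simp: linear_map_def S)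
  moreover have "F ` carrier ?K = carrier N"
  proof
    show "F ` carrier ?K \<subseteq> carrier N" using linear_map_mem[OF F] by (auto simp: S)
    show "carrier N \<subseteq> F ` carrier ?K"
    proof
      fix y assume "y \<in> carrier N"
      then obtain i m where im: "i \<in> I" "m \<in> carrier M" "y = f i m" using cover by blast
      \<comment> \<open>an element in the image of \<open>f i\<close> comes from the \<open>i\<close>-th copy\<close>
      show "y \<in> F ` carrier ?K"
        by (rule image_eqI[of _ F "single i m"])
          (use im F_single linear_map_mem[OF linear_single[OF M im(1)] im(2)] in \<open>simp_all add: S\<close>)
    qed
  qed
  ultimately show ?thesis unfolding is_quotient_def by blast
qed

text \<open>
  Every element \<open>m\<close> of \<open>M\<close> lies in a finite dimensional subcomodule, that is, in the image of a comodule map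
  \<open>f m\<close> from \<open>C\<^sub>\<infinity>\<close>. The carrier of \<open>M\<close> itself serves as the index set.
\<close>

theorem (in tower) quotient_of_copies:
  fixes M :: "('k, 'n::ab_group_add, 'v) comodule"
  assumes M: "comodule Cinf M"
  shows "\<exists>I :: 'n set. is_quotient Cinf M (copies Cinf I (regular_comodule Cinf))"
proof -
  note vM = comodule_vspace[OF M]
  have "\<exists>f. comodule_hom Cinf (regular_comodule Cinf) M f \<and> m \<in> f ` carrier (regular_comodule Cinf)"
    if m: "m \<in> carrier M" for m
  proof -
    obtain N :: "('k, 'n, 'v) comodule" where N: "comodule Cinf N" "finite_dim N" "m \<in> carrier N"
      "carrier N \<subseteq> carrier M" "smult N = smult M" "coact N = coact M"
      by (rule finite_dim_subcomodule[OF precoalgebra_union M m], rule that)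
    obtain f where f: "comodule_hom Cinf (regular_comodule Cinf) N f"
      "f ` carrier (regular_comodule Cinf) = carrier N"
      using finite_dim_quotient[OF N(1,2)] unfolding is_quotient_def by blast
    have "tensor_map (regular_comodule Cinf) Cinf N Cinf = tensor_map (regular_comodule Cinf) Cinf M Cinf"
      by (rule tensor_map_cong) (simp_all add: N)
    then have "comodule_hom Cinf (regular_comodule Cinf) M f"
      using f(1) N(4-6) by (auto simp: comodule_hom_def linear_map_def)
    then show ?thesis using f(2) N(3) by blast
  qed
  then have "\<forall>m\<in>carrier M. \<exists>f. comodule_hom Cinf (regular_comodule Cinf) M f \<and> m \<in> f ` carrier (regular_comodule Cinf)"
    by blast
  from bchoice[OF this] obtain f where
    "\<forall>m\<in>carrier M. comodule_hom Cinf (regular_comodule Cinf) M (f m) \<and> m \<in> f m ` carrier (regular_comodule Cinf)"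
    by blast
  then have "is_quotient Cinf M (copies Cinf (carrier M) (regular_comodule Cinf))"
    by (intro copies_quotient[OF vspace_union vspace_regular M coact_regular_image, of _ f]) blast+
  then show ?thesis by blast
qed

theorem theorem4p2:
  fixes C :: "('k::field, 'c::ab_group_add) coalgebra"
    and R :: "nat \<Rightarrow> ('k, 'v::ab_group_add) coord_comodule set"
    and Cs :: "nat \<Rightarrow> ('k, 'v) coalgebra"
    and Cinf :: "('k, 'v) coalgebra"
  assumes "coalgebra C"
    and "is_tower C R Cs"
    and "Cinf = union_coalgebra Cs"
  shows "(\<forall>M :: ('k, 'm::ab_group_add, 'v) comodule.
            comodule Cinf M \<and> finite_dim M \<longrightarrow> is_quotient Cinf M (regular_comodule Cinf)) \<and>
         (\<forall>M :: ('k, 'n::ab_group_add, 'v) comodule.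
            comodule Cinf M \<longrightarrow>
              (\<exists>I :: 'n set. is_quotient Cinf M (copies Cinf I (regular_comodule Cinf))))"
proof -
  interpret tower C R Cs using assms(1,2) by (rule tower.intro)
  show ?thesis unfolding assms(3) using finite_dim_quotient quotient_of_copies by blast
qed

end
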